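(* Let $\mathcal H$ be an internal complex Hilbert space. The following are equivalent: (i) $\dim\mathcal H\in\mathbb N$ (i.e. the internal dimension of $\mathcal H$ is a standard natural number); (ii) $\widehat{\mathcal B(\mathcal H)}=\mathcal B(\widehat{\mathcal H})$; (iii) $\widehat{\mathcal B(\mathcal H)}$ is a von Neumann algebra.
   Context: Work in a nonstandard universe (in the sense of Robinson's nonstandard analysis) that is $\kappa$-saturated for a sufficiently large uncountable cardinal $\kappa$. $\mathcal B(\mathcal H)$ is the internal algebra of internally bounded linear operators on $\mathcal H$. For $r,s\in{}^*\mathbb R$, $r\approx s$ means $|r-s|<1/n$ for all standard $n\ge1$; $r$ is finite if $|r|<n$ for some standard $n$; ${}^\circ r$ is the standard part of a finite $r$. For an internal normed space $X$ (such as $\mathcal B(\mathcal H)$ or $\mathcal H$), $\mathrm{Fin}(X)=\{x\in X:\|x\|\text{ finite}\}$, $x\approx y$ means $\|x-y\|\approx0$, $\widehat x=\{y\in X:y\approx x\}$, and the nonstandard hull is $\widehat X=\{\widehat x:x\in\mathrm{Fin}(X)\}$ with operations induced from representatives and $\|\widehat x\|={}^\circ\|x\|$. Then $\widehat{\mathcal H}$ is an ordinary Hilbert space with inner product $\langle\widehat x,\widehat y\rangle={}^\circ\langle x,y\rangle$, and $\widehat{\mathcal B(\mathcal H)}$ is an ordinary $C^*$-algebra regarded as a $C^*$-subalgebra of $\mathcal B(\widehat{\mathcal H})$ via $\widehat a(\widehat x)=\widehat{a(x)}$. "Is a von Neumann algebra" means closed in $\mathcal B(\widehat{\mathcal H})$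 in the strong (equivalently weak) operator topology. *)

theory Defs
  imports "HOL-Analysis.Analysis"
begin

unbundle cardinal_syntax

section \<open>Ordinary complex Hilbert spaces on a carrier set\<close>

text \<open>
  Carrier sets instead of types: the same notions are applied to the Hilbert spaces that are
  elements of the standard universe and to the nonstandard hull, whose points are sets.
  All operations are only meaningful on the carrier.
\<close>

record 'a ips =
  car :: "'a set"
  add :: "'a \<Rightarrow> 'a \<Rightarrow> 'a"
  scl :: "complex \<Rightarrow> 'a \<Rightarrow> 'a"
  inn :: "'a \<Rightarrow> 'a \<Rightarrow> complex"

definition complex_vector_space_on :: "'a ips \<Rightarrow> bool" where
  "complex_vector_space_on S \<longleftrightarrow>
     (\<forall>x\<in>car S. \<forall>y\<in>car S. add S x y \<in> car S) \<and>
     (\<forall>c. \<forall>x\<in>car S. scl S c x \<in> car S) \<and>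
     (\<forall>x\<in>car S. \<forall>y\<in>car S. add S x y = add S y x) \<and>
     (\<forall>x\<in>car S. \<forall>y\<in>car S. \<forall>z\<in>car S. add S (add S x y) z = add S x (add S y z)) \<and>
     (\<exists>z\<in>car S. (\<forall>x\<in>car S. add S z x = x) \<and> (\<forall>x\<in>car S. \<exists>y\<in>car S. add S x y = z)) \<and>
     (\<forall>x\<in>car S. scl S 1 x = x) \<and>
     (\<forall>c d. \<forall>x\<in>car S. scl S c (scl S d x) = scl S (c * d) x) \<and>
     (\<forall>c d. \<forall>x\<in>car S. scl S (c + d) x = add S (scl S c x) (scl S d x)) \<and>
     (\<forall>c. \<forall>x\<in>car S. \<forall>y\<in>car S. scl S c (add S x y) = add S (scl S c x) (scl S c y))"

definition hsub :: "'a ips \<Rightarrow> 'a \<Rightarrow> 'a \<Rightarrow> 'a" where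
  "hsub S x y = add S x (scl S (- 1) y)"

definition inner_product_space_on :: "'a ips \<Rightarrow> bool" where
  "inner_product_space_on S \<longleftrightarrow>
     complex_vector_space_on S \<and>
     (\<forall>x\<in>car S. \<forall>y\<in>car S. \<forall>z\<in>car S. inn S (add S x y) z = inn S x z + inn S y z) \<and>
     (\<forall>c. \<forall>x\<in>car S. \<forall>y\<in>car S. inn S (scl S c x) y = c * inn S x y) \<and>
     (\<forall>x\<in>car S. \<forall>y\<in>car S. inn S y x = cnj (inn S x y)) \<and>
     (\<forall>x\<in>car S. inn S x x \<in> \<real> \<and> 0 \<le> Re (inn S x x)) \<and>
     (\<forall>x\<in>car S. inn S x x = 0 \<longrightarrow> x = hsub S x x)"

definition hnorm :: "'a ips \<Rightarrow> 'a \<Rightarrow> real" where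
  "hnorm S x = sqrt (Re (inn S x x))"

text \<open>The value off the carrier is fixed because \<^locale>\<open>Metric_space\<close> asks for symmetry and
  nonnegativity of the distance on the whole type.\<close>

definition hdist :: "'a ips \<Rightarrow> 'a \<Rightarrow> 'a \<Rightarrow> real" where
  "hdist S x y = (if x \<in> car S \<and> y \<in> car S then hnorm S (hsub S x y) else 0)"

definition hilbert_space_on :: "'a ips \<Rightarrow> bool" where
  "hilbert_space_on S \<longleftrightarrow>
     inner_product_space_on S \<and> Metric_space.mcomplete (car S) (hdist S)"

definition bounded_ops :: "'a ips \<Rightarrow> ('a \<Rightarrow> 'a) set" where
  "bounded_ops S =
     {T \<in> car S \<rightarrow>\<^sub>E car S.
        (\<forall>x\<in>car S. \<forall>y\<in>car S. T (add S x y) = add S (T x) (T y)) \<and>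
        (\<forall>c. \<forall>x\<in>car S. T (scl S c x) = scl S c (T x)) \<and>
        (\<exists>M. \<forall>x\<in>car S. hnorm S (T x) \<le> M * hnorm S x)}"

definition op_norm :: "'a ips \<Rightarrow> ('a \<Rightarrow> 'a) \<Rightarrow> real" where
  "op_norm S T = (SUP x\<in>{x \<in> car S. hnorm S x \<le> 1}. hnorm S (T x))"

definition op_sub :: "'a ips \<Rightarrow> ('a \<Rightarrow> 'a) \<Rightarrow> ('a \<Rightarrow> 'a) \<Rightarrow> ('a \<Rightarrow> 'a)" where
  "op_sub S T T' = (\<lambda>x\<in>car S. hsub S (T x) (T' x))"

text \<open>Strong operator topology: pointwise norm convergence, that is, the topology induced on the
  bounded operators by the product of \<open>car S\<close> copies of the normed space.\<close>

definition strong_operator_topology :: "'a ips \<Rightarrow> ('a \<Rightarrow> 'a) topology" where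
  "strong_operator_topology S =
     subtopology
       (product_topology (\<lambda>_. Metric_space.mtopology (car S) (hdist S)) (car S))
       (bounded_ops S)"

definition orthonormal_on :: "'a ips \<Rightarrow> 'a set \<Rightarrow> bool" where
  "orthonormal_on S B \<longleftrightarrow>
     B \<subseteq> car S \<and> (\<forall>x\<in>B. \<forall>y\<in>B. inn S x y = (if x = y then 1 else 0))"

definition orthonormal_basis_on :: "'a ips \<Rightarrow> 'a set \<Rightarrow> bool" where
  "orthonormal_basis_on S B \<longleftrightarrow>
     orthonormal_on S B \<and> (\<forall>B'. orthonormal_on S B' \<and> B \<subseteq> B' \<longrightarrow> B' = B)"

definition has_hilbert_dim :: "'a ips \<Rightarrow> nat \<Rightarrow> bool" where
  "has_hilbert_dim S n \<longleftrightarrow> (\<exists>B. orthonormal_basis_on S B \<and> finite B \<and> card B = n)"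


section \<open>Nonstandard universes\<close>

text \<open>Bounded formulas of set theory; \<open>BEx i j \<phi>\<close> is \<open>\<exists>v\<^sub>i\<in>v\<^sub>j. \<phi>\<close>.\<close>

datatype bounded_fm =
    Mem nat nat
  | Equ nat nat
  | Neg bounded_fm
  | Conj bounded_fm bounded_fm
  | BEx nat nat bounded_fm

primrec sat :: "('a \<Rightarrow> 'a \<Rightarrow> bool) \<Rightarrow> bounded_fm \<Rightarrow> (nat \<Rightarrow> 'a) \<Rightarrow> bool" where
  "sat E (Mem i j) e \<longleftrightarrow> E (e i) (e j)"
| "sat E (Equ i j) e \<longleftrightarrow> e i = e j"
| "sat E (Neg \<phi>) e \<longleftrightarrow> \<not> sat E \<phi> e"
| "sat E (Conj \<phi> \<psi>) e \<longleftrightarrow> sat E \<phi> e \<and> sat E \<psi> e"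
| "sat E (BEx i j \<phi>) e \<longleftrightarrow> (\<exists>x. E x (e j) \<and> sat E \<phi> (e(i := x)))"

text \<open>
  \<open>'u\<close> is the standard universe, with membership \<open>mem\<close> and with the complex numbers, embedded by
  \<open>cpx\<close>, among its atoms. \<open>'v\<close> is the nonstandard universe, with membership \<open>smem\<close>.
\<close>

record ('u, 'v) universe =
  atoms :: "'u set"
  cpx :: "complex \<Rightarrow> 'u"
  mem :: "'u \<Rightarrow> 'u \<Rightarrow> bool"
  smem :: "'v \<Rightarrow> 'v \<Rightarrow> bool"
  star :: "'u \<Rightarrow> 'v"

primrec level :: "('u, 'v) universe \<Rightarrow> nat \<Rightarrow> 'u set" where
  "level U 0 = atoms U"
| "level U (Suc n) = level U n \<union> {a. a \<notin> atoms U \<and> (\<forall>x. mem U x a \<longrightarrow> x \<in> level U n)}"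

text \<open>
  The superstructure over the atoms, cut off at height \<open>h\<close>. For \<open>h = \<infinity>\<close> this is the full
  superstructure, the union of all \<open>level U n\<close>. A finite \<open>h\<close> is allowed as well because a type
  that carries a full superstructure over an infinite set cannot be constructed in HOL.
\<close>

definition superstructure :: "enat \<Rightarrow> ('u, 'v) universe \<Rightarrow> bool" where
  "superstructure h U \<longleftrightarrow>
     (\<forall>a\<in>atoms U. \<forall>x. \<not> mem U x a) \<and>
     (\<forall>a b. a \<notin> atoms U \<and> b \<notin> atoms U \<and> (\<forall>x. mem U x a \<longleftrightarrow> mem U x b) \<longrightarrow> a = b) \<and>
     (\<forall>n A. enat n < h \<and> A \<subseteq> level U n \<longrightarrow> (\<exists>a. a \<notin> atoms U \<and> {x. mem U x a} = A)) \<and>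
     (\<forall>x. \<exists>n. enat n \<le> h \<and> x \<in> level U n)"

definition transfer_principle :: "('u, 'v) universe \<Rightarrow> bool" where
  "transfer_principle U \<longleftrightarrow> (\<forall>\<phi> e. sat (mem U) \<phi> e \<longleftrightarrow> sat (smem U) \<phi> (star U \<circ> e))"

definition internal :: "('u, 'v) universe \<Rightarrow> 'v \<Rightarrow> bool" where
  "internal U v \<longleftrightarrow> (\<exists>a. smem U v (star U a))"

definition saturated :: "'k rel \<Rightarrow> ('u, 'v) universe \<Rightarrow> bool" where
  "saturated \<kappa> U \<longleftrightarrow>
     (\<forall>F. (\<forall>A\<in>F. internal U A) \<and> |F| <o \<kappa> \<and>
          (\<forall>G\<subseteq>F. finite G \<longrightarrow> (\<exists>x. \<forall>A\<in>G. smem U x A))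
        \<longrightarrow> (\<exists>x. \<forall>A\<in>F. smem U x A))"

definition nonstandard_universe :: "enat \<Rightarrow> 'k rel \<Rightarrow> ('u, 'v) universe \<Rightarrow> bool" where
  "nonstandard_universe h \<kappa> U \<longleftrightarrow>
     superstructure h U \<and> inj (cpx U) \<and> range (cpx U) \<subseteq> atoms U \<and>
     transfer_principle U \<and> saturated \<kappa> U"


section \<open>Nonstandard extensions of relations and functions\<close>

text \<open>Kuratowski pairs. The components are required to be members of the pair, so that for an
  internal \<open>p\<close> only internal objects are involved.\<close>

definition is_pair :: "('a \<Rightarrow> 'a \<Rightarrow> bool) \<Rightarrow> 'a \<Rightarrow> 'a \<Rightarrow> 'a \<Rightarrow> bool" where
  "is_pair E p x y \<longleftrightarrow>
     (\<exists>s d. (\<forall>z. E z s \<longleftrightarrow> z = x) \<and> (\<forall>z. E z d \<longleftrightarrow> z = x \<or> z = y) \<and>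
            (\<forall>z. E z p \<longleftrightarrow> z = s \<or> z = d))"

fun is_tuple :: "('a \<Rightarrow> 'a \<Rightarrow> bool) \<Rightarrow> 'a \<Rightarrow> 'a list \<Rightarrow> bool" where
  "is_tuple E p [] \<longleftrightarrow> False"
| "is_tuple E p [x] \<longleftrightarrow> p = x"
| "is_tuple E p (x # y # zs) \<longleftrightarrow> (\<exists>q. is_pair E p x q \<and> is_tuple E q (y # zs))"

text \<open>The extension of an \<open>n\<close>-ary relation \<open>R\<close> (a set of lists of length \<open>n\<close>) is the union of
  the extensions of all standard sets of \<open>n\<close>-tuples in \<open>R\<close>. Hence \<open>R\<close> may be a proper class of the
  superstructure, such as the class of all Hilbert spaces.\<close>

definition star_rel :: "('u, 'v) universe \<Rightarrow> 'u list set \<Rightarrow> 'v list \<Rightarrow> bool" where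
  "star_rel U R vs \<longleftrightarrow>
     (\<exists>a p. (\<forall>q. mem U q a \<longrightarrow> (\<exists>us\<in>R. is_tuple (mem U) q us)) \<and>
            smem U p (star U a) \<and> is_tuple (smem U) p vs)"

text \<open>For the graph \<open>R\<close> of a function (value last).\<close>

definition star_fun :: "('u, 'v) universe \<Rightarrow> 'u list set \<Rightarrow> 'v list \<Rightarrow> 'v" where
  "star_fun U R vs = (THE w. star_rel U R (vs @ [w]))"

abbreviation rl :: "('u, 'v) universe \<Rightarrow> real \<Rightarrow> 'u" where
  "rl U r \<equiv> cpx U (complex_of_real r)"

definition hless :: "('u, 'v) universe \<Rightarrow> 'v \<Rightarrow> 'v \<Rightarrow> bool" where
  "hless U r s \<longleftrightarrow> star_rel U {[rl U a, rl U b] | a b. a < b} [r, s]"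

definition hminus :: "('u, 'v) universe \<Rightarrow> 'v \<Rightarrow> 'v \<Rightarrow> 'v" where
  "hminus U v w = star_fun U {[cpx U c, cpx U d, cpx U (c - d)] | c d. True} [v, w]"

definition habs :: "('u, 'v) universe \<Rightarrow> 'v \<Rightarrow> 'v" where
  "habs U v = star_fun U {[cpx U c, rl U (cmod c)] | c. True} [v]"

definition happrox :: "('u, 'v) universe \<Rightarrow> 'v \<Rightarrow> 'v \<Rightarrow> bool" where
  "happrox U v w \<longleftrightarrow>
     (\<forall>n::nat. 1 \<le> n \<longrightarrow> hless U (habs U (hminus U v w)) (star U (rl U (1 / real n))))"

definition hfinite :: "('u, 'v) universe \<Rightarrow> 'v \<Rightarrow> bool" where
  "hfinite U v \<longleftrightarrow> (\<exists>n::nat. hless U (habs U v) (star U (rl U (real n))))"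

definition standard_part :: "('u, 'v) universe \<Rightarrow> 'v \<Rightarrow> complex" where
  "standard_part U v = (THE c. happrox U v (star U (cpx U c)))"


section \<open>Internal Hilbert spaces\<close>

text \<open>\<open>q\<close> is the tuple of the carrier and of the graphs of the operations of the Hilbert space
  \<open>S\<close>.\<close>

definition codes_hilbert :: "('u, 'v) universe \<Rightarrow> 'u \<Rightarrow> 'u ips \<Rightarrow> bool" where
  "codes_hilbert U q S \<longleftrightarrow>
     hilbert_space_on S \<and>
     (\<exists>c a m i. is_tuple (mem U) q [c, a, m, i] \<and>
        (\<forall>x. mem U x c \<longleftrightarrow> x \<in> car S) \<and>
        (\<forall>t. mem U t a \<longleftrightarrow>
          (\<exists>x\<in>car S. \<exists>y\<in>car S. is_tuple (mem U) t [x, y, add S x y])) \<and>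
        (\<forall>t. mem U t m \<longleftrightarrow>
          (\<exists>\<alpha>. \<exists>x\<in>car S. is_tuple (mem U) t [cpx U \<alpha>, x, scl S \<alpha> x])) \<and>
        (\<forall>t. mem U t i \<longleftrightarrow>
          (\<exists>x\<in>car S. \<exists>y\<in>car S. is_tuple (mem U) t [x, y, cpx U (inn S x y)])))"

definition codes_op :: "('u, 'v) universe \<Rightarrow> 'u ips \<Rightarrow> 'u \<Rightarrow> ('u \<Rightarrow> 'u) \<Rightarrow> bool" where
  "codes_op U S t T \<longleftrightarrow>
     T \<in> bounded_ops S \<and>
     (\<forall>p. mem U p t \<longleftrightarrow> (\<exists>x\<in>car S. is_tuple (mem U) p [x, T x]))"

text \<open>\<open>H\<close> belongs to the extension of the standard set of all Hilbert spaces in \<open>level U k\<close>. In the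
  full superstructure every internal Hilbert space is of this kind for some \<open>k\<close>. If the
  superstructure is cut off at a height \<open>h\<close>, sets of tuples of vectors, of operators etc. of \<open>H\<close>
  only exist if \<open>h\<close> exceeds \<open>k\<close> by some margin.\<close>

definition internal_hilbert_space :: "('u, 'v) universe \<Rightarrow> nat \<Rightarrow> 'v \<Rightarrow> bool" where
  "internal_hilbert_space U k H \<longleftrightarrow>
     star_rel U {[q] | q. q \<in> level U k \<and> (\<exists>S. codes_hilbert U q S)} [H]"

definition internal_dim :: "('u, 'v) universe \<Rightarrow> 'v \<Rightarrow> 'v \<Rightarrow> bool" where
  "internal_dim U H N \<longleftrightarrow>
     star_rel U {[q, rl U (real n)] | q n. \<exists>S. codes_hilbert U q S \<and> has_hilbert_dim S n} [H, N]"

definition ivec :: "('u, 'v) universe \<Rightarrow> 'v \<Rightarrow> 'v set" where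
  "ivec U H = {x. star_rel U {[q, u] | q u. \<exists>S. codes_hilbert U q S \<and> u \<in> car S} [H, x]}"

definition iadd :: "('u, 'v) universe \<Rightarrow> 'v \<Rightarrow> 'v \<Rightarrow> 'v \<Rightarrow> 'v" where
  "iadd U H x y = star_fun U
     {[q, u, w, add S u w] | q u w S. codes_hilbert U q S \<and> u \<in> car S \<and> w \<in> car S} [H, x, y]"

definition isub :: "('u, 'v) universe \<Rightarrow> 'v \<Rightarrow> 'v \<Rightarrow> 'v \<Rightarrow> 'v" where
  "isub U H x y = star_fun U
     {[q, u, w, hsub S u w] | q u w S. codes_hilbert U q S \<and> u \<in> car S \<and> w \<in> car S} [H, x, y]"

definition iscl :: "('u, 'v) universe \<Rightarrow> 'v \<Rightarrow> 'v \<Rightarrow> 'v \<Rightarrow> 'v" where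
  "iscl U H c x = star_fun U
     {[q, cpx U \<alpha>, u, scl S \<alpha> u] | q \<alpha> u S. codes_hilbert U q S \<and> u \<in> car S} [H, c, x]"

definition iinn :: "('u, 'v) universe \<Rightarrow> 'v \<Rightarrow> 'v \<Rightarrow> 'v \<Rightarrow> 'v" where
  "iinn U H x y = star_fun U
     {[q, u, w, cpx U (inn S u w)] | q u w S. codes_hilbert U q S \<and> u \<in> car S \<and> w \<in> car S}
     [H, x, y]"

definition inorm :: "('u, 'v) universe \<Rightarrow> 'v \<Rightarrow> 'v \<Rightarrow> 'v" where
  "inorm U H x = star_fun U
     {[q, u, rl U (hnorm S u)] | q u S. codes_hilbert U q S \<and> u \<in> car S} [H, x]"

definition iops :: "('u, 'v) universe \<Rightarrow> 'v \<Rightarrow> 'v set" where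
  "iops U H = {a. star_rel U {[q, t] | q t. \<exists>S T. codes_hilbert U q S \<and> codes_op U S t T} [H, a]}"

definition iapp :: "('u, 'v) universe \<Rightarrow> 'v \<Rightarrow> 'v \<Rightarrow> 'v \<Rightarrow> 'v" where
  "iapp U H a x = star_fun U
     {[q, t, u, T u] | q t u S T. codes_hilbert U q S \<and> codes_op U S t T \<and> u \<in> car S} [H, a, x]"

definition iopsub :: "('u, 'v) universe \<Rightarrow> 'v \<Rightarrow> 'v \<Rightarrow> 'v \<Rightarrow> 'v" where
  "iopsub U H a b = star_fun U
     {[q, t, t', d] | q t t' d. \<exists>S T T'. codes_hilbert U q S \<and> codes_op U S t T \<and>
        codes_op U S t' T' \<and> codes_op U S d (op_sub S T T')} [H, a, b]"

definition iopnorm :: "('u, 'v) universe \<Rightarrow> 'v \<Rightarrow> 'v \<Rightarrow> 'v" where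
  "iopnorm U H a = star_fun U
     {[q, t, rl U (op_norm S T)] | q t S T. codes_hilbert U q S \<and> codes_op U S t T} [H, a]"


section \<open>Nonstandard hulls\<close>

text \<open>An internal normed space enters through its set of points, its norm and its subtraction.\<close>

definition hat ::
  "('u, 'v) universe \<Rightarrow> 'v set \<Rightarrow> ('v \<Rightarrow> 'v) \<Rightarrow> ('v \<Rightarrow> 'v \<Rightarrow> 'v) \<Rightarrow> 'v \<Rightarrow> 'v set" where
  "hat U V nrm sub x = {y \<in> V. happrox U (nrm (sub y x)) (star U (cpx U 0))}"

definition ns_hull ::
  "('u, 'v) universe \<Rightarrow> 'v set \<Rightarrow> ('v \<Rightarrow> 'v) \<Rightarrow> ('v \<Rightarrow> 'v \<Rightarrow> 'v) \<Rightarrow> 'v set set" where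
  "ns_hull U V nrm sub = hat U V nrm sub ` {x \<in> V. hfinite U (nrm x)}"

definition vhat :: "('u, 'v) universe \<Rightarrow> 'v \<Rightarrow> 'v \<Rightarrow> 'v set" where
  "vhat U H = hat U (ivec U H) (inorm U H) (isub U H)"

definition hull_space :: "('u, 'v) universe \<Rightarrow> 'v \<Rightarrow> 'v set ips" where
  "hull_space U H =
     \<lparr>car = ns_hull U (ivec U H) (inorm U H) (isub U H),
      add = (\<lambda>X Y. THE Z. \<exists>x\<in>X. \<exists>y\<in>Y. Z = vhat U H (iadd U H x y)),
      scl = (\<lambda>c X. THE Z. \<exists>x\<in>X. Z = vhat U H (iscl U H (star U (cpx U c)) x)),
      inn = (\<lambda>X Y. THE c. \<exists>x\<in>X. \<exists>y\<in>Y. c = standard_part U (iinn U H x y))\<rparr>"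

definition hull_ops :: "('u, 'v) universe \<Rightarrow> 'v \<Rightarrow> 'v set set" where
  "hull_ops U H = ns_hull U (iops U H) (iopnorm U H) (iopsub U H)"

text \<open>The operator on the hull space given by an element of \<^const>\<open>hull_ops\<close>.\<close>

definition hull_rep :: "('u, 'v) universe \<Rightarrow> 'v \<Rightarrow> 'v set \<Rightarrow> ('v set \<Rightarrow> 'v set)" where
  "hull_rep U H P =
     (\<lambda>X\<in>car (hull_space U H). THE Y. \<exists>a\<in>P. \<exists>x\<in>X. Y = vhat U H (iapp U H a x))"

definition hull_algebra :: "('u, 'v) universe \<Rightarrow> 'v \<Rightarrow> ('v set \<Rightarrow> 'v set) set" where
  "hull_algebra U H = hull_rep U H ` hull_ops U H"

text \<open>For a C*-subalgebra \<open>A\<close> of the bounded operators, which \<^const>\<open>hull_algebra\<close> is.\<close>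

definition is_von_neumann_algebra :: "'a ips \<Rightarrow> ('a \<Rightarrow> 'a) set \<Rightarrow> bool" where
  "is_von_neumann_algebra S A \<longleftrightarrow> closedin (strong_operator_topology S) A"

end

theory Submission
  imports Defs
begin

text \<open>
  By transfer and saturation, the internal points behave like random points of the standard universe:
  there is an ultrafilter on the maps \<open>g\<close> from internal points to standard points such that an
  extended relation holds between points iff it holds for almost every \<open>g\<close> between their values.
  An internal Hilbert space is then a random Hilbert space, standard parts are limits along the
  ultrafilter, and the hull is an ultraproduct, which saturation makes complete.

  If the internal dimension is a standard \<open>n\<close>, then an internal orthonormal basis passes to one of
  the hull, and every operator \<open>T\<close> on the hull comes from the internal operator
  \<open>x \<mapsto> \<Sum>i<n. \<langle>x, e\<^sub>i\<rangle> f\<^sub>i\<close>, where \<open>f\<^sub>i\<close> represents the value of \<open>T\<close> at the class of \<open>e\<^sub>i\<close>.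
  Otherwise there is an infinite sequence of internal orthonormal vectors. The projections onto the
  spans of their initial segments belong to the algebra and converge strongly to a projection
  which, by saturation, does not come from an internal operator.
\<close>

section \<open>Bounded formulas about tuples\<close>

text \<open>The nonstandard universe is given by axioms and need not be an ultrapower, and transfer
  speaks of syntactic bounded formulas only. Instead of writing Hilbert space theory in such
  formulas, the proof uses them for a few closure properties of extended relations: finite
  implications, projections, complements, the diagonal and sections. These are enough to treat
  points as random elements; afterwards each statement about internal vectors or operators is an
  ordinary statement about an ordinary space, applied for almost every \<open>g\<close>. Two
  obstacles shape the rest. The relations in the definitions range over the class of all Hilbert
  spaces and have to be cut down to a set by fixing \<open>H\<close>. And an eventual statement can
  be decided only if it depends on the values of \<open>g\<close> at finitely many points, so
  whatever is chosen separately for each \<open>g\<close> has to be realised by an internal point.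
  Strong closedness is a condition on a topology, but to refute it a sequence suffices, since a
  pointwise norm limit of operators in a closed set stays in that set.\<close>

abbreviation BAll :: "nat \<Rightarrow> nat \<Rightarrow> bounded_fm \<Rightarrow> bounded_fm" where
  "BAll i j \<phi> \<equiv> Neg (BEx i j (Neg \<phi>))"

abbreviation Imp :: "bounded_fm \<Rightarrow> bounded_fm \<Rightarrow> bounded_fm" where
  "Imp \<phi> \<psi> \<equiv> Neg (Conj \<phi> (Neg \<psi>))"

abbreviation Disj :: "bounded_fm \<Rightarrow> bounded_fm \<Rightarrow> bounded_fm" where
  "Disj \<phi> \<psi> \<equiv> Neg (Conj (Neg \<phi>) (Neg \<psi>))"

text \<open>The memberships of \<open>s\<close> and \<open>d\<close> in \<open>p\<close> do not
  occur here because the quantifiers that bind \<open>s\<close> and \<open>d\<close> in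
  \<open>tuple_fm\<close> already range over the members of \<open>p\<close>.\<close>

definition pair_fm :: "nat \<Rightarrow> nat \<Rightarrow> nat \<Rightarrow> nat \<Rightarrow> nat \<Rightarrow> nat \<Rightarrow> bounded_fm" where
  "pair_fm s d z p x y =
     Conj (Conj (Mem x s) (BAll z s (Equ z x)))
    (Conj (Conj (Mem x d) (Conj (Mem y d) (BAll z d (Disj (Equ z x) (Equ z y)))))
          (BAll z p (Disj (Equ z s) (Equ z d))))"

text \<open>Variables congruent to 0 modulo 3 stand for internal objects and those congruent to 1 for sets
  of tuples; variable 2 stands for a bound on all quantifiers, and the remaining variables
  congruent to 2 are auxiliary.\<close>

fun tuple_fm :: "nat \<Rightarrow> nat \<Rightarrow> nat list \<Rightarrow> bounded_fm" where
  "tuple_fm d p [] = Neg (Equ p p)"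
| "tuple_fm d p [x] = Equ p x"
| "tuple_fm d p (x # y # zs) =
     BEx (3*d+5) p (BEx (3*d+8) p (BEx (3*d+11) (3*d+8)
       (Conj (pair_fm (3*d+5) (3*d+8) (3*d+14) p x (3*d+11)) (tuple_fm (d+4) (3*d+11) (y # zs)))))"

text \<open>Bounding the quantifiers loses nothing: both sets that make up a Kuratowski pair are
  members of \<open>p\<close>, and the second component is a member of \<open>b\<close>.\<close>

lemma bounded_pair_iff:
  "(\<exists>a. E a p \<and> (\<exists>b. E b p \<and> (\<exists>y. E y b \<and> E x a \<and> (\<forall>z. E z a \<longrightarrow> z = x) \<and> E x b \<and> E y b \<and>
      (\<forall>z. E z b \<longrightarrow> z = x \<or> z = y) \<and> (\<forall>z. E z p \<longrightarrow> z = a \<or> z = b) \<and> P a b y))) \<longleftrightarrow>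
   (\<exists>a b y. (\<forall>z. E z a \<longleftrightarrow> z = x) \<and> (\<forall>z. E z b \<longleftrightarrow> z = x \<or> z = y) \<and>
      (\<forall>z. E z p \<longleftrightarrow> z = a \<or> z = b) \<and> P a b y)"
  (is "?L \<longleftrightarrow> ?R")
proof
  assume ?L
  then obtain a b y where *: "E a p" "E b p" "E y b" "E x a" "\<forall>z. E z a \<longrightarrow> z = x" "E x b"
    "\<forall>z. E z b \<longrightarrow> z = x \<or> z = y" "\<forall>z. E z p \<longrightarrow> z = a \<or> z = b" "P a b y"
    by blast
  show ?R by (rule exI[of _ a], rule exI[of _ b], rule exI[of _ y]) (use * in blast)
next
  assume ?R
  then obtain a b y where *: "\<forall>z. E z a \<longleftrightarrow> z = x" "\<forall>z. E z b \<longleftrightarrow> z = x \<or> z = y"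
      "\<forall>z. E z p \<longleftrightarrow> z = a \<or> z = b" "P a b y" by blast
  then show ?L by (intro exI[of _ a] exI[of _ b] exI[of _ y] conjI) simp_all
qed

lemma sat_pair_fm:
  assumes "distinct [s, d, z, q]" "p \<notin> {s, d, z, q}" "x \<notin> {s, d, z, q}"
  shows "sat E (BEx s p (BEx d p (BEx q d (Conj (pair_fm s d z p x q) \<phi>)))) e \<longleftrightarrow>
    (\<exists>a b y. (\<forall>z. E z a \<longleftrightarrow> z = e x) \<and> (\<forall>z. E z b \<longleftrightarrow> z = e x \<or> z = y) \<and>
            (\<forall>z. E z (e p) \<longleftrightarrow> z = a \<or> z = b) \<and> sat E \<phi> (e(s := a, d := b, q := y)))"
proof -
  have "q \<noteq> z" "q \<noteq> s" "q \<noteq> d" using assms(1) by auto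
  then show ?thesis
    using assms bounded_pair_iff[of E "e p" "e x" "\<lambda>a b y. sat E \<phi> (e(s := a, d := b, q := y))"]
    unfolding pair_fm_def by simp
qed

text \<open>No variable is captured: with counter \<open>d\<close> one step binds the four variables
  \<open>3*d+5\<close>, \<open>3*d+8\<close>, \<open>3*d+11\<close> and \<open>3*d+14\<close>, none
  of them a multiple of 3, and the counter then grows by 4. The variables of the tuple are smaller
  than these or multiples of 3.\<close>

lemma sat_tuple_fm:
  assumes "\<forall>i\<in>set (p # is). i < 3*d+5 \<or> i mod 3 = 0"
  shows "sat E (tuple_fm d p is) e \<longleftrightarrow> is_tuple E (e p) (map e is)"
  using assms
proof (induction d p "is" arbitrary: e rule: tuple_fm.induct)
  case (3 d p x y zs)
  have ne0: "i \<notin> {3*d+5, 3*d+8, 3*d+14, 3*d+11}" if "i \<in> set (p # x # y # zs)" for i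
  proof -
    have "i < 3*d+5 \<or> i mod 3 = 0" by (rule bspec[OF 3(2) that])
    moreover have "(3*d+5) mod 3 \<noteq> 0" "(3*d+8) mod 3 \<noteq> 0" "(3*d+11) mod 3 \<noteq> 0" "(3*d+14) mod 3 \<noteq> 0"
      by presburger+
    ultimately have "i \<noteq> 3*d+5" "i \<noteq> 3*d+8" "i \<noteq> 3*d+14" "i \<noteq> 3*d+11"
      by (elim disjE; fastforce)+
    then show ?thesis by simp
  qed
  have ne: "p \<notin> {3*d+5, 3*d+8, 3*d+14, 3*d+11}" "x \<notin> {3*d+5, 3*d+8, 3*d+14, 3*d+11}"
    "\<forall>i\<in>set (y # zs). i \<notin> {3*d+5, 3*d+8, 3*d+14, 3*d+11}"
  proof -
    show "p \<notin> {3*d+5, 3*d+8, 3*d+14, 3*d+11}" by (rule ne0) simp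
    show "x \<notin> {3*d+5, 3*d+8, 3*d+14, 3*d+11}" by (rule ne0) simp
    show "\<forall>i\<in>set (y # zs). i \<notin> {3*d+5, 3*d+8, 3*d+14, 3*d+11}"
      by (intro ballI ne0) simp
  qed
  have IH: "sat E (tuple_fm (d+4) (3*d+11) (y # zs)) e' \<longleftrightarrow>
      is_tuple E (e' (3*d+11)) (map e' (y # zs))" for e'
  proof (rule 3(1))
    show "\<forall>i\<in>set ((3*d+11) # y # zs). i < 3*(d+4)+5 \<or> i mod 3 = 0"
    proof
      fix i assume "i \<in> set ((3*d+11) # y # zs)"
      then have "i = 3*d+11 \<or> i < 3*d+5 \<or> i mod 3 = 0" using 3(2) by (metis list.set_intros(2) set_ConsD)
      then show "i < 3*(d+4)+5 \<or> i mod 3 = 0" by (elim disjE) simp_all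
    qed
  qed
  have mp: "map (e(3*d+5 := a, 3*d+8 := b, 3*d+11 := q)) (y # zs) = map e (y # zs)" for a b q
    by (rule map_cong[OF refl]) (use ne(3) in auto)
  have dist: "distinct [3*d+5, 3*d+8, 3*d+14, 3*d+11]" by simp
  have "sat E (tuple_fm d p (x # y # zs)) e \<longleftrightarrow>
     (\<exists>a b q. (\<forall>z. E z a \<longleftrightarrow> z = e x) \<and> (\<forall>z. E z b \<longleftrightarrow> z = e x \<or> z = q) \<and>
            (\<forall>z. E z (e p) \<longleftrightarrow> z = a \<or> z = b) \<and> is_tuple E q (map e (y # zs)))"
    unfolding tuple_fm.simps sat_pair_fm[OF dist ne(1,2)] IH mp fun_upd_same ..
  also have "\<dots> \<longleftrightarrow> is_tuple E (e p) (map e (x # y # zs))"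
    unfolding list.map is_tuple.simps is_pair_def by blast
  finally show ?case .
qed simp_all

text \<open>Variable 5 holds the tuple; the counter starts at 1 so that the auxiliary variables
  begin at 8.\<close>

definition rel_fm :: "nat \<Rightarrow> nat list \<Rightarrow> bounded_fm" where
  "rel_fm r is = BEx 5 (3*r+1) (tuple_fm 1 5 (map ((*) 3) is))"

definition env :: "'a \<Rightarrow> (nat \<Rightarrow> 'a) \<Rightarrow> (nat \<Rightarrow> 'a) \<Rightarrow> nat \<Rightarrow> 'a" where
  "env V \<rho> x j = (if j mod 3 = 0 then x (j div 3) else if j mod 3 = 1 then \<rho> (j div 3) else V)"

lemma env_simps [simp]:
  "env V \<rho> x (3*i) = x i" "env V \<rho> x (Suc (3*i)) = \<rho> i" "env V \<rho> x 2 = V"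
  "(env V \<rho> x)(3*i := y) = env V \<rho> (x(i := y))"
proof -
  have "Suc (3*i) mod 3 = 1" "Suc (3*i) div 3 = i" by presburger+
  then show "env V \<rho> x (Suc (3*i)) = \<rho> i" by (simp add: env_def)
qed (auto simp: env_def fun_eq_iff)

lemma sat_rel_fm [simp]:
  "sat E (rel_fm r is) (env V \<rho> x) \<longleftrightarrow> (\<exists>p. E p (\<rho> r) \<and> is_tuple E p (map x is))"
proof -
  have A: "map ((env V \<rho> x)(5 := p)) (map ((*) 3) is) = map x is" for p
  proof -
    have "((env V \<rho> x)(5 := p)) (3*i) = x i" for i
    proof -
      have "3*i \<noteq> 5" by presburger
      then show ?thesis by simp
    qed
    then show ?thesis by simp
  qed
  have B: "sat E (tuple_fm 1 5 (map ((*) 3) is)) e \<longleftrightarrow>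
      is_tuple E (e 5) (map e (map ((*) 3) is))" for e
    by (rule sat_tuple_fm) auto
  show ?thesis
    unfolding rel_fm_def sat.simps by (simp only: A B fun_upd_same) simp
qed

lemma sat_tuple_env:
  "sat E (tuple_fm 1 (3*m) (map ((*) 3) is)) (env V \<rho> x) \<longleftrightarrow> is_tuple E (x m) (map x is)"
  by (subst sat_tuple_fm) (auto simp: comp_def)

primrec all_fm :: "nat \<Rightarrow> bounded_fm \<Rightarrow> bounded_fm" where
  "all_fm 0 \<phi> = \<phi>"
| "all_fm (Suc n) \<phi> = all_fm n (BAll (3*n) 2 \<phi>)"

lemma sat_all_fm:
  "sat E (all_fm n \<phi>) (env V \<rho> x) \<longleftrightarrow>
     (\<forall>y. (\<forall>i<n. E (y i) V) \<and> (\<forall>i\<ge>n. y i = x i) \<longrightarrow> sat E \<phi> (env V \<rho> y))"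
proof (induction n arbitrary: \<phi>)
  case 0
  have "(\<forall>i. y i = x i) \<longleftrightarrow> y = x" for y by auto
  then show ?case by simp
next
  case (Suc n)
  have "(\<forall>y. (\<forall>i<n. E (y i) V) \<and> (\<forall>i\<ge>n. y i = x i) \<longrightarrow>
          (\<forall>z. E z V \<longrightarrow> sat E \<phi> (env V \<rho> (y(n := z))))) \<longleftrightarrow>
        (\<forall>y. (\<forall>i<Suc n. E (y i) V) \<and> (\<forall>i\<ge>Suc n. y i = x i) \<longrightarrow> sat E \<phi> (env V \<rho> y))"
    (is "?L \<longleftrightarrow> ?R")
  proof
    assume L: ?L
    show ?R
    proof (intro allI impI)
      fix y assume y: "(\<forall>i<Suc n. E (y i) V) \<and> (\<forall>i\<ge>Suc n. y i = x i)"
      have "\<forall>i\<ge>n. (y(n := x n)) i = x i"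
        using y by (metis fun_upd_apply le_antisym not_less_eq_eq)
      then have "sat E \<phi> (env V \<rho> ((y(n := x n))(n := y n)))"
        using L[rule_format, of "y(n := x n)" "y n"] y by auto
      then show "sat E \<phi> (env V \<rho> y)" by simp
    qed
  next
    assume ?R
    then show ?L by (auto simp: less_Suc_eq)
  qed
  then show ?case by (simp add: Suc)
qed

primrec conj_fm :: "nat \<Rightarrow> (nat \<Rightarrow> bounded_fm) \<Rightarrow> bounded_fm" where
  "conj_fm 0 f = Equ 2 2"
| "conj_fm (Suc n) f = Conj (conj_fm n f) (f n)"

lemma sat_conj_fm [simp]: "sat E (conj_fm n f) e \<longleftrightarrow> (\<forall>i<n. sat E (f i) e)"
  by (induction n) (auto simp: less_Suc_eq)

text \<open>The argument compares members only and does not appeal to extensionality, so it applies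
  to both \<open>mem\<close> and \<open>smem\<close>.\<close>

lemma is_pair_inject:
  assumes "is_pair E p x y" "is_pair E p x' y'"
  shows "x = x' \<and> y = y'"
proof -
  obtain s d where 1: "\<And>z. E z s \<longleftrightarrow> z = x" "\<And>z. E z d \<longleftrightarrow> z = x \<or> z = y" "\<And>z. E z p \<longleftrightarrow> z = s \<or> z = d"
    using assms(1) unfolding is_pair_def by blast
  obtain s' d' where 2: "\<And>z. E z s' \<longleftrightarrow> z = x'" "\<And>z. E z d' \<longleftrightarrow> z = x' \<or> z = y'"
      "\<And>z. E z p \<longleftrightarrow> z = s' \<or> z = d'"
    using assms(2) unfolding is_pair_def by blast
  have c: "s' = s \<or> s' = d" "d' = s \<or> d' = d" "d = s' \<or> d = d'" using 1(3) 2(3) by auto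
  have x: "x = x'" using c(1) 1(1)[of x'] 1(2)[of x] 2(1)[of x'] 2(1)[of x] by auto
  from c(3) show ?thesis
  proof
    \<comment> \<open>The degenerate case: the set of both components is a singleton.\<close>
    assume d: "d = s'"
    then have "y = x" using 1(2)[of y] 2(1)[of y] x by auto
    then show ?thesis using c(2) 1(1)[of y'] 1(2)[of y'] 2(2)[of y'] x by auto
  next
    assume d: "d = d'"
    then show ?thesis using 1(2)[of y] 2(2)[of y] 1(2)[of y'] 2(2)[of y'] x by auto
  qed
qed

lemma is_tuple_inject:
  assumes "is_tuple E p xs" "is_tuple E p ys" "length xs = length ys"
  shows "xs = ys"
  using assms
proof (induction E p xs arbitrary: ys rule: is_tuple.induct)
  case (2 E p x)
  then show ?case by (cases ys) auto
next
  case (3 E p x y zs)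
  then obtain x' y' zs' where "ys = x' # y' # zs'"
    by (metis length_Suc_conv length_Cons)
  moreover obtain q q' where q: "is_pair E p x q" "is_tuple E q (y # zs)"
      "is_pair E p x' q'" "is_tuple E q' (y' # zs')"
    using 3(2,3) calculation by auto
  ultimately show ?case
    using 3(1)[OF q(2), of "y' # zs'"] 3(4) is_pair_inject[OF q(1,3)] by auto
qed auto

section \<open>The ultrafilter of an internal point\<close>

text \<open>The margin 40 has to cover the following: points are taken from
  \<open>level U (k + 5)\<close>, tuples of at most six of them lie in
  \<open>level U (k + 15)\<close>, and sets of such tuples lie one level higher.\<close>

locale nonstandard_setting =
  fixes U :: "('u, 'v) universe" and \<kappa> :: "'k rel" and h :: enat and k :: nat
  assumes card_\<kappa>: "natLeq <o \<kappa>"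
    and universe: "nonstandard_universe h \<kappa> U"
    and height: "enat (k + 40) \<le> h"
begin


lemma no_mem_atom: "a \<in> atoms U \<Longrightarrow> \<not> mem U x a"
  and ex_set: "n < k + 40 \<Longrightarrow> A \<subseteq> level U n \<Longrightarrow> \<exists>a. a \<notin> atoms U \<and> {x. mem U x a} = A"
  and cpx_inj: "inj (cpx U)"
  and cpx_atom: "cpx U c \<in> atoms U"
  and transfer: "sat (mem U) \<phi> e \<longleftrightarrow> sat (smem U) \<phi> (star U \<circ> e)"
  and saturation: "(\<forall>A\<in>F. internal U A) \<Longrightarrow> |F| <o \<kappa> \<Longrightarrow>
          (\<And>G. G \<subseteq> F \<Longrightarrow> finite G \<Longrightarrow> (\<exists>x. \<forall>A\<in>G. smem U x A))
        \<Longrightarrow> \<exists>x. \<forall>A\<in>F. smem U x A"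
proof -
  have ss: "superstructure h U"
    using universe by (auto simp: nonstandard_universe_def)
  note * = ss[unfolded superstructure_def]
  show "a \<in> atoms U \<Longrightarrow> \<not> mem U x a"
    using *[THEN conjunct1] by simp
  show "\<exists>a. a \<notin> atoms U \<and> {x. mem U x a} = A" if "n < k + 40" "A \<subseteq> level U n"
  proof -
    have "enat n < h"
      using that(1) height by (meson enat_ord_simps(2) less_le_trans)
    then show ?thesis
      using *[THEN conjunct2, THEN conjunct2, THEN conjunct1] that(2) by simp
  qed
  note ** = universe[unfolded nonstandard_universe_def]
  show "inj (cpx U)" using ** by (elim conjE)
  have "range (cpx U) \<subseteq> atoms U" using ** by (elim conjE)
  then show "cpx U c \<in> atoms U" by (rule subsetD) simp
  have "transfer_principle U" using ** by (elim conjE)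
  then show "sat (mem U) \<phi> e \<longleftrightarrow> sat (smem U) \<phi> (star U \<circ> e)"
    unfolding transfer_principle_def by (elim allE)
  have "saturated \<kappa> U" using ** by (elim conjE)
  then show "(\<forall>A\<in>F. internal U A) \<Longrightarrow> |F| <o \<kappa> \<Longrightarrow>
          (\<And>G. G \<subseteq> F \<Longrightarrow> finite G \<Longrightarrow> (\<exists>x. \<forall>A\<in>G. smem U x A))
        \<Longrightarrow> \<exists>x. \<forall>A\<in>F. smem U x A"
    unfolding saturated_def by simp
qed

section \<open>Levels, pairs, tuples and sets in the superstructure\<close>

lemma level_mono: "n \<le> n' \<Longrightarrow> level U n \<subseteq> level U n'"
  by (induction n' rule: nat_induct) (auto simp: le_Suc_eq)

lemma level_trans: "mem U x a \<Longrightarrow> a \<in> level U n \<Longrightarrow> x \<in> level U n"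
  by (induction n arbitrary: a) (auto simp: no_mem_atom)

lemma level_SucI: "mem U y a \<Longrightarrow> (\<And>x. mem U x a \<Longrightarrow> x \<in> level U n) \<Longrightarrow> a \<in> level U (Suc n)"
  using no_mem_atom by auto

lemma cpx_level: "cpx U c \<in> level U n"
  using cpx_atom level_mono[of 0 n] by auto

text \<open>One level is used by the sets of components, another one by the pair itself.\<close>

lemma level_pair:
  assumes "is_pair (mem U) p x y" "x \<in> level U n" "y \<in> level U n"
  shows "p \<in> level U (n + 2)"
proof -
  obtain s d where *: "\<forall>z. mem U z s \<longleftrightarrow> z = x" "\<forall>z. mem U z d \<longleftrightarrow> z = x \<or> z = y"
    "\<forall>z. mem U z p \<longleftrightarrow> z = s \<or> z = d"
    using assms(1) unfolding is_pair_def by blast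
  have sd: "s \<in> level U (Suc n)" "d \<in> level U (Suc n)"
  proof -
    show "s \<in> level U (Suc n)" by (rule level_SucI[of x]) (use *(1) assms in simp_all)
    show "d \<in> level U (Suc n)" by (rule level_SucI[of x]) (use *(2) assms in auto)
  qed
  have "p \<in> level U (Suc (Suc n))"
  proof (rule level_SucI)
    show "mem U s p" using * by simp
    show "z \<in> level U (Suc n)" if "mem U z p" for z using that * sd by metis
  qed
  then show ?thesis by (simp del: level.simps)
qed

lemma ex_pair:
  assumes "x \<in> level U n" "y \<in> level U n" "n + 1 < k + 40"
  shows "\<exists>p. is_pair (mem U) p x y"
proof -
  obtain s where s: "{z. mem U z s} = {x}"
    using ex_set[of n "{x}"] assms by auto
  obtain d where d: "{z. mem U z d} = {x, y}"
    using ex_set[of n "{x, y}"] assms by auto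
  have "s \<in> level U (Suc n)" "d \<in> level U (Suc n)"
    using s d assms(1,2) by (auto intro!: level_SucI[of x] simp del: level.simps)
  then obtain p where p: "{z. mem U z p} = {s, d}"
    using ex_set[of "Suc n" "{s, d}"] assms(3) by (auto simp del: level.simps)
  show ?thesis
    unfolding is_pair_def using s d p by (intro exI[of _ p] exI[of _ s] exI[of _ d]) auto
qed

lemma level_tuple:
  assumes "is_tuple (mem U) p us" "set us \<subseteq> level U n"
  shows "p \<in> level U (n + 2 * (length us - 1))"
  using assms
proof (induction "mem U" p us rule: is_tuple.induct)
  case (3 p x y zs)
  then obtain q where q: "is_pair (mem U) p x q" "is_tuple (mem U) q (y # zs)" by auto
  have "x \<in> level U (n + 2 * length zs)"
    using 3(3) level_mono[of n "n + 2 * length zs"] by auto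
  moreover have "q \<in> level U (n + 2 * length zs)"
    using 3(1)[OF q(2)] 3(3) by simp
  ultimately show ?case
    using level_pair[OF q(1), of "n + 2 * length zs"] by (simp add: algebra_simps del: level.simps)
qed auto

lemma ex_tuple:
  assumes "us \<noteq> []" "set us \<subseteq> level U n" "n + 2 * length us \<le> k + 40"
  shows "\<exists>p. is_tuple (mem U) p us"
  using assms
proof (induction us)
  case (Cons x us)
  show ?case
  proof (cases us)
    case (Cons y zs)
    then obtain q where q: "is_tuple (mem U) q us"
      using Cons.IH Cons.prems by auto
    have "q \<in> level U (n + 2 * length zs)"
      using level_tuple[OF q, of n] Cons Cons.prems by auto
    moreover have "x \<in> level U (n + 2 * length zs)"
      using Cons.prems level_mono[of n "n + 2 * length zs"] by auto
    ultimately obtain p where "is_pair (mem U) p x q"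
      using ex_pair[of x "n + 2 * length zs" q] Cons.prems Cons by auto
    then show ?thesis using q Cons by auto
  qed auto
qed auto

declare level.simps [simp del]

definition set_code :: "'u set \<Rightarrow> 'u" where
  "set_code A = (SOME a. a \<notin> atoms U \<and> {x. mem U x a} = A)"

lemma mem_set_code:
  assumes "A \<subseteq> level U n" "n < k + 40"
  shows "mem U x (set_code A) \<longleftrightarrow> x \<in> A"
  using someI_ex[OF ex_set[OF assms(2,1)]] unfolding set_code_def by blast

lemma set_code_level:
  assumes "A \<subseteq> level U n" "n < k + 40"
  shows "set_code A \<in> level U (Suc n)"
  using someI_ex[OF ex_set[OF assms(2,1)]] mem_set_code[OF assms] assms(1)
  unfolding set_code_def level.simps by auto

text \<open>For codes of Hilbert spaces in \<open>level U k\<close> this contains the vectors, the sets of vectors and the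
  graphs of operators.\<close>

definition M :: "'u set" where "M = level U (k + 5)"

definition tuples :: "nat \<Rightarrow> 'u list set" where
  "tuples n = {us. length us = n \<and> set us \<subseteq> M}"

text \<open>Tuples of bounded length keep the sets of tuples below the cut-off height; the tuples
  that occur consist of \<open>H\<close>, a few further points and one value.\<close>

definition arity :: "nat \<Rightarrow> bool" where "arity n \<longleftrightarrow> 1 \<le> n \<and> n \<le> 6"

section \<open>Extensions of relations on a fixed level\<close>

definition rel_code :: "'u list set \<Rightarrow> 'u" where
  "rel_code R = set_code {p. \<exists>us\<in>R. is_tuple (mem U) p us}"

lemma mem_rel_code:
  assumes "R \<subseteq> tuples n" "arity n"
  shows "mem U p (rel_code R) \<longleftrightarrow> (\<exists>us\<in>R. is_tuple (mem U) p us)"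
proof -
  have "{p. \<exists>us\<in>R. is_tuple (mem U) p us} \<subseteq> level U (k + 15)"
  proof safe
    fix p us assume "us \<in> R" and p: "is_tuple (mem U) p us"
    then have "set us \<subseteq> M" "length us = n" using assms(1) by (auto simp: tuples_def)
      moreover have "level U (k + 5 + 2 * (n - 1)) \<subseteq> level U (k + 15)"
      using assms(2) by (intro level_mono) (auto simp: arity_def)
    ultimately show "p \<in> level U (k + 15)"
      using level_tuple[OF p, of "k + 5"] by (auto simp: M_def)
  qed
  from mem_set_code[OF this] show ?thesis by (simp add: rel_code_def)
qed

lemma tuple_in_rel_code:
  assumes "R \<subseteq> tuples n" "arity n" "us \<in> tuples n"
  shows "(\<exists>p. mem U p (rel_code R) \<and> is_tuple (mem U) p us) \<longleftrightarrow> us \<in> R"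
proof
  assume "\<exists>p. mem U p (rel_code R) \<and> is_tuple (mem U) p us"
  then obtain p where p: "mem U p (rel_code R)" "is_tuple (mem U) p us" by (elim exE conjE)
  then obtain us' where us': "us' \<in> R" "is_tuple (mem U) p us'"
    using mem_rel_code[OF assms(1,2), of p] by (elim iffD1[THEN bexE])
  have "length us' = n" using us'(1) assms(1) by (auto simp: tuples_def)
  moreover have "length us = n" using assms(3) by (simp add: tuples_def)
  ultimately show "us \<in> R"
    using us'(1) is_tuple_inject[OF p(2) us'(2)] by metis
next
  assume us: "us \<in> R"
  have "us \<noteq> []" "set us \<subseteq> level U (k + 5)" "k + 5 + 2 * length us \<le> k + 40"
    using assms(2,3) by (auto simp: tuples_def arity_def M_def)
  from ex_tuple[OF this] obtain p where "is_tuple (mem U) p us" by (elim exE)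
  then show "\<exists>p. mem U p (rel_code R) \<and> is_tuple (mem U) p us"
    using mem_rel_code[OF assms(1,2), of p] us by (intro exI[of _ p]) auto
qed

lemma transfer_subset:
  assumes "\<And>p. mem U p a \<Longrightarrow> mem U p b" "smem U p (star U a)"
  shows "smem U p (star U b)"
  using transfer[of "BAll 2 0 (Mem 2 1)" "(\<lambda>_. b)(0 := a)"] assms by auto

text \<open>As \<open>R\<close> lives on a fixed level, there is a largest standard set of tuples
  from \<open>R\<close>, namely \<open>rel_code R\<close>, and by \<open>transfer_subset\<close> its
  extension contains the extensions of all the others.\<close>

lemma star_rel_code:
  assumes "R \<subseteq> tuples n" "arity n"
  shows "star_rel U R vs \<longleftrightarrow> (\<exists>p. smem U p (star U (rel_code R)) \<and> is_tuple (smem U) p vs)"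
proof
  assume "star_rel U R vs"
  then obtain a p where a: "\<And>q. mem U q a \<Longrightarrow> \<exists>us\<in>R. is_tuple (mem U) q us"
    and p: "smem U p (star U a)" "is_tuple (smem U) p vs"
    unfolding star_rel_def by blast
  have "smem U p (star U (rel_code R))"
    by (rule transfer_subset[OF _ p(1)]) (simp add: mem_rel_code[OF assms] a)
  then show "\<exists>p. smem U p (star U (rel_code R)) \<and> is_tuple (smem U) p vs"
    using p(2) by blast
next
  assume "\<exists>p. smem U p (star U (rel_code R)) \<and> is_tuple (smem U) p vs"
  then show "star_rel U R vs"
    unfolding star_rel_def using mem_rel_code[OF assms] by blast
qed

definition VM :: 'u where "VM = set_code M"

text \<open>The extension of the set \<open>M\<close>. Vectors, operators and numbers are all
  treated as points of this one set.\<close>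

definition D :: "'v set" where "D = {v. smem U v (star U VM)}"

lemma mem_VM [simp]: "mem U x VM \<longleftrightarrow> x \<in> M"
  unfolding VM_def by (rule mem_set_code[of _ "k + 5"]) (auto simp: M_def)

text \<open>A default value for the variables beyond the listed points, so that every assignment
  takes its values in \<open>M\<close>.\<close>

definition pt :: 'u where "pt = cpx U 0"

lemma pt_M: "pt \<in> M"
  unfolding pt_def M_def by (rule cpx_level)

text \<open>Transfer concerns assignments of standard values. Closing the formula by quantifiers
  bounded by \<open>VM\<close> turns validity for all assignments into one such instance, and its
  transferred form can be specialised to arbitrary points of \<open>D\<close>.\<close>

lemma transfer_closed:
  assumes valid: "\<And>x. (\<forall>i. x i \<in> M) \<Longrightarrow> sat (mem U) \<phi> (env VM \<rho> x)"
    and "\<forall>i<n. y i \<in> D" "\<forall>i\<ge>n. y i = star U pt"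
  shows "sat (smem U) \<phi> (env (star U VM) (star U \<circ> \<rho>) y)"
proof -
  have "sat (mem U) (all_fm n \<phi>) (env VM \<rho> (\<lambda>_. pt))"
    unfolding sat_all_fm by (intro allI impI valid) (metis mem_VM not_less pt_M)
  then have "sat (smem U) (all_fm n \<phi>) (star U \<circ> env VM \<rho> (\<lambda>_. pt))"
    by (simp add: transfer)
  also have "star U \<circ> env VM \<rho> (\<lambda>_. pt) = env (star U VM) (star U \<circ> \<rho>) (\<lambda>_. star U pt)"
    by (auto simp: env_def)
  finally show ?thesis
    unfolding sat_all_fm using assms(2,3) by (auto simp: D_def)
qed

definition list_env :: "'a \<Rightarrow> 'a list \<Rightarrow> nat \<Rightarrow> 'a" where
  "list_env a vs i = (if i < length vs then vs ! i else a)"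

lemma map_list_env [simp]:
  "map (list_env a vs) [0..<length vs] = vs"
  "length vs = n \<Longrightarrow> map (list_env a (vs @ ws)) [0..<n] = vs"
  by (auto simp: list_env_def nth_append intro!: nth_equalityI)

lemma transfer_list:
  assumes "\<And>x. (\<forall>i. x i \<in> M) \<Longrightarrow> sat (mem U) \<phi> (env VM \<rho> x)" and "set vs \<subseteq> D"
  shows "sat (smem U) \<phi> (env (star U VM) (star U \<circ> \<rho>) (list_env (star U pt) vs))"
  by (rule transfer_closed[OF assms(1), where n = "length vs"])
     (use assms(2) in \<open>auto simp: list_env_def\<close>)

lemma star_rel_D:
  assumes R: "R \<subseteq> tuples n" "arity n" and vs: "star_rel U R vs" "length vs = n"
  shows "set vs \<subseteq> D"
proof -
  obtain p where p: "smem U p (star U (rel_code R))" "is_tuple (smem U) p vs"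
    using vs(1) by (auto simp: star_rel_code[OF R])
  \<comment> \<open>The negated \<open>all_fm\<close> of a negation is an existential quantifier:
    every member of the code of \<open>R\<close> is the tuple of some points of
    \<open>M\<close>.\<close>
  let ?\<phi> = "BAll (3*n) (Suc (3*0)) (Neg (all_fm n (Neg (tuple_fm 1 (3*n) (map ((*) 3) [0..<n])))))"
  have "sat (smem U) ?\<phi> (env (star U VM) (star U \<circ> (\<lambda>_. rel_code R)) (list_env (star U pt) []))"
  proof (rule transfer_list)
    fix x :: "nat \<Rightarrow> 'u"
    have "\<exists>y. (\<forall>i<n. y i \<in> M) \<and> (\<forall>i\<ge>n. y i = (x(n := q)) i) \<and> is_tuple (mem U) (y n) (map y [0..<n])"
      if q: "mem U q (rel_code R)" for q
    proof -
      obtain us where us: "us \<in> R" "is_tuple (mem U) q us"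
        using q mem_rel_code[OF R, of q] by blast
      then have "length us = n" "set us \<subseteq> M" using R by (auto simp: tuples_def)
      then have "map (\<lambda>i. if i < n then us ! i else (x(n := q)) i) [0..<n] = us" "\<forall>i<n. us ! i \<in> M"
        by (auto intro!: nth_equalityI)
      then show ?thesis
        using us(2) by (intro exI[of _ "\<lambda>i. if i < n then us ! i else (x(n := q)) i"]) auto
    qed
    then have "\<forall>q. mem U q (rel_code R) \<longrightarrow> \<not> (\<forall>y. (\<forall>i<n. y i \<in> M) \<and>
      (\<forall>i\<ge>n. y i = (x(n := q)) i) \<longrightarrow> \<not> is_tuple (mem U) (y n) (map y [0..<n]))"
      by (simp only: not_all not_imp not_not) simp
    then show "sat (mem U) ?\<phi> (env VM (\<lambda>_. rel_code R) x)"
      unfolding sat.simps env_simps sat_all_fm sat_tuple_env mem_VM by simp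
  qed auto
  then have "\<forall>q. smem U q (star U (rel_code R)) \<longrightarrow> \<not> (\<forall>y. (\<forall>i<n. smem U (y i) (star U VM)) \<and>
      (\<forall>i\<ge>n. y i = ((list_env (star U pt) [])(n := q)) i) \<longrightarrow> \<not> is_tuple (smem U) (y n) (map y [0..<n]))"
    unfolding sat.simps env_simps sat_all_fm sat_tuple_env comp_def by simp
  from this[rule_format, OF p(1)] obtain y where y: "\<forall>i<n. smem U (y i) (star U VM)"
      "\<forall>i\<ge>n. y i = ((list_env (star U pt) [])(n := p)) i" "is_tuple (smem U) (y n) (map y [0..<n])"
    by auto
  have "y n = p" using y(2) by simp
  have "vs = map y [0..<n]"
    using is_tuple_inject[OF p(2) y(3)[unfolded \<open>y n = p\<close>]] vs(2) by simp
  then show ?thesis using y(1) by (auto simp: D_def)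
qed

text \<open>Points serve as variables: a map \<open>g\<close> from points to \<open>M\<close> is an
  assignment, so an implication that holds for all \<open>g\<close> is a valid bounded formula, and
  transfer evaluates it at the points themselves.\<close>

lemma star_rel_conj:
  fixes R :: "nat \<Rightarrow> 'u list set" and vs :: "nat \<Rightarrow> 'v list"
  assumes R: "\<And>i. i < n \<Longrightarrow> R i \<subseteq> tuples (a i)" "\<And>i. i < n \<Longrightarrow> arity (a i)"
      "\<And>i. i < n \<Longrightarrow> length (vs i) = a i" "\<And>i. i < n \<Longrightarrow> star_rel U (R i) (vs i)"
    and T: "T \<subseteq> tuples b" "arity b" "length ws = b" "set ws \<subseteq> D"
    and imp: "\<And>g. (\<forall>v\<in>D. g v \<in> M) \<Longrightarrow> (\<forall>i<n. map g (vs i) \<in> R i) \<Longrightarrow> map g ws \<in> T"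
  shows "star_rel U T ws"
proof -
  have sub: "(\<Union>i<n. set (vs i)) \<union> set ws \<subseteq> D"
    using star_rel_D[OF R(1,2,4,3)] T(4) by auto
  obtain W where W: "set W = (\<Union>i<n. set (vs i)) \<union> set ws" "distinct W"
    using finite_distinct_list[of "(\<Union>i<n. set (vs i)) \<union> set ws"] by auto
  \<comment> \<open>\<open>W\<close> lists the finitely many points that occur, and
    \<open>idx v\<close> is the number of the variable that stands for \<open>v\<close>.\<close>
  define idx where "idx v = (THE i. i < length W \<and> W ! i = v)" for v
  have idx: "list_env z W (idx v) = v" if "v \<in> set W" for v z
  proof -
    have "\<exists>!i. i < length W \<and> W ! i = v"
      using that W(2) by (metis distinct_Ex1)
    from theI'[OF this] show ?thesis by (auto simp: idx_def list_env_def)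
  qed
  define \<rho> where "\<rho> i = (if i < n then rel_code (R i) else rel_code T)" for i
  let ?\<phi> = "Imp (conj_fm n (\<lambda>i. rel_fm i (map idx (vs i)))) (rel_fm n (map idx ws))"
  have "sat (smem U) ?\<phi> (env (star U VM) (star U \<circ> \<rho>) (list_env (star U pt) W))"
  proof (rule transfer_list)
    fix x :: "nat \<Rightarrow> 'u" assume x: "\<forall>i. x i \<in> M"
    have tup: "map x (map idx us) \<in> tuples (length us)" for us
      using x by (auto simp: tuples_def)
    have 1: "sat (mem U) (rel_fm i (map idx (vs i))) (env VM \<rho> x) \<longleftrightarrow> map (x \<circ> idx) (vs i) \<in> R i"
      if "i < n" for i
      using tuple_in_rel_code[OF R(1,2), OF that that, of "map x (map idx (vs i))"]
        tup[of "vs i"] R(3)[OF that] that by (simp add: \<rho>_def)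
    have 2: "sat (mem U) (rel_fm n (map idx ws)) (env VM \<rho> x) \<longleftrightarrow> map (x \<circ> idx) ws \<in> T"
      using tuple_in_rel_code[OF T(1,2), of "map x (map idx ws)"] tup[of ws] T(3)
      by (simp add: \<rho>_def)
    show "sat (mem U) ?\<phi> (env VM \<rho> x)"
      using imp[of "x \<circ> idx"] x by (simp only: sat.simps sat_conj_fm 2) (auto simp del: sat_rel_fm simp add: 1)
  qed (use sub W in auto)
  moreover have "map (list_env (star U pt) W) (map idx us) = us" if "set us \<subseteq> set W" for us
    using that idx by (auto intro!: map_idI)
  moreover have "set (vs i) \<subseteq> set W" if "i < n" for i using W that by auto
  moreover have "set ws \<subseteq> set W" using W by auto
  moreover have "\<exists>p. smem U p (star U (rel_code (R i))) \<and> is_tuple (smem U) p (vs i)" if "i < n" for i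
    using star_rel_code[OF R(1,2), OF that that] R(4)[OF that] by blast
  ultimately show ?thesis
    unfolding star_rel_code[OF T(1,2)] by (simp add: \<rho>_def del: map_map)
qed

text \<open>Extension commutes with projection along the last coordinate: witnesses for standard
  tuples lie in \<open>M\<close>, so the existential quantifier is bounded by \<open>VM\<close> and
  transfers.\<close>

lemma star_rel_ex:
  assumes R: "R \<subseteq> tuples (Suc n)" "arity n" "arity (Suc n)" and vs: "length vs = n"
    and S: "star_rel U {us \<in> tuples n. \<exists>w. us @ [w] \<in> R} vs"
  shows "\<exists>w. star_rel U R (vs @ [w])"
proof -
  let ?S = "{us \<in> tuples n. \<exists>w. us @ [w] \<in> R}"
  let ?\<phi> = "Imp (rel_fm 0 [0..<n]) (BEx (3*n) 2 (rel_fm 1 [0..<Suc n]))"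
  define \<rho> where "\<rho> i = (if i = 0 then rel_code ?S else rel_code R)" for i :: nat
  have "sat (smem U) ?\<phi> (env (star U VM) (star U \<circ> \<rho>) (list_env (star U pt) vs))"
  proof (rule transfer_list)
    fix x :: "nat \<Rightarrow> 'u" assume x: "\<forall>i. x i \<in> M"
    have t: "map x [0..<n] \<in> tuples n" using x by (auto simp: tuples_def)
    have 1: "sat (mem U) (rel_fm 0 [0..<n]) (env VM \<rho> x) \<longleftrightarrow> (\<exists>w. map x [0..<n] @ [w] \<in> R)"
      using tuple_in_rel_code[of ?S n, OF _ R(2) t] t by (auto simp: \<rho>_def)
    have 2: "sat (mem U) (rel_fm 1 [0..<Suc n]) (env VM \<rho> (x(n := w))) \<longleftrightarrow> map x [0..<n] @ [w] \<in> R"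
      if "w \<in> M" for w
    proof -
      have "map (x(n := w)) [0..<Suc n] = map x [0..<n] @ [w]" by simp
      moreover have "map x [0..<n] @ [w] \<in> tuples (Suc n)" using t that by (auto simp: tuples_def)
      ultimately show ?thesis
        using tuple_in_rel_code[OF R(1,3)] by (simp only: sat_rel_fm) (simp add: \<rho>_def)
    qed
    have 3: "w \<in> M" if "map x [0..<n] @ [w] \<in> R" for w
      using that R(1) by (auto simp: tuples_def)
    show "sat (mem U) ?\<phi> (env VM \<rho> x)"
      by (simp only: sat.simps 1 env_simps mem_VM) (use 2 3 in blast)
  qed (use star_rel_D[OF _ R(2) S vs] in auto)
  moreover have "\<exists>p. smem U p (star U (\<rho> 0)) \<and> is_tuple (smem U) p vs"
    using star_rel_code[of ?S n, OF _ R(2)] S by (auto simp: \<rho>_def)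
  ultimately obtain w p where "smem U p (star U (rel_code R))"
     "is_tuple (smem U) p (map ((list_env (star U pt) vs)(n := w)) [0..<Suc n])"
    using vs by (simp only: sat.simps env_simps sat_rel_fm comp_def map_list_env)
      (auto simp: \<rho>_def)
  moreover have "map ((list_env (star U pt) vs)(n := w)) [0..<Suc n] = vs @ [w]"
    using vs by (auto simp: list_env_def nth_append intro!: nth_equalityI)
  ultimately show ?thesis using star_rel_code[OF R(1,3)] by metis
qed

lemma star_rel_compl:
  assumes "R \<subseteq> tuples n" "arity n" "length vs = n" "set vs \<subseteq> D" "\<not> star_rel U R vs"
  shows "star_rel U (tuples n - R) vs"
proof -
  let ?\<phi> = "Disj (rel_fm 0 [0..<n]) (rel_fm 1 [0..<n])"
  define \<rho> where "\<rho> i = (if i = 0 then rel_code R else rel_code (tuples n - R))" for i :: nat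
  have "sat (smem U) ?\<phi> (env (star U VM) (star U \<circ> \<rho>) (list_env (star U pt) vs))"
  proof (rule transfer_list)
    fix x :: "nat \<Rightarrow> 'u" assume x: "\<forall>i. x i \<in> M"
    have t: "map x [0..<n] \<in> tuples n" using x by (auto simp: tuples_def)
    show "sat (mem U) ?\<phi> (env VM \<rho> x)"
      using tuple_in_rel_code[OF assms(1,2) t] tuple_in_rel_code[OF _ assms(2) t, of "tuples n - R"] t
      by (auto simp: \<rho>_def)
  qed (use assms in auto)
  then show ?thesis
    using star_rel_code[OF assms(1,2)] star_rel_code[OF _ assms(2), of "tuples n - R"] assms(3,5)
    by (auto simp: \<rho>_def)
qed

text \<open>Equality is a primitive of bounded formulas and has its true meaning in both universes,
  so the diagonal extends to the diagonal.\<close>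

lemma star_rel_eqD:
  assumes "star_rel U {[x, x] | x. x \<in> M} [v, w]"
  shows "v = w"
proof -
  let ?R = "{[x, x] | x. x \<in> M}"
  have R: "?R \<subseteq> tuples 2" "arity 2" by (auto simp: tuples_def arity_def)
  let ?\<phi> = "Imp (rel_fm 0 [0,1]) (Equ (3*0) (3*1))"
  have "sat (smem U) ?\<phi> (env (star U VM) (star U \<circ> (\<lambda>_. rel_code ?R)) (list_env (star U pt) [v, w]))"
  proof (rule transfer_list)
    fix x :: "nat \<Rightarrow> 'u" assume x: "\<forall>i. x i \<in> M"
    show "sat (mem U) ?\<phi> (env VM (\<lambda>_. rel_code ?R) x)"
      using tuple_in_rel_code[OF R, of "[x 0, x 1]"] x
      by (simp only: sat.simps sat_rel_fm env_simps) (auto simp: tuples_def)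
  qed (use star_rel_D[OF R assms] in auto)
  then show ?thesis
    using assms star_rel_code[OF R]
    by (simp only: sat.simps sat_rel_fm env_simps) (auto simp: list_env_def)
qed

lemma star_D: "c \<in> M \<Longrightarrow> star U c \<in> D"
  using transfer[of "Mem 0 1" "(\<lambda>_. VM)(0 := c)"] by (simp add: D_def)

lemma star_rel_star:
  assumes "R \<subseteq> tuples n" "arity n" "us \<in> R"
  shows "star_rel U R (map (star U) us)"
proof -
  have us: "set us \<subseteq> M" "length us = n" using assms by (auto simp: tuples_def)
  obtain p where p: "mem U p (rel_code R)" "is_tuple (mem U) p us"
    using mem_rel_code[OF assms(1,2)] tuple_in_rel_code[OF assms(1,2)] assms by blast
  let ?x = "(list_env pt us)"
  have "sat (mem U) (rel_fm 0 [0..<n]) (env VM (\<lambda>_. rel_code R) ?x)"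
    using p us by auto
  then have "sat (smem U) (rel_fm 0 [0..<n]) (star U \<circ> env VM (\<lambda>_. rel_code R) ?x)"
    by (simp only: transfer)
  also have "star U \<circ> env VM (\<lambda>_. rel_code R) ?x =
      env (star U VM) (star U \<circ> (\<lambda>_. rel_code R)) (list_env (star U pt) (map (star U) us))"
    by (auto simp: env_def list_env_def)
  finally show ?thesis
    using star_rel_code[OF assms(1,2)] us(2) map_list_env(1)[of "star U pt" "map (star U) us"] by simp
qed

text \<open>Saturation asks for internal sets. The condition on \<open>last\<close> puts each
  section of \<open>R n\<close> into \<open>level U (k + 4)\<close>, so that the section has a code
  in \<open>M\<close>; transferring the existence of this code makes the solution set of each
  condition internal. This accounts for the last level below \<open>M\<close>.\<close>

lemma star_rel_saturated:
  assumes R: "\<And>n. R n \<subseteq> tuples (Suc a)" "arity a" "arity (Suc a)"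
    and last: "\<And>n us. us \<in> R n \<Longrightarrow> last us \<in> level U (k + 4)"
    and vs: "\<And>n::nat. length (vs n) = a" "\<And>n. set (vs n) \<subseteq> D"
    and fip: "\<And>N. \<exists>x. \<forall>n\<le>N. star_rel U (R n) (vs n @ [x])"
  shows "\<exists>x. \<forall>n. star_rel U (R n) (vs n @ [x])"
proof -
  have "\<exists>A. internal U A \<and> (\<forall>x. smem U x A \<longleftrightarrow> star_rel U (R n) (vs n @ [x]))" for n
  proof -
    let ?r = "rel_fm 0 [0..<Suc a]" and ?A = "3 * Suc a" and ?x = "3 * a"
    \<comment> \<open>The variable \<open>?A\<close> holds a set whose members are exactly the last
      coordinates that complete the first \<open>a\<close> points to a tuple of the
      relation.\<close>
    let ?\<phi> = "BEx ?A 2 (Conj (BAll ?x ?A ?r) (BAll ?x 2 (Imp ?r (Mem ?x ?A))))"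
    have "sat (smem U) ?\<phi> (env (star U VM) (star U \<circ> (\<lambda>_. rel_code (R n))) (list_env (star U pt) (vs n)))"
    proof (rule transfer_list)
      fix x :: "nat \<Rightarrow> 'u" assume x: "\<forall>i. x i \<in> M"
      define B where "B = {w. map x [0..<a] @ [w] \<in> R n}"
      have B: "B \<subseteq> level U (k + 4)" unfolding B_def using last by fastforce
      then have BM: "B \<subseteq> M" using level_mono[of "k + 4" "k + 5"] by (auto simp: M_def)
      have c: "set_code B \<in> M" "\<And>w. mem U w (set_code B) \<longleftrightarrow> w \<in> B"
        using set_code_level[OF B] mem_set_code[OF B] by (auto simp: M_def numeral_eq_Suc)
      have r: "sat (mem U) ?r (env VM (\<lambda>_. rel_code (R n)) (x(Suc a := z, a := w))) \<longleftrightarrow> w \<in> B"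
        if "w \<in> M" for w z
      proof -
        have "map (x(Suc a := z, a := w)) [0..<Suc a] = map x [0..<a] @ [w]" by simp
        moreover have "map x [0..<a] @ [w] \<in> tuples (Suc a)" using x that by (auto simp: tuples_def)
        ultimately show ?thesis
          using tuple_in_rel_code[OF R(1,3)] by (simp only: sat_rel_fm) (simp add: B_def)
      qed
      show "sat (mem U) ?\<phi> (env VM (\<lambda>_. rel_code (R n)) x)"
        using c BM r by (simp only: sat.simps env_simps mem_VM) (intro exI[of _ "set_code B"], auto)
    qed (use vs in auto)
    then obtain A where A: "smem U A (star U VM)"
      "\<forall>w. smem U w A \<longrightarrow> (\<exists>p. smem U p (star U (rel_code (R n))) \<and>
        is_tuple (smem U) p (map ((list_env (star U pt) (vs n))(Suc a := A, a := w)) [0..<Suc a]))"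
      "\<forall>w. smem U w (star U VM) \<longrightarrow> (\<exists>p. smem U p (star U (rel_code (R n))) \<and>
        is_tuple (smem U) p (map ((list_env (star U pt) (vs n))(Suc a := A, a := w)) [0..<Suc a])) \<longrightarrow> smem U w A"
      by (simp only: sat.simps env_simps sat_rel_fm comp_def not_not not_ex) (auto; blast)
    have mp: "map ((list_env (star U pt) (vs n))(Suc a := A, a := w)) [0..<Suc a] = vs n @ [w]" for w
      using vs(1)[of n] by (auto simp: list_env_def nth_append intro!: nth_equalityI)
    have "smem U x A \<longleftrightarrow> star_rel U (R n) (vs n @ [x])" for x
      using A(2,3) star_rel_code[OF R(1,3), of n "vs n @ [x]"] star_rel_D[OF R(1,3), of n "vs n @ [x]"] vs(1)[of n]
      unfolding mp by (auto simp: D_def)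
    then show ?thesis using A(1) by (auto simp: internal_def)
  qed
  then obtain A where A: "\<And>n. internal U (A n)" "\<And>n x. smem U x (A n) \<longleftrightarrow> star_rel U (R n) (vs n @ [x])"
    by metis
  have "\<exists>x. \<forall>B\<in>range A. smem U x B"
  \<comment> \<open>The family is countable, hence smaller than \<kappa>.\<close>
  proof (rule saturation)
    have "|range A| \<le>o |UNIV :: nat set|" by (rule card_of_image)
    then show "|range A| <o \<kappa>"
      using card_\<kappa> card_of_nat ordLeq_ordIso_trans ordLeq_ordLess_trans by blast
    fix G assume G: "G \<subseteq> range A" "finite G"
    then obtain I where I: "finite I" "G = A ` I" by (meson finite_subset_image)
    obtain N where "\<forall>i\<in>I. i \<le> N" using I(1) finite_nat_set_iff_bounded_le by auto
    moreover obtain x where "\<forall>n\<le>N. star_rel U (R n) (vs n @ [x])" using fip by blast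
    ultimately show "\<exists>x. \<forall>B\<in>G. smem U x B" using A(2) I(2) by (intro exI[of _ x]) auto
  qed (use A in auto)
  then show ?thesis using A(2) by auto
qed

end

context nonstandard_setting
begin

text \<open>A point \<open>v\<close> of \<open>D\<close> is treated as the random element \<open>g v\<close> of \<open>M\<close>: an extended relation holds
  between points iff the relation holds \<open>FF\<close>-eventually between their values.\<close>

definition FF :: "('v \<Rightarrow> 'u) filter" where
  "FF = (INF p\<in>{(R, vs). arity (length vs) \<and> R \<subseteq> tuples (length vs) \<and> star_rel U R vs}.
           principal {g. map g (snd p) \<in> fst p})"

text \<open>For the converse, an eventual statement follows from finitely many of the relations that
  generate \<open>FF\<close>, and \<open>star_rel_conj\<close> transfers this implication.\<close>

lemma star_rel_iff_eventually:
  assumes R: "R \<subseteq> tuples n" "arity n" and vs: "length vs = n" "set vs \<subseteq> D"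
  shows "star_rel U R vs \<longleftrightarrow> (\<forall>\<^sub>F g in FF. map g vs \<in> R)"
proof
  assume "star_rel U R vs"
  then have "(R, vs) \<in> {(R, vs). arity (length vs) \<and> R \<subseteq> tuples (length vs) \<and> star_rel U R vs}"
    using R vs by simp
  then show "\<forall>\<^sub>F g in FF. map g vs \<in> R"
    unfolding FF_def by (rule eventually_INF1) (simp add: eventually_principal)
next
  let ?B = "{(R, vs). arity (length vs) \<and> R \<subseteq> tuples (length vs) \<and> star_rel U R vs}"
  assume "\<forall>\<^sub>F g in FF. map g vs \<in> R"
  then obtain X where X: "X \<subseteq> ?B" "finite X"
      "eventually (\<lambda>g. map g vs \<in> R) (INF p\<in>X. principal {g. map g (snd p) \<in> fst p})"
    unfolding FF_def by (subst (asm) eventually_INF) (elim exE conjE)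
  have ev: "map g vs \<in> R" if "\<And>p. p \<in> X \<Longrightarrow> map g (snd p) \<in> fst p" for g
  proof -
    have "g \<in> (\<Inter>p\<in>X. {g. map g (snd p) \<in> fst p})" using that by simp
    then show ?thesis
      using X(3) unfolding INF_principal_finite[OF X(2)] eventually_principal by (rule bspec[rotated])
  qed
  obtain ps where ps: "set ps = X" using finite_list[OF X(2)] by blast
  have psB: "arity (length (snd (ps ! i)))" "fst (ps ! i) \<subseteq> tuples (length (snd (ps ! i)))"
      "star_rel U (fst (ps ! i)) (snd (ps ! i))" if "i < length ps" for i
  proof -
    have "ps ! i \<in> ?B" using nth_mem[OF that] ps X(1) by (simp only: subset_iff)
    then show "arity (length (snd (ps ! i)))" "fst (ps ! i) \<subseteq> tuples (length (snd (ps ! i)))"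
      "star_rel U (fst (ps ! i)) (snd (ps ! i))" by auto
  qed
  show "star_rel U R vs"
  proof (rule star_rel_conj[where n = "length ps" and R = "\<lambda>i. fst (ps ! i)" and
        vs = "\<lambda>i. snd (ps ! i)" and a = "\<lambda>i. length (snd (ps ! i))" and b = n])
    fix g :: "'v \<Rightarrow> 'u"
    assume *: "\<forall>i<length ps. map g (snd (ps ! i)) \<in> fst (ps ! i)"
    show "map g vs \<in> R"
    proof (rule ev)
      fix p assume "p \<in> X"
      then obtain i where "i < length ps" "p = ps ! i" using ps by (metis in_set_conv_nth)
      then show "map g (snd p) \<in> fst p" using * by simp
    qed
  qed (rule psB R vs refl; assumption?)+
qed

section \<open>Deciding and realising eventual statements\<close>

lemma not_star_rel_empty: "\<not> star_rel U {} vs"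
proof
  assume "star_rel U {} vs"
  then obtain p where p: "smem U p (star U (rel_code {}))"
    using star_rel_code[of "{}" 1 vs] by (auto simp: arity_def)
  have "\<not> sat (mem U) (BEx 1 0 (Equ 1 1)) (\<lambda>_. rel_code {})"
    using mem_rel_code[of "{}" 1] by (auto simp: arity_def)
  then have "\<not> sat (smem U) (BEx 1 0 (Equ 1 1)) (star U \<circ> (\<lambda>_. rel_code {}))"
    by (simp only: transfer not_False_eq_True)
  then show False using p by simp
qed

lemma FF_nonbot: "FF \<noteq> bot"
proof
  assume "FF = bot"
  then have "star_rel U {} [star U pt]"
    using star_rel_iff_eventually[of "{}" 1 "[star U pt]"] star_D[OF pt_M] by (simp add: arity_def)
  then show False by (simp add: not_star_rel_empty)
qed

lemma eventually_tuples:
  assumes "set vs \<subseteq> D" "arity (length vs)"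
  shows "\<forall>\<^sub>F g in FF. map g vs \<in> tuples (length vs)"
  using star_rel_iff_eventually[of "tuples (length vs)" "length vs" vs]
    star_rel_compl[of "{}" "length vs" vs] not_star_rel_empty assms by simp

lemma eventually_M: "v \<in> D \<Longrightarrow> \<forall>\<^sub>F g in FF. g v \<in> M"
  using eventually_tuples[of "[v]"] by (simp add: tuples_def arity_def)

text \<open>A property of the values at finitely many points is a relation on \<open>M\<close>, and
  either it or its complement holds of these points. The dichotomy is thus obtained for such
  properties of \<open>g\<close>, not for arbitrary sets of maps.\<close>

lemma ultra:
  assumes "set vs \<subseteq> D" "arity (length vs)"
  shows "(\<forall>\<^sub>F g in FF. P (map g vs)) \<or> (\<forall>\<^sub>F g in FF. \<not> P (map g vs))"
proof -
  let ?n = "length vs" let ?R = "{us \<in> tuples ?n. P us}"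
  show ?thesis
  proof (cases "star_rel U ?R vs")
    case True
    then have "\<forall>\<^sub>F g in FF. map g vs \<in> ?R"
      using star_rel_iff_eventually[of ?R ?n vs] assms by simp
    then show ?thesis by (simp add: eventually_conj_iff)
  next
    case False
    then have "star_rel U (tuples ?n - ?R) vs"
      using star_rel_compl[of ?R ?n vs] assms by simp
    then have "\<forall>\<^sub>F g in FF. map g vs \<in> tuples ?n - ?R"
      using star_rel_iff_eventually[of "tuples ?n - ?R" ?n vs] assms by simp
    then show ?thesis by (intro disjI2) (auto elim: eventually_mono)
  qed
qed

text \<open>Choices made separately for each \<open>g\<close> are replaced by one internal point:
  values and witnesses together form a relation, and \<open>star_rel_ex\<close> supplies an internal
  last coordinate.\<close>

lemma choice_list:
  assumes vs: "set vs \<subseteq> D" "arity (length vs)" "arity (Suc (length vs))"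
    and ex: "\<forall>\<^sub>F g in FF. \<exists>w\<in>M. P (map g vs) w"
  shows "\<exists>w\<in>D. \<forall>\<^sub>F g in FF. P (map g vs) (g w)"
proof -
  let ?n = "length vs"
  define R where "R = {us @ [w] | us w. us \<in> tuples ?n \<and> w \<in> M \<and> P us w}"
  have R: "R \<subseteq> tuples (Suc ?n)" by (auto simp: R_def tuples_def)
  have "\<forall>\<^sub>F g in FF. map g vs \<in> {us \<in> tuples ?n. \<exists>w. us @ [w] \<in> R}"
    using ex eventually_tuples[OF vs(1,2)] by eventually_elim (auto simp: R_def)
  then have "star_rel U {us \<in> tuples ?n. \<exists>w. us @ [w] \<in> R} vs"
    using star_rel_iff_eventually[of _ ?n vs] vs by simp
  then obtain w where w: "star_rel U R (vs @ [w])"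
    using star_rel_ex[OF R vs(2,3) refl] by blast
  have "set (vs @ [w]) \<subseteq> D" by (rule star_rel_D[OF R vs(3) w]) simp
  moreover have "\<forall>\<^sub>F g in FF. map g (vs @ [w]) \<in> R"
    using star_rel_iff_eventually[OF R vs(3), of "vs @ [w]"] w calculation by simp
  then have "\<forall>\<^sub>F g in FF. P (map g vs) (g w)"
    by (rule eventually_mono) (auto simp: R_def)
  ultimately show ?thesis by auto
qed

lemma choice1:
  assumes "a \<in> D" "\<forall>\<^sub>F g in FF. \<exists>w\<in>M. P (g a) w"
  shows "\<exists>w\<in>D. \<forall>\<^sub>F g in FF. P (g a) (g w)"
  using choice_list[of "[a]" "\<lambda>us w. P (us ! 0) w"] assms by (simp add: arity_def)

lemma choice2:
  assumes "a \<in> D" "b \<in> D" "\<forall>\<^sub>F g in FF. \<exists>w\<in>M. P (g a) (g b) w"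
  shows "\<exists>w\<in>D. \<forall>\<^sub>F g in FF. P (g a) (g b) (g w)"
  using choice_list[of "[a, b]" "\<lambda>us w. P (us ! 0) (us ! 1) w"] assms by (simp add: arity_def)

lemma choice4:
  assumes "a \<in> D" "b \<in> D" "c \<in> D" "d \<in> D" "\<forall>\<^sub>F g in FF. \<exists>w\<in>M. P (g a) (g b) (g c) (g d) w"
  shows "\<exists>w\<in>D. \<forall>\<^sub>F g in FF. P (g a) (g b) (g c) (g d) (g w)"
  using choice_list[of "[a, b, c, d]" "\<lambda>us w. P (us ! 0) (us ! 1) (us ! 2) (us ! 3) w"] assms
  by (simp add: arity_def)

lemma ultra2:
  assumes "a \<in> D" "b \<in> D"
  shows "(\<forall>\<^sub>F g in FF. P (g a) (g b)) \<or> (\<forall>\<^sub>F g in FF. \<not> P (g a) (g b))"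
  using ultra[of "[a, b]" "\<lambda>us. P (us ! 0) (us ! 1)"] assms by (simp add: arity_def)

lemma D_eqI:
  assumes "v \<in> D" "w \<in> D" "\<forall>\<^sub>F g in FF. g v = g w"
  shows "v = w"
proof -
  have "\<forall>\<^sub>F g in FF. map g [v, w] \<in> {[x, x] | x. x \<in> M}"
    using assms(3) eventually_M[OF assms(1)] by eventually_elim auto
  then have "star_rel U {[x, x] | x. x \<in> M} [v, w]"
    using star_rel_iff_eventually[of "{[x, x] | x. x \<in> M}" 2 "[v, w]"] assms
    by (fastforce simp: tuples_def arity_def)
  then show ?thesis by (rule star_rel_eqD)
qed

lemma eventually_star:
  assumes "c \<in> M"
  shows "\<forall>\<^sub>F g in FF. g (star U c) = c"
proof -
  have R: "{[c]} \<subseteq> tuples 1" "arity 1" using assms by (auto simp: tuples_def arity_def)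
  have "star_rel U {[c]} (map (star U) [c])"
    by (rule star_rel_star[OF R]) simp
  then have "\<forall>\<^sub>F g in FF. map g [star U c] \<in> {[c]}"
    using star_rel_iff_eventually[OF R, of "[star U c]"] star_D[OF assms] by simp
  then show ?thesis by simp
qed

text \<open>Countable saturation for random points. The bound by \<open>level U (k + 4)\<close> is
  imposed on the approximate solutions because membership in that level is built into the relations
  handed to \<open>star_rel_saturated\<close>.\<close>

lemma saturated_list:
  fixes vs :: "nat \<Rightarrow> 'v list"
  assumes vs: "\<And>n. length (vs n) = a" "\<And>n. set (vs n) \<subseteq> D" "arity a" "arity (Suc a)"
    and fip: "\<And>N. \<exists>x\<in>D. \<forall>n\<le>N. \<forall>\<^sub>F g in FF. g x \<in> level U (k + 4) \<and> P n (map g (vs n)) (g x)"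
  shows "\<exists>x\<in>D. \<forall>n. \<forall>\<^sub>F g in FF. P n (map g (vs n)) (g x)"
proof -
  define R where "R n = {us @ [w] | us w. us \<in> tuples a \<and> w \<in> level U (k + 4) \<and> P n us w}" for n
  have lM: "level U (k + 4) \<subseteq> M" unfolding M_def by (rule level_mono) simp
  have R: "R n \<subseteq> tuples (Suc a)" for n using lM by (auto simp: R_def tuples_def)
  have mapR: "map g (vs n @ [x]) \<in> R n \<longleftrightarrow>
      map g (vs n) \<in> tuples a \<and> g x \<in> level U (k + 4) \<and> P n (map g (vs n)) (g x)" for n g x
    by (auto simp: R_def)
  have iff: "star_rel U (R n) (vs n @ [x]) \<longleftrightarrow> (\<forall>\<^sub>F g in FF. map g (vs n @ [x]) \<in> R n)" if "x \<in> D" for n x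
    by (rule star_rel_iff_eventually[OF R vs(4)]) (use vs that in auto)
  have "\<exists>x. \<forall>n. star_rel U (R n) (vs n @ [x])"
  proof (rule star_rel_saturated[OF R vs(3,4)])
    show "\<exists>x. \<forall>n\<le>N. star_rel U (R n) (vs n @ [x])" for N
    proof -
      obtain x where x: "x \<in> D" "\<forall>n\<le>N. \<forall>\<^sub>F g in FF. g x \<in> level U (k + 4) \<and> P n (map g (vs n)) (g x)"
        using fip by blast
      have "star_rel U (R n) (vs n @ [x])" if "n \<le> N" for n
      proof -
        have "\<forall>\<^sub>F g in FF. map g (vs n) \<in> tuples a"
          using eventually_tuples[OF vs(2), of n] vs(1,3) by simp
        then have "\<forall>\<^sub>F g in FF. map g (vs n @ [x]) \<in> R n"
          using x(2)[rule_format, OF that] by eventually_elim (simp only: mapR)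
        then show ?thesis using iff[OF x(1)] by blast
      qed
      then show ?thesis by blast
    qed
  qed (auto simp: R_def vs)
  then obtain x where x: "\<And>n. star_rel U (R n) (vs n @ [x])" by blast
  have "x \<in> D" using star_rel_D[OF R vs(4) x] vs(1) by simp
  moreover have "\<forall>\<^sub>F g in FF. P n (map g (vs n)) (g x)" for n
    using iff[OF \<open>x \<in> D\<close>, of n] x[of n] by (auto simp only: mapR elim: eventually_mono)
  ultimately show ?thesis by blast
qed

lemma star_rel_D_iff:
  assumes "R \<subseteq> tuples n" "arity n" "length vs = n"
  shows "star_rel U R vs \<longleftrightarrow> set vs \<subseteq> D \<and> (\<forall>\<^sub>F g in FF. map g vs \<in> R)"
  using star_rel_iff_eventually[OF assms(1,2,3)] star_rel_D[OF assms(1,2) _ assms(3)] by blast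

text \<open>\<open>R\<close> may be a class with tuples of unbounded level, so the description of
  its extension enters as a hypothesis. The value exists by choice, and it is unique because points
  that agree eventually are equal.\<close>

lemma star_fun_spec:
  assumes rel: "\<And>w. star_rel U R (vs @ [w]) \<longleftrightarrow> w \<in> D \<and> (\<forall>\<^sub>F g in FF. map g (vs @ [w]) \<in> R)"
    and vs: "set vs \<subseteq> D" "arity (length vs)" "arity (Suc (length vs))"
    and ex: "\<forall>\<^sub>F g in FF. \<exists>w\<in>M. map g vs @ [w] \<in> R"
    and unique: "\<forall>\<^sub>F g in FF. \<forall>w w'. map g vs @ [w] \<in> R \<longrightarrow> map g vs @ [w'] \<in> R \<longrightarrow> w = w'"
  shows "star_fun U R vs \<in> D \<and> (\<forall>\<^sub>F g in FF. map g vs @ [g (star_fun U R vs)] \<in> R)"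
proof -
  obtain w where w: "w \<in> D" "\<forall>\<^sub>F g in FF. map g vs @ [g w] \<in> R"
    using choice_list[OF vs, of "\<lambda>us w. us @ [w] \<in> R"] ex by blast
  have "star_fun U R vs = w"
    unfolding star_fun_def
  proof (rule the_equality)
    show "star_rel U R (vs @ [w])" using w by (simp add: rel)
    fix w' assume "star_rel U R (vs @ [w'])"
    then have w': "w' \<in> D" "\<forall>\<^sub>F g in FF. map g vs @ [g w'] \<in> R" by (simp_all add: rel)
    have "\<forall>\<^sub>F g in FF. g w' = g w"
      using unique w(2) w'(2) by eventually_elim blast
    with w'(1) w(1) show "w' = w" by (rule D_eqI)
  qed
  then show ?thesis using w by simp
qed

end

section \<open>Inner product spaces on a carrier set\<close>

locale inner_product_space =
  fixes S :: "'a ips"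
  assumes ips: "inner_product_space_on S"
begin

lemma add_closed [simp, intro]: "x \<in> car S \<Longrightarrow> y \<in> car S \<Longrightarrow> add S x y \<in> car S"
  and scl_closed [simp, intro]: "x \<in> car S \<Longrightarrow> scl S c x \<in> car S"
  and add_commute: "x \<in> car S \<Longrightarrow> y \<in> car S \<Longrightarrow> add S x y = add S y x"
  and add_assoc: "x \<in> car S \<Longrightarrow> y \<in> car S \<Longrightarrow> z \<in> car S \<Longrightarrow> add S (add S x y) z = add S x (add S y z)"
  and ex_zero: "\<exists>z\<in>car S. (\<forall>x\<in>car S. add S z x = x) \<and> (\<forall>x\<in>car S. \<exists>y\<in>car S. add S x y = z)"
  and scl_one: "x \<in> car S \<Longrightarrow> scl S 1 x = x"
  and scl_add_left: "x \<in> car S \<Longrightarrow> scl S (c + d) x = add S (scl S c x) (scl S d x)"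
proof -
  note * = ips[unfolded inner_product_space_on_def complex_vector_space_on_def, THEN conjunct1]
  show "x \<in> car S \<Longrightarrow> y \<in> car S \<Longrightarrow> add S x y \<in> car S"
    using *[THEN conjunct1] by metis
  note * = *[THEN conjunct2]
  show "x \<in> car S \<Longrightarrow> scl S c x \<in> car S"
    using *[THEN conjunct1] by metis
  note * = *[THEN conjunct2]
  show "x \<in> car S \<Longrightarrow> y \<in> car S \<Longrightarrow> add S x y = add S y x"
    using *[THEN conjunct1] by metis
  note * = *[THEN conjunct2]
  show "x \<in> car S \<Longrightarrow> y \<in> car S \<Longrightarrow> z \<in> car S \<Longrightarrow> add S (add S x y) z = add S x (add S y z)"
    using *[THEN conjunct1] by metis
  note * = *[THEN conjunct2]
  show "\<exists>z\<in>car S. (\<forall>x\<in>car S. add S z x = x) \<and> (\<forall>x\<in>car S. \<exists>y\<in>car S. add S x y = z)"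
    by (rule *[THEN conjunct1])
  note * = *[THEN conjunct2]
  show "x \<in> car S \<Longrightarrow> scl S 1 x = x"
    using *[THEN conjunct1] by metis
  note * = *[THEN conjunct2, THEN conjunct2]
  show "x \<in> car S \<Longrightarrow> scl S (c + d) x = add S (scl S c x) (scl S d x)"
    using *[THEN conjunct1] by metis
qed

lemma inn_add [simp]: "x \<in> car S \<Longrightarrow> y \<in> car S \<Longrightarrow> z \<in> car S \<Longrightarrow> inn S (add S x y) z = inn S x z + inn S y z"
  and inn_scl [simp]: "x \<in> car S \<Longrightarrow> y \<in> car S \<Longrightarrow> inn S (scl S c x) y = c * inn S x y"
  and inn_cnj: "x \<in> car S \<Longrightarrow> y \<in> car S \<Longrightarrow> inn S y x = cnj (inn S x y)"
  and inn_real: "x \<in> car S \<Longrightarrow> inn S x x \<in> \<real>"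
  and inn_nonneg [simp]: "x \<in> car S \<Longrightarrow> 0 \<le> Re (inn S x x)"
  and inn_self_zero: "x \<in> car S \<Longrightarrow> inn S x x = 0 \<Longrightarrow> x = hsub S x x"
proof -
  note * = ips[unfolded inner_product_space_on_def, THEN conjunct2]
  show "x \<in> car S \<Longrightarrow> y \<in> car S \<Longrightarrow> z \<in> car S \<Longrightarrow> inn S (add S x y) z = inn S x z + inn S y z"
    using *[THEN conjunct1] by metis
  note * = *[THEN conjunct2]
  show "x \<in> car S \<Longrightarrow> y \<in> car S \<Longrightarrow> inn S (scl S c x) y = c * inn S x y"
    using *[THEN conjunct1] by metis
  note * = *[THEN conjunct2]
  show "x \<in> car S \<Longrightarrow> y \<in> car S \<Longrightarrow> inn S y x = cnj (inn S x y)"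
    using *[THEN conjunct1] by metis
  note * = *[THEN conjunct2]
  show "x \<in> car S \<Longrightarrow> inn S x x \<in> \<real>" "x \<in> car S \<Longrightarrow> 0 \<le> Re (inn S x x)"
    using *[THEN conjunct1] by metis+
  show "x \<in> car S \<Longrightarrow> inn S x x = 0 \<Longrightarrow> x = hsub S x x"
    using *[THEN conjunct2] by metis
qed

lemma hsub_closed [simp, intro]: "x \<in> car S \<Longrightarrow> y \<in> car S \<Longrightarrow> hsub S x y \<in> car S"
  by (simp add: hsub_def)

lemma inn_hsub [simp]:
  "x \<in> car S \<Longrightarrow> y \<in> car S \<Longrightarrow> z \<in> car S \<Longrightarrow> inn S (hsub S x y) z = inn S x z - inn S y z"
  by (simp add: hsub_def)

lemma inn_add_right [simp]: "x \<in> car S \<Longrightarrow> y \<in> car S \<Longrightarrow> z \<in> car S \<Longrightarrow> inn S z (add S x y) = inn S z x + inn S z y"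
  by (subst (1 2 3) inn_cnj) auto

lemma inn_scl_right [simp]: "x \<in> car S \<Longrightarrow> y \<in> car S \<Longrightarrow> inn S x (scl S c y) = cnj c * inn S x y"
  by (subst (1 2) inn_cnj) auto

lemma inn_hsub_right [simp]: "x \<in> car S \<Longrightarrow> y \<in> car S \<Longrightarrow> z \<in> car S \<Longrightarrow> inn S z (hsub S x y) = inn S z x - inn S z y"
  by (simp add: hsub_def)

text \<open>Inner products separate vectors. Vector identities are from here on proved by comparing
  inner products, where sums and scalars become arithmetic of complex numbers.\<close>

lemma eqI:
  assumes x: "x \<in> car S" and y: "y \<in> car S" and eq: "\<And>z. z \<in> car S \<Longrightarrow> inn S x z = inn S y z"
  shows "x = y"
proof -
  obtain e where e: "e \<in> car S" "\<And>x. x \<in> car S \<Longrightarrow> add S e x = x"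
      "\<And>x. x \<in> car S \<Longrightarrow> \<exists>y\<in>car S. add S x y = e"
    using ex_zero by blast
  have zero: "scl S 0 v = e" if v: "v \<in> car S" for v
  proof -
    obtain w where w: "w \<in> car S" "add S (scl S 0 v) w = e" using e(3)[of "scl S 0 v"] v by auto
    have "add S (scl S 0 v) (scl S 0 v) = scl S 0 v" using scl_add_left[OF v, of 0 0] by simp
    then have "add S (scl S 0 v) e = e" using add_assoc[of "scl S 0 v" "scl S 0 v" w] w v by simp
    then show ?thesis using add_commute[of e "scl S 0 v"] e(1,2) v by simp
  qed
  have cancel: "add S v (scl S (-1) v) = e" "add S (scl S (-1) v) v = e" if "v \<in> car S" for v
    using scl_add_left[OF that, of 1 "-1"] scl_add_left[OF that, of "-1" 1] zero[OF that] scl_one[OF that]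
    by simp_all
  let ?d = "hsub S x y"
  have d: "?d \<in> car S" using x y by simp
  have "inn S ?d ?d = 0" using inn_hsub[OF x y d] eq[OF d] by (simp only: diff_self)
  \<comment> \<open>The record has no zero, so definiteness is stated as equality with
    \<open>hsub S x x\<close>; by \<open>cancel\<close> this vector is the neutral element
    \<open>e\<close>.\<close>
  then have "?d = hsub S ?d ?d" using inn_self_zero[OF d] by simp
  also have "\<dots> = e" using cancel(1)[OF d] by (subst hsub_def)
  finally have "add S x (scl S (-1) y) = e" by (simp only: hsub_def)
  then have "y = add S (add S x (scl S (-1) y)) y" using e(2)[OF y] by simp
  also have "\<dots> = add S x (add S (scl S (-1) y) y)" using add_assoc x y by simp
  also have "\<dots> = x" using cancel(2)[OF y] add_commute[OF x e(1)] e(2)[OF x] by simp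
  finally show ?thesis by simp
qed

lemma hnorm_nonneg [simp]: "x \<in> car S \<Longrightarrow> 0 \<le> hnorm S x"
  by (simp add: hnorm_def)

lemma hnorm_power2: "x \<in> car S \<Longrightarrow> (hnorm S x)\<^sup>2 = Re (inn S x x)"
  by (simp add: hnorm_def)

lemma inn_self: "x \<in> car S \<Longrightarrow> inn S x x = complex_of_real ((hnorm S x)\<^sup>2)"
  using inn_real[of x] by (simp add: hnorm_power2 complex_is_Real_iff complex_eq_iff)

lemma inn_zero_right: "x \<in> car S \<Longrightarrow> y \<in> car S \<Longrightarrow> inn S y y = 0 \<Longrightarrow> inn S x y = 0"
  by (subst inn_self_zero[of y]) auto

lemma Cauchy_Schwarz:
  assumes "x \<in> car S" "y \<in> car S"
  shows "cmod (inn S x y) \<le> hnorm S x * hnorm S y"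
proof (cases "hnorm S y = 0")
  case True
  then show ?thesis using inn_zero_right[OF assms] assms by (simp add: inn_self)
next
  case False
  let ?a = "(hnorm S x)\<^sup>2" and ?b = "(hnorm S y)\<^sup>2" and ?c = "inn S x y"
  \<comment> \<open>The component of \<open>x\<close> orthogonal to \<open>y\<close>, multiplied by
    the squared norm of \<open>y\<close> to avoid a division.\<close>
  let ?v = "hsub S (scl S (complex_of_real ?b) x) (scl S ?c y)"
  have v: "?v \<in> car S" using assms by simp
  have "inn S ?v ?v = complex_of_real (?b * (?a * ?b - (cmod ?c)\<^sup>2))"
    using assms inn_cnj[OF assms] complex_norm_square[of ?c] by (simp add: inn_self[OF assms(1)] inn_self[OF assms(2)] algebra_simps power2_eq_square)
  then have "0 \<le> ?b * (?a * ?b - (cmod ?c)\<^sup>2)"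
    using inn_nonneg[OF v] by simp
  moreover have "0 < ?b" using False by simp
  ultimately have "(cmod ?c)\<^sup>2 \<le> (hnorm S x * hnorm S y)\<^sup>2"
    by (simp add: zero_le_mult_iff power_mult_distrib)
  then show ?thesis by (rule power2_le_imp_le) (use assms in simp)
qed

lemma hnorm_scl [simp]: "x \<in> car S \<Longrightarrow> hnorm S (scl S c x) = cmod c * hnorm S x"
proof -
  assume x: "x \<in> car S"
  have "inn S (scl S c x) (scl S c x) = complex_of_real ((cmod c)\<^sup>2) * complex_of_real ((hnorm S x)\<^sup>2)"
    unfolding complex_norm_square using x by (simp add: inn_self[OF x])
  then have "(hnorm S (scl S c x))\<^sup>2 = (cmod c * hnorm S x)\<^sup>2"
    using x by (simp add: hnorm_power2[of "scl S c x"] power_mult_distrib flip: of_real_mult)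
  then show ?thesis using x by (simp add: power2_eq_iff_nonneg)
qed

lemma hnorm_add: 
  assumes "x \<in> car S" "y \<in> car S"
  shows "hnorm S (add S x y) \<le> hnorm S x + hnorm S y"
proof (rule power2_le_imp_le)
  have "Re (inn S x y) \<le> hnorm S x * hnorm S y"
    using complex_Re_le_cmod[of "inn S x y"] Cauchy_Schwarz[OF assms] by linarith
  then show "(hnorm S (add S x y))\<^sup>2 \<le> (hnorm S x + hnorm S y)\<^sup>2"
    using assms inn_cnj[OF assms] by (simp add: hnorm_power2 power2_sum)
qed (use assms in simp)

lemma hnorm_hsub_commute:
  assumes "x \<in> car S" "y \<in> car S" shows "hnorm S (hsub S x y) = hnorm S (hsub S y x)"
proof -
  have "hsub S x y = scl S (-1) (hsub S y x)" by (rule eqI) (use assms in auto)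
  then show ?thesis using assms by simp
qed

lemma hnorm_hsub_triangle:
  assumes "x \<in> car S" "y \<in> car S" "z \<in> car S"
  shows "hnorm S (hsub S x z) \<le> hnorm S (hsub S x y) + hnorm S (hsub S y z)"
proof -
  have "hsub S x z = add S (hsub S x y) (hsub S y z)" by (rule eqI) (use assms in auto)
  then show ?thesis using assms hnorm_add by simp
qed

lemma hnorm_le_hsub:
  assumes "x \<in> car S" "y \<in> car S" shows "hnorm S x \<le> hnorm S (hsub S x y) + hnorm S y"
proof -
  have "x = add S (hsub S x y) y" by (rule eqI) (use assms in auto)
  then show ?thesis using assms hnorm_add[of "hsub S x y" y] by simp
qed

lemma hnorm_hsub_le:
  assumes "x \<in> car S" "y \<in> car S" shows "hnorm S (hsub S x y) \<le> hnorm S x + hnorm S y"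
  using hnorm_add[of x "scl S (-1) y"] assms by (simp add: hsub_def)

lemma hnorm_hsub_eq_0: "x \<in> car S \<Longrightarrow> y \<in> car S \<Longrightarrow> hnorm S (hsub S x y) = 0 \<longleftrightarrow> x = y"
proof
  assume x: "x \<in> car S" "y \<in> car S" and n: "hnorm S (hsub S x y) = 0"
  have d: "hsub S x y \<in> car S" using x by simp
  have 0: "inn S (hsub S x y) (hsub S x y) = 0" unfolding inn_self[OF d] n by simp
  show "x = y"
  proof (rule eqI[OF x])
    fix z assume z: "z \<in> car S"
    have "inn S (hsub S x y) z = 0"
      unfolding inn_cnj[OF z d] inn_zero_right[OF z d 0] by simp
    then show "inn S x z = inn S y z" using x z by simp
  qed
next
  assume x: "x \<in> car S" "y \<in> car S" and "x = y"
  then have "(hnorm S (hsub S x y))\<^sup>2 = 0" by (simp add: hnorm_power2)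
  then show "hnorm S (hsub S x y) = 0" by simp
qed

lemma metric: "Metric_space (car S) (hdist S)"
  by standard (auto simp: hdist_def hnorm_hsub_commute hnorm_hsub_eq_0 hnorm_hsub_triangle)

lemma inn_diff_bound:
  assumes "x \<in> car S" "y \<in> car S" "x' \<in> car S" "y' \<in> car S"
  shows "cmod (inn S x y - inn S x' y') \<le>
    hnorm S (hsub S x x') * hnorm S y + hnorm S x' * hnorm S (hsub S y y')"
proof -
  have "inn S x y - inn S x' y' = inn S (hsub S x x') y + inn S x' (hsub S y y')"
    using assms by simp
  then show ?thesis
    using norm_triangle_ineq[of "inn S (hsub S x x') y" "inn S x' (hsub S y y')"]
      Cauchy_Schwarz[of "hsub S x x'" y] Cauchy_Schwarz[of x' "hsub S y y'"] assms
    by simp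
qed

section \<open>Bounded operators and their norm\<close>

lemma bounded_opsD:
  assumes "T \<in> bounded_ops S"
  shows "x \<in> car S \<Longrightarrow> T x \<in> car S"
    "x \<in> car S \<Longrightarrow> y \<in> car S \<Longrightarrow> T (add S x y) = add S (T x) (T y)"
    "x \<in> car S \<Longrightarrow> T (scl S c x) = scl S c (T x)"
    "T \<in> extensional (car S)" "\<exists>B. \<forall>x\<in>car S. hnorm S (T x) \<le> B * hnorm S x"
  using assms by (auto simp: bounded_ops_def PiE_def)

lemma bounded_ops_hsub:
  "T \<in> bounded_ops S \<Longrightarrow> x \<in> car S \<Longrightarrow> y \<in> car S \<Longrightarrow> T (hsub S x y) = hsub S (T x) (T y)"
  by (simp add: hsub_def bounded_opsD)

lemma bounded_op_bound:
  assumes "T \<in> bounded_ops S"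
  obtains B where "0 \<le> B" "\<And>x. x \<in> car S \<Longrightarrow> hnorm S (T x) \<le> B * hnorm S x"
proof -
  obtain B where B: "\<forall>x\<in>car S. hnorm S (T x) \<le> B * hnorm S x" using bounded_opsD(5)[OF assms] by blast
  show ?thesis
  proof (rule that[of "\<bar>B\<bar>"])
    fix x assume "x \<in> car S"
    then show "hnorm S (T x) \<le> \<bar>B\<bar> * hnorm S x"
      using B mult_right_mono[of B "\<bar>B\<bar>" "hnorm S x"] by fastforce
  qed simp
qed

lemma hnorm_le_op_norm:
  assumes T: "T \<in> bounded_ops S" and x: "x \<in> car S" "hnorm S x \<le> 1"
  shows "hnorm S (T x) \<le> op_norm S T"
proof -
  obtain B where B: "0 \<le> B" "\<And>x. x \<in> car S \<Longrightarrow> hnorm S (T x) \<le> B * hnorm S x"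
    using bounded_op_bound[OF T] by blast
  show ?thesis
    unfolding op_norm_def
  proof (rule cSUP_upper)
    show "bdd_above ((\<lambda>x. hnorm S (T x)) ` {x \<in> car S. hnorm S x \<le> 1})"
    proof (rule bdd_aboveI2)
      fix z assume "z \<in> {x \<in> car S. hnorm S x \<le> 1}"
      then show "hnorm S (T z) \<le> B" using B(2)[of z] mult_left_le[OF _ B(1), of "hnorm S z"] by simp
    qed
  qed (use x in simp)
qed

lemma op_norm_nonneg:
  assumes "T \<in> bounded_ops S" shows "0 \<le> op_norm S T"
proof -
  obtain z where z: "z \<in> car S" using ex_zero by blast
  have "hnorm S (T (scl S 0 z)) \<le> op_norm S T" by (rule hnorm_le_op_norm[OF assms]) (use z in simp_all)
  moreover have "0 \<le> hnorm S (T (scl S 0 z))" using bounded_opsD(1)[OF assms, of "scl S 0 z"] z by simp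
  ultimately show ?thesis by linarith
qed

lemma op_norm_bound:
  assumes T: "T \<in> bounded_ops S" and x: "x \<in> car S"
  shows "hnorm S (T x) \<le> op_norm S T * hnorm S x"
proof (cases "hnorm S x = 0")
  case True
  obtain B where "\<And>x. x \<in> car S \<Longrightarrow> hnorm S (T x) \<le> B * hnorm S x"
    using bounded_op_bound[OF T] by blast
  from this[OF x] show ?thesis using True by simp
next
  case False
  let ?y = "scl S (complex_of_real (1 / hnorm S x)) x"
  have "hnorm S (T ?y) \<le> op_norm S T"
    by (rule hnorm_le_op_norm[OF T]) (use x False in \<open>simp_all add: norm_divide\<close>)
  moreover have "hnorm S (T ?y) = hnorm S (T x) / hnorm S x"
    using x bounded_opsD(1)[OF T x] by (simp add: bounded_opsD(3)[OF T] norm_divide)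
  ultimately have "hnorm S (T x) / hnorm S x \<le> op_norm S T" by (simp only:)
  moreover have "0 < hnorm S x" using False hnorm_nonneg[OF x] by linarith
  ultimately show ?thesis by (simp only: pos_divide_le_eq)
qed

lemma op_norm_le:
  assumes "car S \<noteq> {}" "0 \<le> B" "\<And>x. x \<in> car S \<Longrightarrow> hnorm S (T x) \<le> B * hnorm S x"
  shows "op_norm S T \<le> B"
  unfolding op_norm_def
proof (rule cSUP_least)
  obtain x where "x \<in> car S" using assms(1) by blast
  then have "scl S 0 x \<in> {x \<in> car S. hnorm S x \<le> 1}" by simp
  then show "{x \<in> car S. hnorm S x \<le> 1} \<noteq> {}" by blast
  fix x assume "x \<in> {x \<in> car S. hnorm S x \<le> 1}"
  then show "hnorm S (T x) \<le> B" using assms(3)[of x] mult_left_le[OF _ assms(2), of "hnorm S x"] by simp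
qed

lemma op_sub_bounded:
  assumes "T \<in> bounded_ops S" "T' \<in> bounded_ops S"
  shows "op_sub S T T' \<in> bounded_ops S"
proof -
  obtain B where B: "\<And>x. x \<in> car S \<Longrightarrow> hnorm S (T x) \<le> B * hnorm S x"
    using bounded_op_bound[OF assms(1)] by blast
  obtain B' where B': "\<And>x. x \<in> car S \<Longrightarrow> hnorm S (T' x) \<le> B' * hnorm S x"
    using bounded_op_bound[OF assms(2)] by blast
  note D = bounded_opsD[OF assms(1)] and D' = bounded_opsD[OF assms(2)]
  have "hnorm S (hsub S (T x) (T' x)) \<le> (B + B') * hnorm S x" if "x \<in> car S" for x
    using hnorm_hsub_le[of "T x" "T' x"] B[OF that] B'[OF that] D(1) D'(1) that by (simp add: algebra_simps)
  moreover have "hsub S (T (add S x y)) (T' (add S x y)) = add S (hsub S (T x) (T' x)) (hsub S (T y) (T' y))"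
    if "x \<in> car S" "y \<in> car S" for x y
    by (rule eqI) (use that D(1-2) D'(1-2) in auto)
  moreover have "hsub S (T (scl S c x)) (T' (scl S c x)) = scl S c (hsub S (T x) (T' x))"
    if "x \<in> car S" for c x
    by (rule eqI) (use that D(1,3) D'(1,3) in \<open>auto simp: algebra_simps\<close>)
  ultimately show ?thesis
    using D(1) D'(1) unfolding bounded_ops_def op_sub_def by auto
qed

text \<open>A rank-one update of \<open>T\<close>. Finite-rank operators are built by repeating this
  step a standard number of times, so that internal finite sums never have to be formed.\<close>

definition op_upd :: "('a \<Rightarrow> 'a) \<Rightarrow> 'a \<Rightarrow> 'a \<Rightarrow> 'a \<Rightarrow> 'a" where
  "op_upd T f w = (\<lambda>x\<in>car S. add S (T x) (scl S (inn S x f) w))"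

lemma op_upd_bound:
  assumes "x \<in> car S" "T x \<in> car S" "f \<in> car S" "w \<in> car S" "hnorm S (T x) \<le> B * hnorm S x"
  shows "hnorm S (op_upd T f w x) \<le> (B + hnorm S f * hnorm S w) * hnorm S x"
proof -
  have "cmod (inn S x f) * hnorm S w \<le> (hnorm S x * hnorm S f) * hnorm S w"
    by (rule mult_right_mono[OF Cauchy_Schwarz]) (use assms in auto)
  then show ?thesis
    using hnorm_add[of "T x" "scl S (inn S x f) w"] assms
    by (simp add: op_upd_def algebra_simps)
qed

lemma op_upd_bounded:
  assumes T: "T \<in> bounded_ops S" and f: "f \<in> car S" and w: "w \<in> car S"
  shows "op_upd T f w \<in> bounded_ops S"
proof -
  note D = bounded_opsD[OF T]
  obtain B where B: "\<And>x. x \<in> car S \<Longrightarrow> hnorm S (T x) \<le> B * hnorm S x"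
    using bounded_op_bound[OF T] by blast
  have "add S (T (add S x y)) (scl S (inn S (add S x y) f) w) =
      add S (add S (T x) (scl S (inn S x f) w)) (add S (T y) (scl S (inn S y f) w))"
    if "x \<in> car S" "y \<in> car S" for x y
    by (rule eqI) (use that D(1-2) f w in \<open>auto simp: algebra_simps\<close>)
  moreover have "add S (T (scl S c x)) (scl S (inn S (scl S c x) f) w) =
      scl S c (add S (T x) (scl S (inn S x f) w))" if "x \<in> car S" for c x
    by (rule eqI) (use that D(1,3) f w in \<open>auto simp: algebra_simps\<close>)
  moreover have "\<exists>B. \<forall>x\<in>car S. hnorm S (op_upd T f w x) \<le> B * hnorm S x"
  proof (intro exI ballI)
    fix x assume x: "x \<in> car S"
    show "hnorm S (op_upd T f w x) \<le> (B + hnorm S f * hnorm S w) * hnorm S x"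
      by (rule op_upd_bound[where T = T and x = x, OF x D(1)[OF x] f w B[OF x]])
  qed
  ultimately show ?thesis
    using D(1) f w unfolding bounded_ops_def op_upd_def by auto
qed

lemma zero_op_bounded: "(\<lambda>x\<in>car S. scl S 0 x) \<in> bounded_ops S"
proof -
  have "scl S 0 (add S x y) = add S (scl S 0 x) (scl S 0 y)" if "x \<in> car S" "y \<in> car S" for x y
    by (rule eqI) (use that in auto)
  moreover have "scl S 0 (scl S c x) = scl S c (scl S 0 x)" if "x \<in> car S" for c x
    by (rule eqI) (use that in auto)
  ultimately show ?thesis
    unfolding bounded_ops_def by (auto intro!: exI[of _ 0])
qed

end

section \<open>Internal Hilbert spaces as families of Hilbert spaces\<close>

text \<open>A code determines a space on its carrier only; off the carrier the operations are
  arbitrary, so this is the sense in which two spaces with the same code agree.\<close>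

definition same_ops :: "'a ips \<Rightarrow> 'a ips \<Rightarrow> bool" where
  "same_ops S S' \<longleftrightarrow> car S' = car S \<and>
     (\<forall>x\<in>car S. \<forall>y\<in>car S. add S' x y = add S x y) \<and>
     (\<forall>c. \<forall>x\<in>car S. scl S' c x = scl S c x) \<and>
     (\<forall>x\<in>car S. \<forall>y\<in>car S. inn S' x y = inn S x y)"

locale same_spaces = inner_product_space S for S :: "'a ips" +
  fixes S' :: "'a ips"
  assumes same: "same_ops S S'"
begin

lemma car_same: "car S' = car S"
  and add_same: "x \<in> car S \<Longrightarrow> y \<in> car S \<Longrightarrow> add S' x y = add S x y"
  and scl_same: "x \<in> car S \<Longrightarrow> scl S' c x = scl S c x"
  and inn_same: "x \<in> car S \<Longrightarrow> y \<in> car S \<Longrightarrow> inn S' x y = inn S x y"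
  using same by (simp_all add: same_ops_def)

lemma hsub_same: "x \<in> car S \<Longrightarrow> y \<in> car S \<Longrightarrow> hsub S' x y = hsub S x y"
  by (simp add: hsub_def scl_same add_same)

lemma hnorm_same: "x \<in> car S \<Longrightarrow> hnorm S' x = hnorm S x"
  by (simp add: hnorm_def inn_same)

lemma bounded_ops_same: "bounded_ops S' = bounded_ops S"
proof -
  have "T \<in> bounded_ops S' \<longleftrightarrow> T \<in> bounded_ops S" for T
  proof (cases "T \<in> car S \<rightarrow>\<^sub>E car S")
    case True
    then have "T x \<in> car S" if "x \<in> car S" for x using that by auto
    then show ?thesis
      by (simp add: bounded_ops_def car_same add_same scl_same hnorm_same)
  qed (simp add: bounded_ops_def car_same)
  then show ?thesis by blast
qed

lemma op_norm_same: "T \<in> bounded_ops S \<Longrightarrow> op_norm S' T = op_norm S T"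
proof -
  assume T: "T \<in> bounded_ops S"
  have "{x \<in> car S'. hnorm S' x \<le> 1} = {x \<in> car S. hnorm S x \<le> 1}"
    by (auto simp: car_same hnorm_same)
  moreover have "(\<lambda>x. hnorm S' (T x)) ` {x \<in> car S. hnorm S x \<le> 1} =
      (\<lambda>x. hnorm S (T x)) ` {x \<in> car S. hnorm S x \<le> 1}"
    by (rule image_cong) (auto simp: hnorm_same bounded_opsD(1)[OF T])
  ultimately show ?thesis by (simp only: op_norm_def)
qed

lemma op_sub_same:
  "T \<in> bounded_ops S \<Longrightarrow> T' \<in> bounded_ops S \<Longrightarrow> op_sub S' T T' = op_sub S T T'"
  unfolding op_sub_def car_same by (rule restrict_ext) (simp add: hsub_same bounded_opsD(1))

lemma has_hilbert_dim_same: "has_hilbert_dim S' n \<longleftrightarrow> has_hilbert_dim S n"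
proof -
  have "orthonormal_on S' B \<longleftrightarrow> orthonormal_on S B" for B
    by (auto simp: orthonormal_on_def car_same inn_same subset_iff)
  then show ?thesis by (simp add: has_hilbert_dim_def orthonormal_basis_on_def)
qed

end

context nonstandard_setting
begin

section \<open>Codes of Hilbert spaces and of operators\<close>

lemma level_components:
  assumes "is_tuple (mem U) p us" "p \<in> level U n"
  shows "set us \<subseteq> level U n"
  using assms
proof (induction "mem U" p us rule: is_tuple.induct)
  case (3 p x y zs)
  then obtain q where q: "is_pair (mem U) p x q" "is_tuple (mem U) q (y # zs)" by auto
  obtain s d where sd: "mem U x s" "mem U q d" "mem U s p" "mem U d p"
    using q(1) unfolding is_pair_def by metis
  have "x \<in> level U n" "q \<in> level U n"
    using sd 3(3) level_trans by metis+
  then show ?case using 3(1)[OF q(2)] by simp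
qed auto

declare is_tuple.simps(3) [simp del]

lemma codes_opD:
  "codes_op U S t T \<Longrightarrow> mem U p t \<Longrightarrow> \<exists>x\<in>car S. is_tuple (mem U) p [x, T x]"
  "codes_op U S t T \<Longrightarrow> is_tuple (mem U) p [x, T x] \<Longrightarrow> x \<in> car S \<Longrightarrow> mem U p t"
proof -
  assume "codes_op U S t T"
  note * = this[unfolded codes_op_def, THEN conjunct2, THEN spec, of p]
  show "mem U p t \<Longrightarrow> \<exists>x\<in>car S. is_tuple (mem U) p [x, T x]" by (rule iffD1[OF *])
  show "is_tuple (mem U) p [x, T x] \<Longrightarrow> x \<in> car S \<Longrightarrow> mem U p t" by (rule iffD2[OF *, OF bexI])
qed

lemma ex_tuple_level: "us \<noteq> [] \<Longrightarrow> set us \<subseteq> level U k \<Longrightarrow> length us \<le> 4 \<Longrightarrow> \<exists>p. is_tuple (mem U) p us"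
  by (rule ex_tuple) auto

lemma codes_hilbert_level:
  assumes "codes_hilbert U q S" "q \<in> level U k"
  shows "car S \<subseteq> level U k"
proof
  fix x assume x: "x \<in> car S"
  obtain c a m i where q: "is_tuple (mem U) q [c, a, m, i]" and c: "\<forall>x. mem U x c \<longleftrightarrow> x \<in> car S"
    using assms(1) unfolding codes_hilbert_def by (elim conjE exE)
  have "c \<in> level U k" using level_components[OF q assms(2)] by simp
  then show "x \<in> level U k" using c x level_trans[of x c k] by simp
qed

lemma codes_hilbert_ips: "codes_hilbert U q S \<Longrightarrow> inner_product_space S"
  unfolding codes_hilbert_def hilbert_space_on_def by unfold_locales (elim conjE)

text \<open>For all arguments the tuple of arguments and value exists, belongs to the graph stored
  in the code, and is therefore also such a tuple for the other space; injectivity of tuples gives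
  equal values.\<close>

lemma codes_hilbert_same:
  assumes S: "codes_hilbert U q S" and S': "codes_hilbert U q S'" and q: "q \<in> level U k"
  shows "same_ops S S'"
proof -
  interpret inner_product_space S by (rule codes_hilbert_ips[OF S])
  obtain c a m i where 1: "is_tuple (mem U) q [c, a, m, i]" "\<forall>x. mem U x c \<longleftrightarrow> x \<in> car S"
    "\<forall>t. mem U t a \<longleftrightarrow> (\<exists>x\<in>car S. \<exists>y\<in>car S. is_tuple (mem U) t [x, y, add S x y])"
    "\<forall>t. mem U t m \<longleftrightarrow> (\<exists>\<alpha>. \<exists>x\<in>car S. is_tuple (mem U) t [cpx U \<alpha>, x, scl S \<alpha> x])"
    "\<forall>t. mem U t i \<longleftrightarrow> (\<exists>x\<in>car S. \<exists>y\<in>car S. is_tuple (mem U) t [x, y, cpx U (inn S x y)])"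
    using S unfolding codes_hilbert_def by (elim conjE exE)
  obtain c' a' m' i' where 2: "is_tuple (mem U) q [c', a', m', i']" "\<forall>x. mem U x c' \<longleftrightarrow> x \<in> car S'"
    "\<forall>t. mem U t a' \<longleftrightarrow> (\<exists>x\<in>car S'. \<exists>y\<in>car S'. is_tuple (mem U) t [x, y, add S' x y])"
    "\<forall>t. mem U t m' \<longleftrightarrow> (\<exists>\<alpha>. \<exists>x\<in>car S'. is_tuple (mem U) t [cpx U \<alpha>, x, scl S' \<alpha> x])"
    "\<forall>t. mem U t i' \<longleftrightarrow> (\<exists>x\<in>car S'. \<exists>y\<in>car S'. is_tuple (mem U) t [x, y, cpx U (inn S' x y)])"
    using S' unfolding codes_hilbert_def by (elim conjE exE)
  have eq: "c' = c" "a' = a" "m' = m" "i' = i"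
    using is_tuple_inject[OF 1(1) 2(1)] by simp_all
  have lev: "car S \<subseteq> level U k" by (rule codes_hilbert_level[OF S q])
  have tup: "\<exists>t. is_tuple (mem U) t [u, v, w]" if "u \<in> level U k" "v \<in> level U k" "w \<in> level U k" for u v w
    using that by (intro ex_tuple_level) auto
  have "car S' = car S" using 1(2) 2(2) eq by auto
  moreover have "add S' x y = add S x y" if xy: "x \<in> car S" "y \<in> car S" for x y
  proof -
    obtain t where t: "is_tuple (mem U) t [x, y, add S x y]"
      using tup[of x y "add S x y"] lev xy by auto
    have "mem U t a" by (rule iffD2[OF 1(3)[THEN spec]], rule bexI[OF _ xy(1)], rule bexI[OF _ xy(2)], rule t)
    then have "mem U t a'" by (simp only: eq)
    from iffD1[OF 2(3)[THEN spec] this] obtain x' y' where "is_tuple (mem U) t [x', y', add S' x' y']"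
      by (elim bexE)
    from is_tuple_inject[OF t this] show ?thesis by auto
  qed
  moreover have "scl S' \<alpha> x = scl S \<alpha> x" if x: "x \<in> car S" for \<alpha> x
  proof -
    obtain t where t: "is_tuple (mem U) t [cpx U \<alpha>, x, scl S \<alpha> x]"
      using tup[of "cpx U \<alpha>" x "scl S \<alpha> x"] lev x cpx_level by auto
    have "mem U t m" by (rule iffD2[OF 1(4)[THEN spec]], rule exI, rule bexI[OF _ x], rule t)
    then have "mem U t m'" by (simp only: eq)
    from iffD1[OF 2(4)[THEN spec] this] obtain \<alpha>' x' where "is_tuple (mem U) t [cpx U \<alpha>', x', scl S' \<alpha>' x']"
      by (elim exE bexE)
    from is_tuple_inject[OF t this] show ?thesis using cpx_inj by (auto dest: injD)
  qed
  moreover have "inn S' x y = inn S x y" if xy: "x \<in> car S" "y \<in> car S" for x y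
  proof -
    obtain t where t: "is_tuple (mem U) t [x, y, cpx U (inn S x y)]"
      using tup[of x y "cpx U (inn S x y)"] lev xy cpx_level by auto
    have "mem U t i" by (rule iffD2[OF 1(5)[THEN spec]], rule bexI[OF _ xy(1)], rule bexI[OF _ xy(2)], rule t)
    then have "mem U t i'" by (simp only: eq)
    from iffD1[OF 2(5)[THEN spec] this] obtain x' y' where "is_tuple (mem U) t [x', y', cpx U (inn S' x' y')]"
      by (elim bexE)
    from is_tuple_inject[OF t this] show ?thesis using cpx_inj by (auto dest: injD)
  qed
  ultimately show ?thesis by (simp add: same_ops_def)
qed

definition K :: "'u set" where "K = {q \<in> level U k. \<exists>S. codes_hilbert U q S}"

text \<open>Fixes one space for each code; by \<open>codes_hilbert_same\<close> the choice matters
  only off the carrier.\<close>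

definition sp :: "'u \<Rightarrow> 'u ips" where "sp q = (SOME S. codes_hilbert U q S)"

lemma codes_sp: "q \<in> K \<Longrightarrow> codes_hilbert U q (sp q)"
  unfolding K_def sp_def by (auto intro: someI)

lemma sp_level: "q \<in> K \<Longrightarrow> car (sp q) \<subseteq> level U k"
  using codes_hilbert_level[OF codes_sp] by (simp add: K_def)

lemma level_k_M: "x \<in> level U k \<Longrightarrow> x \<in> M"
  unfolding M_def using level_mono[of k "k + 5"] by auto

lemma cpx_M: "cpx U c \<in> M"
  unfolding M_def by (rule cpx_level)

lemma K_M: "q \<in> K \<Longrightarrow> q \<in> M"
  by (rule level_k_M) (simp add: K_def)

lemma sp_M: "q \<in> K \<Longrightarrow> x \<in> car (sp q) \<Longrightarrow> x \<in> M"
  using sp_level level_k_M by blast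

lemma sp_ips: "q \<in> K \<Longrightarrow> inner_product_space (sp q)"
  by (rule codes_hilbert_ips[OF codes_sp])

lemma same_sp: "q \<in> K \<Longrightarrow> codes_hilbert U q S \<Longrightarrow> same_spaces (sp q) S"
  using codes_hilbert_same[OF codes_sp, of q S] sp_ips[of q]
  by (simp add: same_spaces_def same_spaces_axioms_def K_def)

text \<open>The graph forces agreement on the carrier, and bounded operators are
  extensional.\<close>

lemma codes_op_fun:
  assumes q: "q \<in> K" and T: "codes_op U (sp q) t T" "codes_op U (sp q) t T'"
  shows "T = T'"
proof -
  interpret inner_product_space "sp q" by (rule sp_ips[OF q])
  have b: "T \<in> bounded_ops (sp q)" "T' \<in> bounded_ops (sp q)" using T by (simp_all add: codes_op_def)
  show ?thesis
  proof (rule extensionalityI[OF bounded_opsD(4)[OF b(1)] bounded_opsD(4)[OF b(2)]])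
    fix x assume x: "x \<in> car (sp q)"
    have "x \<in> level U k" "T x \<in> level U k" using sp_level[OF q] x bounded_opsD(1)[OF b(1) x] by auto
    then obtain p where p: "is_tuple (mem U) p [x, T x]"
      using ex_tuple_level[of "[x, T x]"] by auto
    then obtain x' where "is_tuple (mem U) p [x', T' x']"
      using codes_opD(1)[OF T(2) codes_opD(2)[OF T(1) p x]] by (elim bexE)
    from is_tuple_inject[OF p this] show "T x = T' x" by auto
  qed
qed

text \<open>Pairs of vectors lie in \<open>level U (k + 2)\<close>, so the graph lies in
  \<open>level U (k + 3)\<close>, which is contained in \<open>M\<close>.\<close>

lemma ex_op_code:
  assumes q: "q \<in> K" and T: "T \<in> bounded_ops (sp q)"
  shows "\<exists>t\<in>M. codes_op U (sp q) t T"
proof -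
  interpret inner_product_space "sp q" by (rule sp_ips[OF q])
  let ?A = "{p. \<exists>x\<in>car (sp q). is_tuple (mem U) p [x, T x]}"
  have A: "?A \<subseteq> level U (k + 2)"
  proof safe
    fix p x assume x: "x \<in> car (sp q)" and p: "is_tuple (mem U) p [x, T x]"
    have "x \<in> level U k" "T x \<in> level U k" using sp_level[OF q] x bounded_opsD(1)[OF T x] by auto
    then show "p \<in> level U (k + 2)" using level_tuple[OF p, of k] by simp
  qed
  have "set_code ?A \<in> level U (Suc (k + 2))" by (rule set_code_level[OF A]) simp
  then have "set_code ?A \<in> M" unfolding M_def using level_mono[of "Suc (k + 2)" "k + 5"] by auto
  moreover have "codes_op U (sp q) (set_code ?A) T"
    unfolding codes_op_def using T mem_set_code[OF A] by simp
  ultimately show ?thesis by blast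
qed

definition opf :: "'u \<Rightarrow> 'u \<Rightarrow> 'u \<Rightarrow> 'u" where
  "opf q t = (SOME T. codes_op U (sp q) t T)"

lemma codes_opf: "codes_op U (sp q) t T \<Longrightarrow> codes_op U (sp q) t (opf q t)"
  unfolding opf_def by (rule someI[of "\<lambda>T. codes_op U (sp q) t T"])

definition is_op :: "'u \<Rightarrow> 'u \<Rightarrow> bool" where
  "is_op q t \<longleftrightarrow> codes_op U (sp q) t (opf q t)"

lemma is_op_bounded: "is_op q t \<Longrightarrow> opf q t \<in> bounded_ops (sp q)"
  by (simp add: is_op_def codes_op_def)

lemma codes_op_iff: "q \<in> K \<Longrightarrow> codes_op U (sp q) t T \<longleftrightarrow> is_op q t \<and> T = opf q t"
  using codes_op_fun[of q t T "opf q t"] codes_opf[of q t T] by (auto simp: is_op_def)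

lemma codes_op_sp:
  "q \<in> K \<Longrightarrow> codes_hilbert U q S \<Longrightarrow> codes_op U S t T \<longleftrightarrow> codes_op U (sp q) t T"
  using same_spaces.bounded_ops_same[OF same_sp] same_spaces.car_same[OF same_sp]
  by (simp add: codes_op_def)

lemma is_op_M:
  assumes q: "q \<in> K" and t: "is_op q t"
  shows "t \<in> M"
proof -
  interpret inner_product_space "sp q" by (rule sp_ips[OF q])
  have b: "opf q t \<in> bounded_ops (sp q)" by (rule is_op_bounded[OF t])
  have t': "codes_op U (sp q) t (opf q t)" using t by (simp add: is_op_def)
  obtain x where x: "x \<in> car (sp q)" using ex_zero by blast
  have lev: "x \<in> level U k" "opf q t x \<in> level U k" if "x \<in> car (sp q)" for x
    using sp_level[OF q] that bounded_opsD(1)[OF b that] by auto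
  obtain p where p: "is_tuple (mem U) p [x, opf q t x]"
    using ex_tuple_level[of "[x, opf q t x]"] lev[OF x] by auto
  have "t \<in> level U (Suc (k + 2))"
  proof (rule level_SucI)
    show "mem U p t" by (rule codes_opD(2)[OF t' p x])
    fix p' assume "mem U p' t"
    then obtain y where y: "y \<in> car (sp q)" "is_tuple (mem U) p' [y, opf q t y]"
      using codes_opD(1)[OF t' \<open>mem U p' t\<close>] by (elim bexE)
    show "p' \<in> level U (k + 2)" using level_tuple[OF y(2), of k] lev[OF y(1)] by simp
  qed
  then show ?thesis unfolding M_def using level_mono[of "Suc (k + 2)" "k + 5"] by auto
qed

text \<open>The relations that define the internal operations quantify over all spaces with a given
  code. For codes in \<open>K\<close> these spaces agree on the carrier, so \<open>sp q\<close> can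
  stand for all of them; each right-hand side is the standard meaning of an internal notion.\<close>

lemma codes_relations:
  assumes q: "q \<in> K"
  shows
    "[q, u] \<in> {[q, u] | q u. \<exists>S. codes_hilbert U q S \<and> u \<in> car S} \<longleftrightarrow> u \<in> car (sp q)"
    "[q, u, w, z] \<in> {[q, u, w, add S u w] | q u w S. codes_hilbert U q S \<and> u \<in> car S \<and> w \<in> car S} \<longleftrightarrow>
      u \<in> car (sp q) \<and> w \<in> car (sp q) \<and> z = add (sp q) u w"
    "[q, u, w, z] \<in> {[q, u, w, hsub S u w] | q u w S. codes_hilbert U q S \<and> u \<in> car S \<and> w \<in> car S} \<longleftrightarrow>
      u \<in> car (sp q) \<and> w \<in> car (sp q) \<and> z = hsub (sp q) u w"
    "[q, c, u, z] \<in> {[q, cpx U \<alpha>, u, scl S \<alpha> u] | q \<alpha> u S. codes_hilbert U q S \<and> u \<in> car S} \<longleftrightarrow>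
      (\<exists>\<alpha>. c = cpx U \<alpha> \<and> u \<in> car (sp q) \<and> z = scl (sp q) \<alpha> u)"
    "[q, u, w, z] \<in> {[q, u, w, cpx U (inn S u w)] | q u w S. codes_hilbert U q S \<and> u \<in> car S \<and> w \<in> car S} \<longleftrightarrow>
      u \<in> car (sp q) \<and> w \<in> car (sp q) \<and> z = cpx U (inn (sp q) u w)"
    "[q, u, z] \<in> {[q, u, rl U (hnorm S u)] | q u S. codes_hilbert U q S \<and> u \<in> car S} \<longleftrightarrow>
      u \<in> car (sp q) \<and> z = rl U (hnorm (sp q) u)"
    "[q, t] \<in> {[q, t] | q t. \<exists>S T. codes_hilbert U q S \<and> codes_op U S t T} \<longleftrightarrow> is_op q t"
    "[q, t, u, z] \<in> {[q, t, u, T u] | q t u S T. codes_hilbert U q S \<and> codes_op U S t T \<and> u \<in> car S} \<longleftrightarrow>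
      is_op q t \<and> u \<in> car (sp q) \<and> z = opf q t u"
    "[q, t, t', d] \<in> {[q, t, t', d] | q t t' d. \<exists>S T T'. codes_hilbert U q S \<and> codes_op U S t T \<and>
        codes_op U S t' T' \<and> codes_op U S d (op_sub S T T')} \<longleftrightarrow>
      is_op q t \<and> is_op q t' \<and> codes_op U (sp q) d (op_sub (sp q) (opf q t) (opf q t'))"
    "[q, t, z] \<in> {[q, t, rl U (op_norm S T)] | q t S T. codes_hilbert U q S \<and> codes_op U S t T} \<longleftrightarrow>
      is_op q t \<and> z = rl U (op_norm (sp q) (opf q t))"
    "[q, z] \<in> {[q, rl U (real n)] | q n. \<exists>S. codes_hilbert U q S \<and> has_hilbert_dim S n} \<longleftrightarrow>
      (\<exists>n. z = rl U (real n) \<and> has_hilbert_dim (sp q) n)"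
proof -
  note cs = codes_sp[OF q]
  note same = same_sp[OF q]
  note cop = codes_op_sp[OF q]
  have ex: "X \<longleftrightarrow> Q" if "X \<longleftrightarrow> (\<exists>S. codes_hilbert U q S \<and> P S)"
    "\<And>S. codes_hilbert U q S \<Longrightarrow> P S \<longleftrightarrow> Q" for X P Q
    using that cs by blast
  show "[q, u] \<in> {[q, u] | q u. \<exists>S. codes_hilbert U q S \<and> u \<in> car S} \<longleftrightarrow> u \<in> car (sp q)"
  proof (rule ex[where P = "\<lambda>S. u \<in> car S"], blast)
    fix S assume S: "codes_hilbert U q S"
    interpret same_spaces "sp q" S by (rule same[OF S])
    show "(u \<in> car S) \<longleftrightarrow> u \<in> car (sp q)"
      by (simp add: car_same)
  qed
  show "[q, u, w, z] \<in> {[q, u, w, add S u w] | q u w S. codes_hilbert U q S \<and> u \<in> car S \<and> w \<in> car S} \<longleftrightarrow> u \<in> car (sp q) \<and> w \<in> car (sp q) \<and> z = add (sp q) u w"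
  proof (rule ex[where P = "\<lambda>S. u \<in> car S \<and> w \<in> car S \<and> z = add S u w"], blast)
    fix S assume S: "codes_hilbert U q S"
    interpret same_spaces "sp q" S by (rule same[OF S])
    show "(u \<in> car S \<and> w \<in> car S \<and> z = add S u w) \<longleftrightarrow> u \<in> car (sp q) \<and> w \<in> car (sp q) \<and> z = add (sp q) u w"
      by (auto simp: car_same add_same)
  qed
  show "[q, u, w, z] \<in> {[q, u, w, hsub S u w] | q u w S. codes_hilbert U q S \<and> u \<in> car S \<and> w \<in> car S} \<longleftrightarrow> u \<in> car (sp q) \<and> w \<in> car (sp q) \<and> z = hsub (sp q) u w"
  proof (rule ex[where P = "\<lambda>S. u \<in> car S \<and> w \<in> car S \<and> z = hsub S u w"], blast)
    fix S assume S: "codes_hilbert U q S"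
    interpret same_spaces "sp q" S by (rule same[OF S])
    show "(u \<in> car S \<and> w \<in> car S \<and> z = hsub S u w) \<longleftrightarrow> u \<in> car (sp q) \<and> w \<in> car (sp q) \<and> z = hsub (sp q) u w"
      by (auto simp: car_same hsub_same)
  qed
  show "[q, c, u, z] \<in> {[q, cpx U \<alpha>, u, scl S \<alpha> u] | q \<alpha> u S. codes_hilbert U q S \<and> u \<in> car S} \<longleftrightarrow> (\<exists>\<alpha>. c = cpx U \<alpha> \<and> u \<in> car (sp q) \<and> z = scl (sp q) \<alpha> u)"
  proof (rule ex[where P = "\<lambda>S. \<exists>\<alpha>. c = cpx U \<alpha> \<and> u \<in> car S \<and> z = scl S \<alpha> u"], blast)
    fix S assume S: "codes_hilbert U q S"
    interpret same_spaces "sp q" S by (rule same[OF S])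
    show "(\<exists>\<alpha>. c = cpx U \<alpha> \<and> u \<in> car S \<and> z = scl S \<alpha> u) \<longleftrightarrow> (\<exists>\<alpha>. c = cpx U \<alpha> \<and> u \<in> car (sp q) \<and> z = scl (sp q) \<alpha> u)"
      by (auto simp: car_same scl_same)
  qed
  show "[q, u, w, z] \<in> {[q, u, w, cpx U (inn S u w)] | q u w S. codes_hilbert U q S \<and> u \<in> car S \<and> w \<in> car S} \<longleftrightarrow> u \<in> car (sp q) \<and> w \<in> car (sp q) \<and> z = cpx U (inn (sp q) u w)"
  proof (rule ex[where P = "\<lambda>S. u \<in> car S \<and> w \<in> car S \<and> z = cpx U (inn S u w)"], blast)
    fix S assume S: "codes_hilbert U q S"
    interpret same_spaces "sp q" S by (rule same[OF S])
    show "(u \<in> car S \<and> w \<in> car S \<and> z = cpx U (inn S u w)) \<longleftrightarrow> u \<in> car (sp q) \<and> w \<in> car (sp q) \<and> z = cpx U (inn (sp q) u w)"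
      by (auto simp: car_same inn_same)
  qed
  show "[q, u, z] \<in> {[q, u, rl U (hnorm S u)] | q u S. codes_hilbert U q S \<and> u \<in> car S} \<longleftrightarrow> u \<in> car (sp q) \<and> z = rl U (hnorm (sp q) u)"
  proof (rule ex[where P = "\<lambda>S. u \<in> car S \<and> z = rl U (hnorm S u)"], blast)
    fix S assume S: "codes_hilbert U q S"
    interpret same_spaces "sp q" S by (rule same[OF S])
    show "(u \<in> car S \<and> z = rl U (hnorm S u)) \<longleftrightarrow> u \<in> car (sp q) \<and> z = rl U (hnorm (sp q) u)"
      by (auto simp: car_same hnorm_same)
  qed
  show "[q, t] \<in> {[q, t] | q t. \<exists>S T. codes_hilbert U q S \<and> codes_op U S t T} \<longleftrightarrow> is_op q t"
  proof (rule ex[where P = "\<lambda>S. \<exists>T. codes_op U S t T"], blast)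
    fix S assume S: "codes_hilbert U q S"
    interpret same_spaces "sp q" S by (rule same[OF S])
    show "(\<exists>T. codes_op U S t T) \<longleftrightarrow> is_op q t"
      unfolding cop[OF S] codes_op_iff[OF q] car_same by blast
  qed
  show "[q, t, u, z] \<in> {[q, t, u, T u] | q t u S T. codes_hilbert U q S \<and> codes_op U S t T \<and> u \<in> car S} \<longleftrightarrow> is_op q t \<and> u \<in> car (sp q) \<and> z = opf q t u"
  proof (rule ex[where P = "\<lambda>S. \<exists>T. codes_op U S t T \<and> u \<in> car S \<and> z = T u"], blast)
    fix S assume S: "codes_hilbert U q S"
    interpret same_spaces "sp q" S by (rule same[OF S])
    show "(\<exists>T. codes_op U S t T \<and> u \<in> car S \<and> z = T u) \<longleftrightarrow> is_op q t \<and> u \<in> car (sp q) \<and> z = opf q t u"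
      unfolding cop[OF S] codes_op_iff[OF q] car_same by blast
  qed
  show "[q, t, z] \<in> {[q, t, rl U (op_norm S T)] | q t S T. codes_hilbert U q S \<and> codes_op U S t T} \<longleftrightarrow> is_op q t \<and> z = rl U (op_norm (sp q) (opf q t))"
  proof (rule ex[where P = "\<lambda>S. \<exists>T. codes_op U S t T \<and> z = rl U (op_norm S T)"], blast)
    fix S assume S: "codes_hilbert U q S"
    interpret same_spaces "sp q" S by (rule same[OF S])
    show "(\<exists>T. codes_op U S t T \<and> z = rl U (op_norm S T)) \<longleftrightarrow> is_op q t \<and> z = rl U (op_norm (sp q) (opf q t))"
      unfolding cop[OF S] codes_op_iff[OF q] using op_norm_same[OF is_op_bounded] by auto
  qed
  show "[q, z] \<in> {[q, rl U (real n)] | q n. \<exists>S. codes_hilbert U q S \<and> has_hilbert_dim S n} \<longleftrightarrow> (\<exists>n. z = rl U (real n) \<and> has_hilbert_dim (sp q) n)"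
  proof (rule ex[where P = "\<lambda>S. \<exists>n. z = rl U (real n) \<and> has_hilbert_dim S n"], blast)
    fix S assume S: "codes_hilbert U q S"
    interpret same_spaces "sp q" S by (rule same[OF S])
    show "(\<exists>n. z = rl U (real n) \<and> has_hilbert_dim S n) \<longleftrightarrow> (\<exists>n. z = rl U (real n) \<and> has_hilbert_dim (sp q) n)"
      by (simp add: has_hilbert_dim_same)
  qed
  have "(\<exists>S T T'. codes_hilbert U q S \<and> codes_op U S t T \<and>
        codes_op U S t' T' \<and> codes_op U S d (op_sub S T T')) \<longleftrightarrow>
      is_op q t \<and> is_op q t' \<and> codes_op U (sp q) d (op_sub (sp q) (opf q t) (opf q t'))"
    (is "?L \<longleftrightarrow> ?R")
  proof
    assume ?L
    then obtain S T T' where *: "codes_hilbert U q S" "codes_op U S t T" "codes_op U S t' T'"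
      "codes_op U S d (op_sub S T T')" by (elim exE conjE)
    have T: "is_op q t" "T = opf q t" "is_op q t'" "T' = opf q t'"
      using *(2,3) unfolding cop[OF *(1)] codes_op_iff[OF q] by simp_all
    moreover have "op_sub S T T' = op_sub (sp q) T T'"
      using same_spaces.op_sub_same[OF same[OF *(1)] is_op_bounded[OF T(1)] is_op_bounded[OF T(3)]] T(2,4) by simp
    ultimately show ?R using *(4) unfolding cop[OF *(1)] by simp
  next
    assume ?R
    then show ?L using cs by (intro exI[of _ "sp q"] exI[of _ "opf q t"] exI[of _ "opf q t'"]) (auto simp: is_op_def)
  qed
  then show "[q, t, t', d] \<in> {[q, t, t', d] | q t t' d. \<exists>S T T'. codes_hilbert U q S \<and> codes_op U S t T \<and>
        codes_op U S t' T' \<and> codes_op U S d (op_sub S T T')} \<longleftrightarrow>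
      is_op q t \<and> is_op q t' \<and> codes_op U (sp q) d (op_sub (sp q) (opf q t) (opf q t'))"
    by simp
qed

end

context nonstandard_setting
begin

text \<open>The member of \<open>a\<close> rules out atoms, to which extensionality does not
  apply.\<close>

lemma set_eqI:
  assumes "mem U x a" "\<And>z. mem U z a \<longleftrightarrow> mem U z b"
  shows "a = b"
proof -
  note * = universe[unfolded nonstandard_universe_def, THEN conjunct1, unfolded superstructure_def,
      THEN conjunct2, THEN conjunct1]
  have "a \<notin> atoms U" "b \<notin> atoms U" using no_mem_atom assms by metis+
  then show ?thesis using * assms(2) by metis
qed

definition op_code :: "'u \<Rightarrow> ('u \<Rightarrow> 'u) \<Rightarrow> 'u" where
  "op_code q T = (SOME t. codes_op U (sp q) t T)"

text \<open>The carrier contains a vector, so a graph has a member and extensionality makes the code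
  of an operator unique. This turns the relation behind \<open>iopsub\<close> into the graph of a
  function.\<close>

lemma op_code_iff:
  assumes q: "q \<in> K" and T: "T \<in> bounded_ops (sp q)"
  shows "codes_op U (sp q) t T \<longleftrightarrow> t = op_code q T"
proof -
  interpret inner_product_space "sp q" by (rule sp_ips[OF q])
  have c: "codes_op U (sp q) (op_code q T) T"
    unfolding op_code_def using ex_op_code[OF q T] by (auto intro: someI)
  have "t = op_code q T" if t: "codes_op U (sp q) t T"
  proof -
    obtain x where x: "x \<in> car (sp q)" using ex_zero by blast
    have "x \<in> level U k" "T x \<in> level U k" using sp_level[OF q] x bounded_opsD(1)[OF T x] by auto
    then obtain p where p: "is_tuple (mem U) p [x, T x]"
      using ex_tuple_level[of "[x, T x]"] by auto
    have mt: "mem U z t \<longleftrightarrow> (\<exists>x\<in>car (sp q). is_tuple (mem U) z [x, T x])"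
      if "codes_op U (sp q) t T" for z t
      using codes_opD[OF that, of z] by (intro iffI) (assumption | elim bexE)+
    show ?thesis
    proof (rule set_eqI)
      show "mem U p t" by (rule codes_opD(2)[OF t p x])
      show "mem U z t \<longleftrightarrow> mem U z (op_code q T)" for z
        unfolding mt[OF t] mt[OF c] ..
    qed
  qed
  then show ?thesis using c by auto
qed

lemma is_op_op_code: "q \<in> K \<Longrightarrow> T \<in> bounded_ops (sp q) \<Longrightarrow> is_op q (op_code q T)"
  and opf_op_code: "q \<in> K \<Longrightarrow> T \<in> bounded_ops (sp q) \<Longrightarrow> opf q (op_code q T) = T"
  using op_code_iff[of q T "op_code q T"] codes_op_iff[of q "op_code q T" T] by simp_all

text \<open>The relations behind the internal operations are classes, with spaces of all levels in
  the first coordinate, and \<open>rel_code\<close> does not apply to them directly. As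
  \<open>H\<close> belongs to the extension of \<open>K\<close>, they can be cut down to the tuples
  with first coordinate in \<open>K\<close>.\<close>

lemma star_rel_restrict:
  assumes len: "\<And>us. us \<in> R \<Longrightarrow> length us = n" "2 \<le> n" "n \<le> 6"
    and sub: "\<And>us. us \<in> R \<Longrightarrow> hd us \<in> K \<Longrightarrow> set us \<subseteq> M"
    and H: "star_rel U {[q] | q. q \<in> K} [H]" and vs: "length vs = n - 1"
  shows "star_rel U R (H # vs) \<longleftrightarrow> star_rel U {us \<in> R. hd us \<in> K} (H # vs)"
proof
  assume "star_rel U {us \<in> R. hd us \<in> K} (H # vs)"
  then obtain a p where a: "\<forall>q. mem U q a \<longrightarrow> (\<exists>us\<in>{us \<in> R. hd us \<in> K}. is_tuple (mem U) q us)"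
    "smem U p (star U a)" "is_tuple (smem U) p (H # vs)"
    unfolding star_rel_def by (elim exE conjE)
  show "star_rel U R (H # vs)"
    unfolding star_rel_def
  proof (intro exI conjI allI impI)
    fix q assume "mem U q a"
    from a(1)[THEN spec, THEN mp, OF this] obtain us where "us \<in> R" "is_tuple (mem U) q us"
      by (elim bexE CollectE conjE)
    then show "\<exists>us\<in>R. is_tuple (mem U) q us" by (rule bexI[rotated])
  qed (rule a(2,3))+
next
  assume "star_rel U R (H # vs)"
  then obtain a p where a: "\<forall>q. mem U q a \<longrightarrow> (\<exists>us\<in>R. is_tuple (mem U) q us)"
    and p: "smem U p (star U a)" "is_tuple (smem U) p (H # vs)"
    unfolding star_rel_def by (elim exE conjE)
  let ?R = "{us \<in> R. hd us \<in> K}"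
  have R: "?R \<subseteq> tuples n" "arity n" using len sub by (auto simp: tuples_def arity_def)
  let ?K = "{[q] | q. q \<in> K}"
  have K: "?K \<subseteq> tuples 1" "arity 1" using K_M by (auto simp: tuples_def arity_def)
  have memK: "mem U q (rel_code ?K) \<longleftrightarrow> q \<in> K" for q
    unfolding mem_rel_code[OF K, of q] by auto
  have HK: "smem U H (star U (rel_code ?K))" using H unfolding star_rel_code[OF K] by simp
  \<comment> \<open>The first coordinate is recognised by a bounded condition: it is the only
    element of some member of the pair. The formula says that a tuple from \<open>a\<close> with
    first coordinate in \<open>K\<close> belongs to the restricted relation.\<close>
  let ?\<phi> = "BAll 3 0 (BAll 4 3 (BAll 5 4 (Imp (Conj (BAll 6 4 (Equ 6 5)) (Mem 5 1)) (Mem 3 2))))"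
  let ?e = "(\<lambda>_ :: nat. a)(1 := rel_code ?K, 2 := rel_code ?R)"
  have e: "?e 0 = a" "?e 1 = rel_code ?K" "?e 2 = rel_code ?R" by simp_all
  have sat_\<phi>: "sat E ?\<phi> e \<longleftrightarrow> (\<forall>p. E p (e 0) \<longrightarrow> (\<forall>s. E s p \<longrightarrow> (\<forall>q. E q s \<longrightarrow>
      (\<forall>z. E z s \<longrightarrow> z = q) \<longrightarrow> E q (e 1) \<longrightarrow> E p (e 2))))"
    for E :: "'z \<Rightarrow> 'z \<Rightarrow> bool" and e
    by (simp only: sat.simps fun_upd_same fun_upd_other not_ex not_not de_Morgan_conj
        num.distinct num.inject numeral_eq_iff zero_neq_numeral one_eq_numeral_iff semiring_norm
        not_False_eq_True) blast
  have "mem U p (rel_code ?R)"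
    if pa: "mem U p a" and s: "mem U s p" "\<forall>z. mem U z s \<longrightarrow> z = q" and q: "q \<in> K" for p s q
  proof -
    from a[THEN spec, THEN mp, OF pa] obtain us where us: "us \<in> R" "is_tuple (mem U) p us" by (elim bexE)
    then obtain x y zs where xyz: "us = x # y # zs"
      using len(1)[OF us(1)] len(2) by (cases us; cases "tl us") simp_all
    have "is_tuple (mem U) p (x # y # zs)" using us(2) by (simp only: xyz)
    then obtain r where "is_pair (mem U) p x r" unfolding is_tuple.simps(3) by (elim exE conjE)
    then obtain s0 d0 where sd: "\<forall>z. mem U z s0 \<longleftrightarrow> z = x" "\<forall>z. mem U z d0 \<longleftrightarrow> z = x \<or> z = r"
        "\<forall>z. mem U z p \<longleftrightarrow> z = s0 \<or> z = d0"
      unfolding is_pair_def by (elim exE conjE)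
    have "s = s0 \<or> s = d0" using sd(3) s(1) by simp
    then have "mem U x s" using sd(1,2) by (elim disjE) simp_all
    then have "x = q" using s(2) by simp
    then have "us \<in> ?R" using us(1) xyz q by simp
    then show ?thesis by (intro iffD2[OF mem_rel_code[OF R]], intro bexI[of _ us] us(2))
  qed
  then have "\<forall>p. mem U p a \<longrightarrow> (\<forall>s. mem U s p \<longrightarrow> (\<forall>q. mem U q s \<longrightarrow>
      (\<forall>z. mem U z s \<longrightarrow> z = q) \<longrightarrow> q \<in> K \<longrightarrow> mem U p (rel_code ?R)))"
    by (intro allI impI)
  then have "sat (mem U) ?\<phi> ?e"
    unfolding sat_\<phi> e memK .
  then have *: "sat (smem U) ?\<phi> (star U \<circ> ?e)" by (simp only: transfer)
  note * = *[unfolded sat_\<phi> comp_apply e, rule_format]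
  obtain v ws where v: "vs = v # ws" using vs len(2) by (cases vs) auto
  have "is_tuple (smem U) p (H # v # ws)" using p(2) by (simp only: v)
  then obtain r where "is_pair (smem U) p H r" unfolding is_tuple.simps(3) by (elim exE conjE)
  then obtain s d where s: "\<forall>z. smem U z s \<longleftrightarrow> z = H" "\<forall>z. smem U z p \<longleftrightarrow> z = s \<or> z = d"
    unfolding is_pair_def by (elim exE conjE)
  have "smem U p (star U (rel_code ?R))"
    by (rule *[OF p(1) _ _ _ HK, of s]) (simp_all only: s simp_thms)
  then show "star_rel U ?R (H # vs)"
    by (intro iffD2[OF star_rel_code[OF R]] exI[of _ p] conjI p(2))
qed

section \<open>Nonstandard numbers as random numbers\<close>

lemma cpx_eq_iff [simp]: "cpx U a = cpx U b \<longleftrightarrow> a = b"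
  using cpx_inj by (auto dest: injD)

lemma hminus_spec:
  assumes "v \<in> D" "w \<in> D" "\<forall>\<^sub>F g in FF. g v = cpx U (a g)" "\<forall>\<^sub>F g in FF. g w = cpx U (b g)"
  shows "hminus U v w \<in> D" "\<forall>\<^sub>F g in FF. g (hminus U v w) = cpx U (a g - b g)"
proof -
  let ?R = "{[cpx U c, cpx U d, cpx U (c - d)] | c d. True}"
  have R: "?R \<subseteq> tuples 3" "arity 3" using cpx_M by (auto simp: tuples_def arity_def)
  have "star_fun U ?R [v, w] \<in> D \<and> (\<forall>\<^sub>F g in FF. map g [v, w] @ [g (star_fun U ?R [v, w])] \<in> ?R)"
  proof (rule star_fun_spec)
    show "star_rel U ?R ([v, w] @ [z]) \<longleftrightarrow> z \<in> D \<and> (\<forall>\<^sub>F g in FF. map g ([v, w] @ [z]) \<in> ?R)" for z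
      using star_rel_D_iff[OF R, of "[v, w, z]"] assms by simp
    show "\<forall>\<^sub>F g in FF. \<exists>z\<in>M. map g [v, w] @ [z] \<in> ?R"
      using assms(3,4) by eventually_elim (auto intro: cpx_M)
  qed (use assms in \<open>auto simp: arity_def intro!: always_eventually\<close>)
  then have d: "hminus U v w \<in> D" and e: "\<forall>\<^sub>F g in FF. map g [v, w] @ [g (hminus U v w)] \<in> ?R"
    unfolding hminus_def by simp_all
  show "hminus U v w \<in> D" by (rule d)
  show "\<forall>\<^sub>F g in FF. g (hminus U v w) = cpx U (a g - b g)"
    using e assms(3,4) by eventually_elim auto
qed

lemma habs_spec:
  assumes "v \<in> D" "\<forall>\<^sub>F g in FF. g v = cpx U (a g)"
  shows "habs U v \<in> D" "\<forall>\<^sub>F g in FF. g (habs U v) = rl U (cmod (a g))"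
proof -
  let ?R = "{[cpx U c, rl U (cmod c)] | c. True}"
  have R: "?R \<subseteq> tuples 2" "arity 2" using cpx_M by (auto simp: tuples_def arity_def)
  have "star_fun U ?R [v] \<in> D \<and> (\<forall>\<^sub>F g in FF. map g [v] @ [g (star_fun U ?R [v])] \<in> ?R)"
  proof (rule star_fun_spec)
    show "star_rel U ?R ([v] @ [z]) \<longleftrightarrow> z \<in> D \<and> (\<forall>\<^sub>F g in FF. map g ([v] @ [z]) \<in> ?R)" for z
      using star_rel_D_iff[OF R, of "[v, z]"] assms by simp
    show "\<forall>\<^sub>F g in FF. \<exists>z\<in>M. map g [v] @ [z] \<in> ?R"
      using assms(2) by eventually_elim (auto intro: cpx_M)
  qed (use assms in \<open>auto simp: arity_def intro!: always_eventually\<close>)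
  then have d: "habs U v \<in> D" and e: "\<forall>\<^sub>F g in FF. map g [v] @ [g (habs U v)] \<in> ?R"
    unfolding habs_def by simp_all
  show "habs U v \<in> D" by (rule d)
  show "\<forall>\<^sub>F g in FF. g (habs U v) = rl U (cmod (a g))"
    using e assms(2) by eventually_elim auto
qed

lemma hless_iff:
  assumes "v \<in> D" "w \<in> D" "\<forall>\<^sub>F g in FF. g v = rl U (a g)" "\<forall>\<^sub>F g in FF. g w = rl U (b g)"
  shows "hless U v w \<longleftrightarrow> (\<forall>\<^sub>F g in FF. a g < b g)"
proof -
  let ?R = "{[rl U a, rl U b] | a b. a < b}"
  have R: "?R \<subseteq> tuples 2" "arity 2" using cpx_M by (auto simp: tuples_def arity_def)
  have "hless U v w \<longleftrightarrow> (\<forall>\<^sub>F g in FF. map g [v, w] \<in> ?R)"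
    unfolding hless_def using star_rel_D_iff[OF R, of "[v, w]"] assms by simp
  also have "\<dots> \<longleftrightarrow> (\<forall>\<^sub>F g in FF. a g < b g)"
    by (rule eventually_subst) (use assms(3,4) in \<open>eventually_elim, auto\<close>)
  finally show ?thesis .
qed

lemma star_cpx_D [simp]: "star U (cpx U c) \<in> D"
  and eventually_star_cpx: "\<forall>\<^sub>F g in FF. g (star U (cpx U c)) = cpx U c"
  by (rule star_D[OF cpx_M]) (rule eventually_star[OF cpx_M])

text \<open>Being within \<open>1 / n\<close> of \<open>c\<close> for every standard
  \<open>n\<close> is convergence along \<open>FF\<close>, by the Archimedean property.\<close>

lemma happrox_iff:
  assumes "v \<in> D" "\<forall>\<^sub>F g in FF. g v = cpx U (f g)"
  shows "happrox U v (star U (cpx U c)) \<longleftrightarrow> (f \<longlongrightarrow> c) FF"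
proof -
  note m = hminus_spec[OF assms(1) star_cpx_D assms(2) eventually_star_cpx, of c]
  note a = habs_spec[OF m]
  have "happrox U v (star U (cpx U c)) \<longleftrightarrow> (\<forall>n::nat. 1 \<le> n \<longrightarrow> (\<forall>\<^sub>F g in FF. dist (f g) c < 1 / real n))"
    unfolding happrox_def hless_iff[OF a(1) star_cpx_D a(2) eventually_star_cpx] by (simp add: dist_norm)
  also have "\<dots> \<longleftrightarrow> (f \<longlongrightarrow> c) FF"
  proof
    assume *: "\<forall>n::nat. 1 \<le> n \<longrightarrow> (\<forall>\<^sub>F g in FF. dist (f g) c < 1 / real n)"
    show "(f \<longlongrightarrow> c) FF"
    proof (rule tendstoI)
      fix e :: real assume "0 < e"
      then obtain n where n: "inverse (real (Suc n)) < e" using reals_Archimedean by blast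
      have "\<forall>\<^sub>F g in FF. dist (f g) c < 1 / real (Suc n)" using *[rule_format, of "Suc n"] by simp
      then show "\<forall>\<^sub>F g in FF. dist (f g) c < e"
        by (rule eventually_mono) (use n in \<open>simp add: inverse_eq_divide\<close>)
    qed
  qed (auto intro: tendstoD)
  finally show ?thesis .
qed

lemma hfinite_iff:
  assumes "v \<in> D" "\<forall>\<^sub>F g in FF. g v = cpx U (f g)"
  shows "hfinite U v \<longleftrightarrow> (\<exists>B. \<forall>\<^sub>F g in FF. cmod (f g) \<le> B)"
proof -
  note a = habs_spec[OF assms]
  have "hfinite U v \<longleftrightarrow> (\<exists>n::nat. \<forall>\<^sub>F g in FF. cmod (f g) < real n)"
    unfolding hfinite_def hless_iff[OF a(1) star_cpx_D a(2) eventually_star_cpx] ..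
  also have "\<dots> \<longleftrightarrow> (\<exists>B. \<forall>\<^sub>F g in FF. cmod (f g) \<le> B)"
  proof
    assume "\<exists>B. \<forall>\<^sub>F g in FF. cmod (f g) \<le> B"
    then obtain B where B: "\<forall>\<^sub>F g in FF. cmod (f g) \<le> B" ..
    obtain n where n: "B < real n" using reals_Archimedean2 by blast
    show "\<exists>n::nat. \<forall>\<^sub>F g in FF. cmod (f g) < real n"
      by (rule exI[of _ n], rule eventually_mono[OF B]) (use n in simp)
  qed (auto intro: exI eventually_mono less_imp_le)
  finally show ?thesis .
qed

lemma standard_part_eq:
  assumes "v \<in> D" "\<forall>\<^sub>F g in FF. g v = cpx U (f g)" "(f \<longlongrightarrow> c) FF"
  shows "standard_part U v = c"
  unfolding standard_part_def happrox_iff[OF assms(1,2)]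
  by (rule the_equality) (use assms(3) tendsto_unique[OF FF_nonbot] in auto)

text \<open>Compactness: if no \<open>c\<close> were a limit, each \<open>c\<close> would have a
  ball avoided by almost all values, and finitely many of these balls would cover the closed ball of
  radius \<open>B\<close>.\<close>

lemma ex_limit:
  assumes v: "v \<in> D" "\<forall>\<^sub>F g in FF. g v = cpx U (f g)" and B: "\<forall>\<^sub>F g in FF. cmod (f g) \<le> B"
  shows "\<exists>c. (f \<longlongrightarrow> c) FF"
proof (rule ccontr)
  assume no: "\<nexists>c. (f \<longlongrightarrow> c) FF"
  have "\<exists>r>0. \<forall>\<^sub>F g in FF. \<not> dist (f g) c < r" for c
  proof -
    obtain r where r: "r > 0" "\<not> (\<forall>\<^sub>F g in FF. dist (f g) c < r)"
      using no tendstoI by blast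
    \<comment> \<open>\<open>ultra\<close> decides properties of the value of \<open>g\<close> at
      \<open>v\<close>, so the condition on \<open>f g\<close> is phrased through the embedding of
      the complex numbers.\<close>
    let ?P = "\<lambda>us. \<exists>z. us ! 0 = cpx U z \<and> dist z c < r"
    have iff: "\<forall>\<^sub>F g in FF. ?P (map g [v]) = (dist (f g) c < r)"
      using v(2) by eventually_elim auto
    have "(\<forall>\<^sub>F g in FF. ?P (map g [v])) \<or> (\<forall>\<^sub>F g in FF. \<not> ?P (map g [v]))"
      by (rule ultra) (use v(1) in \<open>auto simp: arity_def\<close>)
    then have "\<forall>\<^sub>F g in FF. \<not> dist (f g) c < r"
    proof
      assume "\<forall>\<^sub>F g in FF. ?P (map g [v])"
      with iff have "\<forall>\<^sub>F g in FF. dist (f g) c < r" by eventually_elim simp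
      with r(2) show ?thesis by simp
    next
      assume "\<forall>\<^sub>F g in FF. \<not> ?P (map g [v])"
      with iff show ?thesis by eventually_elim simp
    qed
    with r(1) show ?thesis by blast
  qed
  then obtain r where r: "\<And>c. r c > 0" "\<And>c. \<forall>\<^sub>F g in FF. \<not> dist (f g) c < r c" by metis
  have "cball 0 B \<subseteq> (\<Union>c\<in>cball 0 B. ball c (r c))" using r(1) by auto
  then obtain C where C: "C \<subseteq> cball 0 B" "finite C" "cball 0 B \<subseteq> (\<Union>c\<in>C. ball c (r c))"
    using compactE_image[OF compact_cball, of "cball 0 B" "\<lambda>c. ball c (r c)" 0 B] by auto
  have "\<forall>\<^sub>F g in FF. \<forall>c\<in>C. \<not> dist (f g) c < r c"
    using r(2) by (intro eventually_ball_finite[OF C(2)]) auto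
  with B have "\<forall>\<^sub>F g in FF. False"
  proof eventually_elim
    case (elim g)
    then have "f g \<in> cball 0 B" by simp
    then obtain c where "c \<in> C" "f g \<in> ball c (r c)" using C(3) by blast
    then show False using elim(2) by (simp add: dist_commute)
  qed
  then show False using FF_nonbot by simp
qed

end

section \<open>The operations of an internal Hilbert space\<close>

locale internal_hilbert = nonstandard_setting U \<kappa> h k
  for U :: "('u, 'v) universe" and \<kappa> :: "'k rel" and h k +
  fixes H :: 'v
  assumes internal_H: "internal_hilbert_space U k H"
begin

lemma star_rel_K: "star_rel U {[q] | q. q \<in> K} [H]"
proof -
  have "{[q] | q. q \<in> K} = {[q] | q. q \<in> level U k \<and> (\<exists>S. codes_hilbert U q S)}"
    by (auto simp: K_def)
  then show ?thesis using internal_H by (simp only: internal_hilbert_space_def)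
qed

lemma H_D: "H \<in> D" and eventually_K: "\<forall>\<^sub>F g in FF. g H \<in> K"
proof -
  have "{[q] | q. q \<in> K} \<subseteq> tuples 1" "arity 1" using K_M by (auto simp: tuples_def arity_def)
  from star_rel_D_iff[OF this, of "[H]"] star_rel_K
  have "H \<in> D" "\<forall>\<^sub>F g in FF. map g [H] \<in> {[q] | q. q \<in> K}" by simp_all
  then show "H \<in> D" "\<forall>\<^sub>F g in FF. g H \<in> K" by simp_all
qed

lemma star_rel_H:
  assumes len: "\<And>us. us \<in> R \<Longrightarrow> length us = n" "2 \<le> n" "n \<le> 6"
    and sub: "\<And>us. us \<in> R \<Longrightarrow> hd us \<in> K \<Longrightarrow> set us \<subseteq> M" and vs: "length vs = n - 1"
  shows "star_rel U R (H # vs) \<longleftrightarrow> set vs \<subseteq> D \<and> (\<forall>\<^sub>F g in FF. g H # map g vs \<in> R)"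
proof -
  let ?R = "{us \<in> R. hd us \<in> K}"
  have R: "?R \<subseteq> tuples n" "arity n" using len sub by (auto simp: tuples_def arity_def)
  have "star_rel U R (H # vs) \<longleftrightarrow> star_rel U ?R (H # vs)"
    by (rule star_rel_restrict[OF len sub star_rel_K vs]) auto
  also have "\<dots> \<longleftrightarrow> set (H # vs) \<subseteq> D \<and> (\<forall>\<^sub>F g in FF. map g (H # vs) \<in> ?R)"
    by (rule star_rel_D_iff[OF R]) (use vs len in simp)
  also have "\<dots> \<longleftrightarrow> set vs \<subseteq> D \<and> (\<forall>\<^sub>F g in FF. g H # map g vs \<in> R)"
    using H_D eventually_K by (auto simp: eventually_conj_iff)
  finally show ?thesis .
qed

lemma star_rel_H1:
  assumes len: "\<And>us. us \<in> R \<Longrightarrow> length us = 2"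
    and R: "\<And>q u. q \<in> K \<Longrightarrow> [q, u] \<in> R \<longleftrightarrow> P q u" and P: "\<And>q u. q \<in> K \<Longrightarrow> P q u \<Longrightarrow> u \<in> M"
  shows "star_rel U R [H, x] \<longleftrightarrow> x \<in> D \<and> (\<forall>\<^sub>F g in FF. P (g H) (g x))"
proof -
  have "star_rel U R (H # [x]) \<longleftrightarrow> set [x] \<subseteq> D \<and> (\<forall>\<^sub>F g in FF. g H # map g [x] \<in> R)"
  proof (rule star_rel_H)
    fix us assume us: "us \<in> R" "hd us \<in> K"
    then obtain q u where "us = [q, u]" using len[of us] by (auto simp: length_Suc_conv numeral_2_eq_2)
    then show "set us \<subseteq> M" using us R P K_M by auto
  qed (use len in auto)
  also have "(\<forall>\<^sub>F g in FF. g H # map g [x] \<in> R) \<longleftrightarrow> (\<forall>\<^sub>F g in FF. P (g H) (g x))"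
    by (rule eventually_subst) (use eventually_K in \<open>eventually_elim, auto simp: R\<close>)
  finally show ?thesis by simp
qed

text \<open>For codes in \<open>K\<close> the relation is the graph of \<open>F\<close> on the
  domain \<open>P\<close>, which is all that matters because the value at \<open>H\<close> is
  eventually in \<open>K\<close>.\<close>

lemma star_fun_H1:
  assumes len: "\<And>us. us \<in> R \<Longrightarrow> length us = 3"
    and R: "\<And>q u w. q \<in> K \<Longrightarrow> [q, u, w] \<in> R \<longleftrightarrow> P q u \<and> w = F q u"
    and P: "\<And>q u. q \<in> K \<Longrightarrow> P q u \<Longrightarrow> u \<in> M \<and> F q u \<in> M"
    and x: "x \<in> D" "\<forall>\<^sub>F g in FF. P (g H) (g x)"
  shows "star_fun U R [H, x] \<in> D \<and> (\<forall>\<^sub>F g in FF. g (star_fun U R [H, x]) = F (g H) (g x))"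
proof -
  have "star_fun U R [H, x] \<in> D \<and>
      (\<forall>\<^sub>F g in FF. map g [H, x] @ [g (star_fun U R [H, x])] \<in> R)"
  proof (rule star_fun_spec)
    show "star_rel U R ([H, x] @ [w]) \<longleftrightarrow> w \<in> D \<and> (\<forall>\<^sub>F g in FF. map g ([H, x] @ [w]) \<in> R)" for w
    proof -
      have "star_rel U R (H # [x, w]) \<longleftrightarrow> set [x, w] \<subseteq> D \<and> (\<forall>\<^sub>F g in FF. g H # map g [x, w] \<in> R)"
      proof (rule star_rel_H)
        fix us assume us: "us \<in> R" "hd us \<in> K"
        then obtain q u v where "us = [q, u, v]" using len[of us] by (auto simp: length_Suc_conv numeral_3_eq_3)
        then show "set us \<subseteq> M" using us R P K_M by auto
      qed (use len in auto)
      then show ?thesis using x(1) by simp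
    qed
    show "\<forall>\<^sub>F g in FF. \<exists>w\<in>M. map g [H, x] @ [w] \<in> R"
      using eventually_K x(2) by eventually_elim (use R P in auto)
    show "\<forall>\<^sub>F g in FF. \<forall>w w'. map g [H, x] @ [w] \<in> R \<longrightarrow> map g [H, x] @ [w'] \<in> R \<longrightarrow> w = w'"
      using eventually_K by eventually_elim (use R in auto)
  qed (use H_D x in \<open>auto simp: arity_def\<close>)
  note * = this
  have "\<forall>\<^sub>F g in FF. g (star_fun U R [H, x]) = F (g H) (g x)"
    using eventually_K *[THEN conjunct2] by eventually_elim (use R in auto)
  then show ?thesis using *[THEN conjunct1] by (rule conjI[rotated])
qed

lemma star_fun_H2:
  assumes len: "\<And>us. us \<in> R \<Longrightarrow> length us = 4"
    and R: "\<And>q u v w. q \<in> K \<Longrightarrow> [q, u, v, w] \<in> R \<longleftrightarrow> P q u v \<and> w = F q u v"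
    and P: "\<And>q u v. q \<in> K \<Longrightarrow> P q u v \<Longrightarrow> u \<in> M \<and> v \<in> M \<and> F q u v \<in> M"
    and x: "x \<in> D" "y \<in> D" "\<forall>\<^sub>F g in FF. P (g H) (g x) (g y)"
  shows "star_fun U R [H, x, y] \<in> D \<and> (\<forall>\<^sub>F g in FF. g (star_fun U R [H, x, y]) = F (g H) (g x) (g y))"
proof -
  have "star_fun U R [H, x, y] \<in> D \<and>
      (\<forall>\<^sub>F g in FF. map g [H, x, y] @ [g (star_fun U R [H, x, y])] \<in> R)"
  proof (rule star_fun_spec)
    show "star_rel U R ([H, x, y] @ [w]) \<longleftrightarrow> w \<in> D \<and> (\<forall>\<^sub>F g in FF. map g ([H, x, y] @ [w]) \<in> R)" for w
    proof -
      have "star_rel U R (H # [x, y, w]) \<longleftrightarrow> set [x, y, w] \<subseteq> D \<and> (\<forall>\<^sub>F g in FF. g H # map g [x, y, w] \<in> R)"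
      proof (rule star_rel_H)
        fix us assume us: "us \<in> R" "hd us \<in> K"
        then obtain q u v v' where "us = [q, u, v, v']"
          using len[of us] by (auto simp: length_Suc_conv eval_nat_numeral)
        then show "set us \<subseteq> M" using us R P K_M by auto
      qed (use len in auto)
      then show ?thesis using x(1,2) by simp
    qed
    show "\<forall>\<^sub>F g in FF. \<exists>w\<in>M. map g [H, x, y] @ [w] \<in> R"
      using eventually_K x(3) by eventually_elim (use R P in auto)
    show "\<forall>\<^sub>F g in FF. \<forall>w w'. map g [H, x, y] @ [w] \<in> R \<longrightarrow> map g [H, x, y] @ [w'] \<in> R \<longrightarrow> w = w'"
      using eventually_K by eventually_elim (use R in auto)
  qed (use H_D x in \<open>auto simp: arity_def\<close>)
  note * = this
  have "\<forall>\<^sub>F g in FF. g (star_fun U R [H, x, y]) = F (g H) (g x) (g y)"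
    using eventually_K *[THEN conjunct2] by eventually_elim (use R in auto)
  then show ?thesis using *[THEN conjunct1] by (rule conjI[rotated])
qed

abbreviation Sp :: "('v \<Rightarrow> 'u) \<Rightarrow> 'u ips" where "Sp g \<equiv> sp (g H)"

abbreviation opg :: "('v \<Rightarrow> 'u) \<Rightarrow> 'v \<Rightarrow> 'u \<Rightarrow> 'u" where "opg g a \<equiv> opf (g H) (g a)"

lemma ivec_iff: "x \<in> ivec U H \<longleftrightarrow> x \<in> D \<and> (\<forall>\<^sub>F g in FF. g x \<in> car (Sp g))"
  unfolding ivec_def mem_Collect_eq
  by (rule star_rel_H1) (auto simp only: codes_relations(1) sp_M, auto)

lemma iops_iff: "a \<in> iops U H \<longleftrightarrow> a \<in> D \<and> (\<forall>\<^sub>F g in FF. is_op (g H) (g a))"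
  unfolding iops_def mem_Collect_eq
  by (rule star_rel_H1) (auto simp only: codes_relations(7) is_op_M, auto)

lemma ivec_D: "x \<in> ivec U H \<Longrightarrow> x \<in> D" and ivec_car: "x \<in> ivec U H \<Longrightarrow> \<forall>\<^sub>F g in FF. g x \<in> car (Sp g)"
  by (simp_all add: ivec_iff)

lemma iops_D: "x \<in> iops U H \<Longrightarrow> x \<in> D" and iops_op: "x \<in> iops U H \<Longrightarrow> \<forall>\<^sub>F g in FF. is_op (g H) (g x)"
  by (simp_all add: iops_iff)

lemma iadd_spec:
  assumes "x \<in> ivec U H" "y \<in> ivec U H"
  shows "iadd U H x y \<in> ivec U H" "\<forall>\<^sub>F g in FF. g (iadd U H x y) = add (Sp g) (g x) (g y)"
proof -
  have *: "iadd U H x y \<in> D \<and> (\<forall>\<^sub>F g in FF. g (iadd U H x y) = add (Sp g) (g x) (g y))"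
    unfolding iadd_def
  proof (rule star_fun_H2[where P = "\<lambda>q u v. u \<in> car (sp q) \<and> v \<in> car (sp q)"])
    show "u \<in> M \<and> v \<in> M \<and> add (sp q) u v \<in> M" if "q \<in> K" "u \<in> car (sp q) \<and> v \<in> car (sp q)" for q u v
      using that sp_M inner_product_space.add_closed[OF sp_ips] by metis
    show "\<forall>\<^sub>F g in FF. g x \<in> car (Sp g) \<and> g y \<in> car (Sp g)"
      using ivec_car[OF assms(1)] ivec_car[OF assms(2)] by eventually_elim simp
  qed (use assms ivec_D in \<open>auto simp only: codes_relations(2), auto\<close>)
  then show "\<forall>\<^sub>F g in FF. g (iadd U H x y) = add (Sp g) (g x) (g y)" by simp
  then have "\<forall>\<^sub>F g in FF. g (iadd U H x y) \<in> car (Sp g)"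
    using eventually_K ivec_car[OF assms(1)] ivec_car[OF assms(2)]
    by eventually_elim (simp add: inner_product_space.add_closed[OF sp_ips])
  then show "iadd U H x y \<in> ivec U H" using * by (simp add: ivec_iff)
qed

lemma isub_spec:
  assumes "x \<in> ivec U H" "y \<in> ivec U H"
  shows "isub U H x y \<in> ivec U H" "\<forall>\<^sub>F g in FF. g (isub U H x y) = hsub (Sp g) (g x) (g y)"
proof -
  have *: "isub U H x y \<in> D \<and> (\<forall>\<^sub>F g in FF. g (isub U H x y) = hsub (Sp g) (g x) (g y))"
    unfolding isub_def
  proof (rule star_fun_H2[where P = "\<lambda>q u v. u \<in> car (sp q) \<and> v \<in> car (sp q)"])
    show "u \<in> M \<and> v \<in> M \<and> hsub (sp q) u v \<in> M" if "q \<in> K" "u \<in> car (sp q) \<and> v \<in> car (sp q)" for q u v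
      using that sp_M inner_product_space.hsub_closed[OF sp_ips] by metis
    show "\<forall>\<^sub>F g in FF. g x \<in> car (Sp g) \<and> g y \<in> car (Sp g)"
      using ivec_car[OF assms(1)] ivec_car[OF assms(2)] by eventually_elim simp
  qed (use assms ivec_D in \<open>auto simp only: codes_relations(3), auto\<close>)
  then show "\<forall>\<^sub>F g in FF. g (isub U H x y) = hsub (Sp g) (g x) (g y)" by simp
  then have "\<forall>\<^sub>F g in FF. g (isub U H x y) \<in> car (Sp g)"
    using eventually_K ivec_car[OF assms(1)] ivec_car[OF assms(2)]
    by eventually_elim (simp add: inner_product_space.hsub_closed[OF sp_ips])
  then show "isub U H x y \<in> ivec U H" using * by (simp add: ivec_iff)
qed

lemma iscl_spec:
  assumes "x \<in> ivec U H"
  shows "iscl U H (star U (cpx U c)) x \<in> ivec U H"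
    "\<forall>\<^sub>F g in FF. g (iscl U H (star U (cpx U c)) x) = scl (Sp g) c (g x)"
proof -
  let ?z = "iscl U H (star U (cpx U c)) x"
  \<comment> \<open>The scalar is a point too: its value under \<open>g\<close> is decoded by the
    inverse of \<open>cpx U\<close>, and the decoded number is eventually \<open>c\<close>.\<close>
  have *: "?z \<in> D \<and> (\<forall>\<^sub>F g in FF. g ?z = scl (Sp g) (inv (cpx U) (g (star U (cpx U c)))) (g x))"
    unfolding iscl_def
  proof (rule star_fun_H2[where P = "\<lambda>q c u. c \<in> range (cpx U) \<and> u \<in> car (sp q)" and
        F = "\<lambda>q c u. scl (sp q) (inv (cpx U) c) u"])
    show "a \<in> M \<and> v \<in> M \<and> scl (sp q) (inv (cpx U) a) v \<in> M" if "q \<in> K" "a \<in> range (cpx U) \<and> v \<in> car (sp q)" for q a v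
      using that sp_M inner_product_space.scl_closed[OF sp_ips] cpx_M by (metis rangeE)
    show "\<forall>\<^sub>F g in FF. g (star U (cpx U c)) \<in> range (cpx U) \<and> g x \<in> car (Sp g)"
      using ivec_car[OF assms(1)] eventually_star_cpx[of c] by eventually_elim simp
    show "[q, a, v, w] \<in> {[q, cpx U \<alpha>, u, scl S \<alpha> u] | q \<alpha> u S. codes_hilbert U q S \<and> u \<in> car S} \<longleftrightarrow>
      (a \<in> range (cpx U) \<and> v \<in> car (sp q)) \<and> w = scl (sp q) (inv (cpx U) a) v" if "q \<in> K" for q a v w
      unfolding codes_relations(4)[OF that] using inv_f_f[OF cpx_inj] by auto
  qed (use assms ivec_D in auto)
  then have "\<forall>\<^sub>F g in FF. g ?z = scl (Sp g) (inv (cpx U) (g (star U (cpx U c)))) (g x)" by simp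
  then show ev: "\<forall>\<^sub>F g in FF. g ?z = scl (Sp g) c (g x)"
    using eventually_star_cpx[of c] by eventually_elim (simp add: inv_f_f[OF cpx_inj])
  then have "\<forall>\<^sub>F g in FF. g ?z \<in> car (Sp g)"
    using eventually_K ivec_car[OF assms(1)]
    by eventually_elim (simp add: inner_product_space.scl_closed[OF sp_ips])
  then show "?z \<in> ivec U H" using * by (simp add: ivec_iff)
qed

lemma iinn_spec:
  assumes "x \<in> ivec U H" "y \<in> ivec U H"
  shows "iinn U H x y \<in> D" "\<forall>\<^sub>F g in FF. g (iinn U H x y) = cpx U (inn (Sp g) (g x) (g y))"
proof -
  have "iinn U H x y \<in> D \<and> (\<forall>\<^sub>F g in FF. g (iinn U H x y) = cpx U (inn (Sp g) (g x) (g y)))"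
    unfolding iinn_def
  proof (rule star_fun_H2[where P = "\<lambda>q u v. u \<in> car (sp q) \<and> v \<in> car (sp q)" and
       F = "\<lambda>q u v. cpx U (inn (sp q) u v)"])
    show "u \<in> M \<and> v \<in> M \<and> cpx U (inn (sp q) u v) \<in> M" if "q \<in> K" "u \<in> car (sp q) \<and> v \<in> car (sp q)" for q u v
      using that sp_M cpx_M by metis
    show "\<forall>\<^sub>F g in FF. g x \<in> car (Sp g) \<and> g y \<in> car (Sp g)"
      using ivec_car[OF assms(1)] ivec_car[OF assms(2)] by eventually_elim simp
  qed (use assms ivec_D in \<open>auto simp only: codes_relations(5), auto\<close>)
  then show "iinn U H x y \<in> D" "\<forall>\<^sub>F g in FF. g (iinn U H x y) = cpx U (inn (Sp g) (g x) (g y))"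
    by simp_all
qed

lemma inorm_spec:
  assumes "x \<in> ivec U H"
  shows "inorm U H x \<in> D" "\<forall>\<^sub>F g in FF. g (inorm U H x) = rl U (hnorm (Sp g) (g x))"
proof -
  have "inorm U H x \<in> D \<and> (\<forall>\<^sub>F g in FF. g (inorm U H x) = rl U (hnorm (Sp g) (g x)))"
    unfolding inorm_def
  proof (rule star_fun_H1[where P = "\<lambda>q u. u \<in> car (sp q)" and F = "\<lambda>q u. rl U (hnorm (sp q) u)"])
    show "u \<in> M \<and> rl U (hnorm (sp q) u) \<in> M" if "q \<in> K" "u \<in> car (sp q)" for q u
      using that sp_M cpx_M by metis
  qed (use assms ivec_D ivec_car in \<open>auto simp only: codes_relations(6), auto\<close>)
  then show "inorm U H x \<in> D" "\<forall>\<^sub>F g in FF. g (inorm U H x) = rl U (hnorm (Sp g) (g x))"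
    by simp_all
qed

lemma iapp_spec:
  assumes "a \<in> iops U H" "x \<in> ivec U H"
  shows "iapp U H a x \<in> ivec U H" "\<forall>\<^sub>F g in FF. g (iapp U H a x) = opg g a (g x)"
proof -
  have cl: "opf q t u \<in> car (sp q)" if "q \<in> K" "is_op q t" "u \<in> car (sp q)" for q t u
    using inner_product_space.bounded_opsD(1)[OF sp_ips is_op_bounded] that by metis
  have *: "iapp U H a x \<in> D \<and> (\<forall>\<^sub>F g in FF. g (iapp U H a x) = opg g a (g x))"
    unfolding iapp_def
  proof (rule star_fun_H2[where P = "\<lambda>q t v. is_op q t \<and> v \<in> car (sp q)"])
    show "t \<in> M \<and> v \<in> M \<and> opf q t v \<in> M" if "q \<in> K" "is_op q t \<and> v \<in> car (sp q)" for q t v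
      using that sp_M is_op_M cl by metis
    show "\<forall>\<^sub>F g in FF. is_op (g H) (g a) \<and> g x \<in> car (Sp g)"
      using iops_op[OF assms(1)] ivec_car[OF assms(2)] by eventually_elim simp
  qed (use assms ivec_D iops_D in \<open>auto simp only: codes_relations(8), auto\<close>)
  then show "\<forall>\<^sub>F g in FF. g (iapp U H a x) = opg g a (g x)" by simp
  then have "\<forall>\<^sub>F g in FF. g (iapp U H a x) \<in> car (Sp g)"
    using eventually_K iops_op[OF assms(1)] ivec_car[OF assms(2)]
    by eventually_elim (simp add: cl)
  then show "iapp U H a x \<in> ivec U H" using * by (simp add: ivec_iff)
qed

lemma iopsub_spec:
  assumes "a \<in> iops U H" "b \<in> iops U H"
  shows "iopsub U H a b \<in> iops U H"
    "\<forall>\<^sub>F g in FF. opg g (iopsub U H a b) = op_sub (Sp g) (opg g a) (opg g b)"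
proof -
  have bd: "op_sub (sp q) (opf q t) (opf q t') \<in> bounded_ops (sp q)"
    if "q \<in> K" "is_op q t" "is_op q t'" for q t t'
    using inner_product_space.op_sub_bounded[OF sp_ips] is_op_bounded that by metis
  let ?F = "\<lambda>q t t'. op_code q (op_sub (sp q) (opf q t) (opf q t'))"
  have *: "iopsub U H a b \<in> D \<and> (\<forall>\<^sub>F g in FF. g (iopsub U H a b) = ?F (g H) (g a) (g b))"
    unfolding iopsub_def
  proof (rule star_fun_H2[where P = "\<lambda>q t t'. is_op q t \<and> is_op q t'" and F = ?F])
    show "t \<in> M \<and> t' \<in> M \<and> ?F q t t' \<in> M" if "q \<in> K" "is_op q t \<and> is_op q t'" for q t t'
      using that is_op_M is_op_op_code bd by metis
    show "\<forall>\<^sub>F g in FF. is_op (g H) (g a) \<and> is_op (g H) (g b)"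
      using iops_op[OF assms(1)] iops_op[OF assms(2)] by eventually_elim simp
    show "[q, t, t', d] \<in> {[q, t, t', d] | q t t' d. \<exists>S T T'. codes_hilbert U q S \<and> codes_op U S t T \<and>
        codes_op U S t' T' \<and> codes_op U S d (op_sub S T T')} \<longleftrightarrow>
        (is_op q t \<and> is_op q t') \<and> d = ?F q t t'" if q: "q \<in> K" for q t t' d
      unfolding codes_relations(9)[OF q] using op_code_iff[OF q bd[OF q]] by auto
  qed (use assms iops_D in auto)
  then have ev: "\<forall>\<^sub>F g in FF. g (iopsub U H a b) = ?F (g H) (g a) (g b)" by simp
  have "\<forall>\<^sub>F g in FF. is_op (g H) (g (iopsub U H a b)) \<and>
      opg g (iopsub U H a b) = op_sub (Sp g) (opg g a) (opg g b)"
    using ev eventually_K iops_op[OF assms(1)] iops_op[OF assms(2)]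
    by eventually_elim (simp add: is_op_op_code opf_op_code bd)
  then show "iopsub U H a b \<in> iops U H"
    "\<forall>\<^sub>F g in FF. opg g (iopsub U H a b) = op_sub (Sp g) (opg g a) (opg g b)"
    using * by (simp_all add: iops_iff eventually_conj_iff)
qed

lemma iopnorm_spec:
  assumes "a \<in> iops U H"
  shows "iopnorm U H a \<in> D" "\<forall>\<^sub>F g in FF. g (iopnorm U H a) = rl U (op_norm (Sp g) (opg g a))"
proof -
  have "iopnorm U H a \<in> D \<and> (\<forall>\<^sub>F g in FF. g (iopnorm U H a) = rl U (op_norm (Sp g) (opg g a)))"
    unfolding iopnorm_def
  proof (rule star_fun_H1[where P = is_op and F = "\<lambda>q t. rl U (op_norm (sp q) (opf q t))"])
    show "t \<in> M \<and> rl U (op_norm (sp q) (opf q t)) \<in> M" if "q \<in> K" "is_op q t" for q t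
      using that is_op_M cpx_M by metis
  qed (use assms iops_D iops_op in \<open>auto simp only: codes_relations(10), auto\<close>)
  then show "iopnorm U H a \<in> D" "\<forall>\<^sub>F g in FF. g (iopnorm U H a) = rl U (op_norm (Sp g) (opg g a))"
    by simp_all
qed

lemma internal_dim_iff:
  "internal_dim U H (star U (rl U (real n))) \<longleftrightarrow> (\<forall>\<^sub>F g in FF. has_hilbert_dim (Sp g) n)"
proof -
  have "internal_dim U H (star U (rl U (real n))) \<longleftrightarrow> star U (rl U (real n)) \<in> D \<and>
      (\<forall>\<^sub>F g in FF. \<exists>m. g (star U (rl U (real n))) = rl U (real m) \<and> has_hilbert_dim (Sp g) m)"
    unfolding internal_dim_def
    by (rule star_rel_H1) (auto simp only: codes_relations(11) cpx_M, auto)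
  also have "\<dots> \<longleftrightarrow> (\<forall>\<^sub>F g in FF. \<exists>m. g (star U (rl U (real n))) = rl U (real m) \<and> has_hilbert_dim (Sp g) m)"
    by simp
  also have "\<dots> \<longleftrightarrow> (\<forall>\<^sub>F g in FF. has_hilbert_dim (Sp g) n)"
    by (rule eventually_subst) (use eventually_star_cpx[of "complex_of_real (real n)"] in \<open>eventually_elim, auto\<close>)
  finally show ?thesis .
qed

end

section \<open>The hull as an inner product space\<close>

context inner_product_space
begin

lemma hnorm_add_diff:
  assumes "x \<in> car S" "y \<in> car S" "x' \<in> car S" "y' \<in> car S"
  shows "hnorm S (hsub S (add S x y) (add S x' y')) \<le> hnorm S (hsub S x x') + hnorm S (hsub S y y')"
proof -
  have "hsub S (add S x y) (add S x' y') = add S (hsub S x x') (hsub S y y')"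
    by (rule eqI) (use assms in auto)
  then show ?thesis using hnorm_add[of "hsub S x x'" "hsub S y y'"] assms by simp
qed

lemma hnorm_scl_diff:
  assumes "x \<in> car S" "x' \<in> car S"
  shows "hnorm S (hsub S (scl S c x) (scl S c x')) = cmod c * hnorm S (hsub S x x')"
proof -
  have "hsub S (scl S c x) (scl S c x') = scl S c (hsub S x x')"
    by (rule eqI) (use assms in \<open>auto simp: algebra_simps\<close>)
  then show ?thesis using assms by simp
qed

lemma hnorm_hsub_self: "x \<in> car S \<Longrightarrow> hnorm S (hsub S x x) = 0"
  by (simp add: hnorm_hsub_eq_0)

end

context internal_hilbert
begin

lemma eventually_ips: "\<forall>\<^sub>F g in FF. inner_product_space (Sp g)"
  using eventually_K by (rule eventually_mono) (rule sp_ips)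

definition fin :: "'v set" where
  "fin = {x \<in> ivec U H. \<exists>B. \<forall>\<^sub>F g in FF. hnorm (Sp g) (g x) \<le> B}"

definition near :: "'v \<Rightarrow> 'v \<Rightarrow> bool" where
  "near x y \<longleftrightarrow> ((\<lambda>g. hnorm (Sp g) (hsub (Sp g) (g x) (g y))) \<longlongrightarrow> 0) FF"

lemma fin_ivec: "x \<in> fin \<Longrightarrow> x \<in> ivec U H"
  by (simp add: fin_def)

lemma fin_car: "x \<in> fin \<Longrightarrow> \<forall>\<^sub>F g in FF. g x \<in> car (Sp g)"
  by (rule ivec_car[OF fin_ivec])

lemma finI: "x \<in> ivec U H \<Longrightarrow> \<forall>\<^sub>F g in FF. hnorm (Sp g) (g x) \<le> B \<Longrightarrow> x \<in> fin"
  by (auto simp: fin_def)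

lemma finE:
  assumes "x \<in> fin"
  obtains B where "0 \<le> B" "\<forall>\<^sub>F g in FF. hnorm (Sp g) (g x) \<le> B"
proof -
  obtain B where B: "\<forall>\<^sub>F g in FF. hnorm (Sp g) (g x) \<le> B" using assms by (auto simp: fin_def)
  show ?thesis
    by (rule that[of "\<bar>B\<bar>"]) (auto intro: eventually_mono[OF B])
qed

lemma hfinite_inorm:
  assumes "x \<in> ivec U H"
  shows "hfinite U (inorm U H x) \<longleftrightarrow> x \<in> fin"
proof -
  have "hfinite U (inorm U H x) \<longleftrightarrow> (\<exists>B. \<forall>\<^sub>F g in FF. cmod (complex_of_real (hnorm (Sp g) (g x))) \<le> B)"
    by (rule hfinite_iff[OF inorm_spec[OF assms]])
  also have "\<dots> \<longleftrightarrow> (\<exists>B. \<forall>\<^sub>F g in FF. hnorm (Sp g) (g x) \<le> B)"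
  proof -
    have "(\<forall>\<^sub>F g in FF. cmod (complex_of_real (hnorm (Sp g) (g x))) \<le> B) \<longleftrightarrow>
        (\<forall>\<^sub>F g in FF. hnorm (Sp g) (g x) \<le> B)" for B
    proof (rule eventually_subst)
      show "\<forall>\<^sub>F g in FF. (cmod (complex_of_real (hnorm (Sp g) (g x))) \<le> B) = (hnorm (Sp g) (g x) \<le> B)"
        using eventually_ips ivec_car[OF assms]
        by eventually_elim (simp add: inner_product_space.hnorm_nonneg)
    qed
    then show ?thesis by simp
  qed
  finally show ?thesis using assms by (simp add: fin_def)
qed

lemma near_refl: "x \<in> ivec U H \<Longrightarrow> near x x"
  unfolding near_def
proof (rule tendsto_eventually)
  assume x: "x \<in> ivec U H"
  show "\<forall>\<^sub>F g in FF. hnorm (Sp g) (hsub (Sp g) (g x) (g x)) = 0"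
    using eventually_ips ivec_car[OF x] by eventually_elim (rule inner_product_space.hnorm_hsub_self)
qed

lemma near_sym:
  assumes "x \<in> ivec U H" "y \<in> ivec U H" "near x y" shows "near y x"
  using assms(3) unfolding near_def
proof (rule tendsto_cong[THEN iffD1, rotated])
  show "\<forall>\<^sub>F g in FF. hnorm (Sp g) (hsub (Sp g) (g x) (g y)) = hnorm (Sp g) (hsub (Sp g) (g y) (g x))"
    using eventually_ips ivec_car[OF assms(1)] ivec_car[OF assms(2)]
    by eventually_elim (rule inner_product_space.hnorm_hsub_commute)
qed

lemma near_bound:
  assumes "x \<in> ivec U H" "y \<in> ivec U H"
    and le: "\<forall>\<^sub>F g in FF. hnorm (Sp g) (hsub (Sp g) (g x) (g y)) \<le> f g" and f: "(f \<longlongrightarrow> 0) FF"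
  shows "near x y"
  unfolding near_def
proof (rule tendsto_sandwich[OF _ le tendsto_const f])
  show "\<forall>\<^sub>F g in FF. 0 \<le> hnorm (Sp g) (hsub (Sp g) (g x) (g y))"
    using eventually_ips ivec_car[OF assms(1)] ivec_car[OF assms(2)]
    by eventually_elim (simp add: inner_product_space.hnorm_nonneg inner_product_space.hsub_closed)
qed

lemma near_trans:
  assumes "x \<in> ivec U H" "y \<in> ivec U H" "z \<in> ivec U H" "near x y" "near y z" shows "near x z"
proof (rule near_bound[OF assms(1,3)])
  show "\<forall>\<^sub>F g in FF. hnorm (Sp g) (hsub (Sp g) (g x) (g z)) \<le>
      hnorm (Sp g) (hsub (Sp g) (g x) (g y)) + hnorm (Sp g) (hsub (Sp g) (g y) (g z))"
    using eventually_ips ivec_car[OF assms(1)] ivec_car[OF assms(2)] ivec_car[OF assms(3)]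
    by eventually_elim (rule inner_product_space.hnorm_hsub_triangle)
  show "((\<lambda>g. hnorm (Sp g) (hsub (Sp g) (g x) (g y)) + hnorm (Sp g) (hsub (Sp g) (g y) (g z))) \<longlongrightarrow> 0) FF"
    using tendsto_add[OF assms(4,5)[unfolded near_def]] by simp
qed

lemma vhat_iff:
  assumes "x \<in> ivec U H"
  shows "y \<in> vhat U H x \<longleftrightarrow> y \<in> ivec U H \<and> near y x"
proof (cases "y \<in> ivec U H")
  case True
  note s = isub_spec[OF True assms]
  have "\<forall>\<^sub>F g in FF. g (inorm U H (isub U H y x)) = rl U (hnorm (Sp g) (hsub (Sp g) (g y) (g x)))"
    using inorm_spec(2)[OF s(1)] s(2) by eventually_elim simp
  from happrox_iff[OF inorm_spec(1)[OF s(1)] this, of 0]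
  show ?thesis
    using True tendsto_of_real_iff[where c = "0 :: real" and 'a = complex] by (simp add: vhat_def hat_def near_def)
qed (simp add: vhat_def hat_def)

lemma vhat_eq_iff:
  assumes "x \<in> ivec U H" "y \<in> ivec U H"
  shows "vhat U H x = vhat U H y \<longleftrightarrow> near x y"
proof
  assume "vhat U H x = vhat U H y"
  then have "x \<in> vhat U H y" using vhat_iff[OF assms(1), of x] near_refl assms by simp
  then show "near x y" using vhat_iff[OF assms(2)] by simp
next
  assume "near x y"
  then show "vhat U H x = vhat U H y"
    using vhat_iff[OF assms(1)] vhat_iff[OF assms(2)] near_trans near_sym assms by blast
qed

lemma near_fin:
  assumes "x \<in> fin" "y \<in> ivec U H" "near y x" shows "y \<in> fin"
proof -
  obtain B where B: "\<forall>\<^sub>F g in FF. hnorm (Sp g) (g x) \<le> B" using finE[OF assms(1)] by blast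
  have "\<forall>\<^sub>F g in FF. hnorm (Sp g) (hsub (Sp g) (g y) (g x)) < 1"
    using order_tendstoD(2)[OF assms(3)[unfolded near_def], of 1] by simp
  then have "\<forall>\<^sub>F g in FF. hnorm (Sp g) (g y) \<le> 1 + B"
    using eventually_ips B fin_car[OF assms(1)] ivec_car[OF assms(2)]
  proof eventually_elim
    case (elim g)
    show ?case using inner_product_space.hnorm_le_hsub[OF elim(2,5,4)] elim(1,3) by linarith
  qed
  then show ?thesis by (rule finI[OF assms(2)])
qed

abbreviation HS :: "'v set ips" where "HS \<equiv> hull_space U H"

lemma car_HS: "car HS = vhat U H ` fin"
proof -
  have "{x \<in> ivec U H. hfinite U (inorm U H x)} = fin"
    using hfinite_inorm fin_ivec by blast
  then show ?thesis by (simp add: hull_space_def ns_hull_def vhat_def)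
qed

lemma vhat_HS: "x \<in> fin \<Longrightarrow> vhat U H x \<in> car HS"
  by (simp add: car_HS)

lemma vhat_self: "x \<in> ivec U H \<Longrightarrow> x \<in> vhat U H x"
  by (simp add: vhat_iff near_refl)

lemma vhat_memD: "x \<in> fin \<Longrightarrow> y \<in> vhat U H x \<Longrightarrow> y \<in> fin \<and> near y x"
  using near_fin vhat_iff fin_ivec by blast

lemma iadd_fin:
  assumes "x \<in> fin" "y \<in> fin" shows "iadd U H x y \<in> fin"
proof -
  obtain B where B: "\<forall>\<^sub>F g in FF. hnorm (Sp g) (g x) \<le> B" using finE[OF assms(1)] by blast
  obtain C where C: "\<forall>\<^sub>F g in FF. hnorm (Sp g) (g y) \<le> C" using finE[OF assms(2)] by blast
  note a = iadd_spec[OF fin_ivec fin_ivec, OF assms]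
  have "\<forall>\<^sub>F g in FF. hnorm (Sp g) (g (iadd U H x y)) \<le> B + C"
    using eventually_ips B C fin_car[OF assms(1)] fin_car[OF assms(2)] a(2)
  proof eventually_elim
    case (elim g)
    show ?case using inner_product_space.hnorm_add[OF elim(1,4,5)] elim(2,3,6) by simp
  qed
  then show ?thesis by (rule finI[OF a(1)])
qed

lemma iscl_fin:
  assumes "x \<in> fin" shows "iscl U H (star U (cpx U c)) x \<in> fin"
proof -
  obtain B where B: "\<forall>\<^sub>F g in FF. hnorm (Sp g) (g x) \<le> B" using finE[OF assms(1)] by blast
  note a = iscl_spec[OF fin_ivec, OF assms, of c]
  have "\<forall>\<^sub>F g in FF. hnorm (Sp g) (g (iscl U H (star U (cpx U c)) x)) \<le> cmod c * B"
    using eventually_ips B fin_car[OF assms(1)] a(2)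
    by eventually_elim (simp add: inner_product_space.hnorm_scl mult_left_mono)
  then show ?thesis by (rule finI[OF a(1)])
qed

text \<open>The description in \<open>hull_space\<close> is well defined because the distance of two
  sums is at most the sum of the distances of the summands, hence infinitesimal for infinitely close
  representatives.\<close>

lemma add_HS:
  assumes "x \<in> fin" "y \<in> fin"
  shows "add HS (vhat U H x) (vhat U H y) = vhat U H (iadd U H x y)"
proof -
  have "vhat U H (iadd U H x' y') = vhat U H (iadd U H x y)"
    if "x' \<in> vhat U H x" "y' \<in> vhat U H y" for x' y'
  proof -
    have xy: "x' \<in> fin" "near x' x" "y' \<in> fin" "near y' y" using vhat_memD assms that by blast+
    note iv = fin_ivec[OF xy(1)] fin_ivec[OF xy(3)] fin_ivec[OF assms(1)] fin_ivec[OF assms(2)]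
    note a = iadd_spec[OF iv(1,2)] and b = iadd_spec[OF iv(3,4)]
    have "near (iadd U H x' y') (iadd U H x y)"
    proof (rule near_bound[OF a(1) b(1)])
      show "\<forall>\<^sub>F g in FF. hnorm (Sp g) (hsub (Sp g) (g (iadd U H x' y')) (g (iadd U H x y))) \<le>
          hnorm (Sp g) (hsub (Sp g) (g x') (g x)) + hnorm (Sp g) (hsub (Sp g) (g y') (g y))"
        using eventually_ips ivec_car[OF iv(1)] ivec_car[OF iv(2)] ivec_car[OF iv(3)] ivec_car[OF iv(4)] a(2) b(2)
        by eventually_elim (simp add: inner_product_space.hnorm_add_diff)
      show "((\<lambda>g. hnorm (Sp g) (hsub (Sp g) (g x') (g x)) + hnorm (Sp g) (hsub (Sp g) (g y') (g y))) \<longlongrightarrow> 0) FF"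
        using tendsto_add[OF xy(2,4)[unfolded near_def]] by simp
    qed
    then show ?thesis using vhat_eq_iff[OF a(1) b(1)] by simp
  qed
  moreover have "x \<in> vhat U H x" "y \<in> vhat U H y" using vhat_self fin_ivec assms by blast+
  ultimately show ?thesis
    unfolding hull_space_def ips.simps by (intro the_equality) blast+
qed

lemma scl_HS:
  assumes "x \<in> fin"
  shows "scl HS c (vhat U H x) = vhat U H (iscl U H (star U (cpx U c)) x)"
proof -
  let ?s = "\<lambda>x. iscl U H (star U (cpx U c)) x"
  have "vhat U H (?s x') = vhat U H (?s x)" if "x' \<in> vhat U H x" for x'
  proof -
    have xy: "x' \<in> fin" "near x' x" using vhat_memD assms that by blast+
    note iv = fin_ivec[OF xy(1)] fin_ivec[OF assms]
    note a = iscl_spec[OF iv(1), of c] and b = iscl_spec[OF iv(2), of c]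
    have "near (?s x') (?s x)"
    proof (rule near_bound[OF a(1) b(1)])
      show "\<forall>\<^sub>F g in FF. hnorm (Sp g) (hsub (Sp g) (g (?s x')) (g (?s x))) \<le>
          cmod c * hnorm (Sp g) (hsub (Sp g) (g x') (g x))"
        using eventually_ips ivec_car[OF iv(1)] ivec_car[OF iv(2)] a(2) b(2)
        by eventually_elim (simp add: inner_product_space.hnorm_scl_diff)
      show "((\<lambda>g. cmod c * hnorm (Sp g) (hsub (Sp g) (g x') (g x))) \<longlongrightarrow> 0) FF"
        using tendsto_mult_right_zero[OF xy(2)[unfolded near_def]] by simp
    qed
    then show ?thesis using vhat_eq_iff[OF a(1) b(1)] by simp
  qed
  moreover have "x \<in> vhat U H x" using vhat_self fin_ivec assms by blast
  ultimately show ?thesis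
    unfolding hull_space_def ips.simps by (intro the_equality) blast+
qed

section \<open>Inner product and vector space axioms of the hull\<close>

definition li :: "'v \<Rightarrow> 'v \<Rightarrow> complex" where
  "li x y = Lim FF (\<lambda>g. inn (Sp g) (g x) (g y))"

text \<open>The inner product of finite vectors is bounded by Cauchy-Schwarz, and bounded random
  numbers converge along \<open>FF\<close>.\<close>

lemma li_tendsto:
  assumes "x \<in> fin" "y \<in> fin"
  shows "((\<lambda>g. inn (Sp g) (g x) (g y)) \<longlongrightarrow> li x y) FF"
proof -
  obtain B where B: "0 \<le> B" "\<forall>\<^sub>F g in FF. hnorm (Sp g) (g x) \<le> B" using finE[OF assms(1)] by blast
  obtain C where C: "\<forall>\<^sub>F g in FF. hnorm (Sp g) (g y) \<le> C" using finE[OF assms(2)] by blast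
  have "\<forall>\<^sub>F g in FF. cmod (inn (Sp g) (g x) (g y)) \<le> B * C"
    using eventually_ips B(2) C fin_car[OF assms(1)] fin_car[OF assms(2)]
  proof eventually_elim
    case (elim g)
    interpret inner_product_space "Sp g" by (rule elim(1))
    show ?case using Cauchy_Schwarz[OF elim(4,5)] mult_mono[OF elim(2,3) B(1) hnorm_nonneg[OF elim(5)]]
      by linarith
  qed
  from ex_limit[OF iinn_spec[OF fin_ivec[OF assms(1)] fin_ivec[OF assms(2)]] this]
  show ?thesis unfolding li_def using tendsto_Lim[OF FF_nonbot] by blast
qed

lemma standard_part_iinn:
  assumes "x \<in> fin" "y \<in> fin"
  shows "standard_part U (iinn U H x y) = li x y"
  by (rule standard_part_eq[OF iinn_spec[OF fin_ivec fin_ivec] li_tendsto]) (use assms in auto)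

lemma li_eqI: "((\<lambda>g. inn (Sp g) (g x) (g y)) \<longlongrightarrow> c) FF \<Longrightarrow> li x y = c"
  unfolding li_def by (rule tendsto_Lim[OF FF_nonbot])

text \<open>Independence of the representatives: a change of representatives alters the inner
  product by at most infinitesimal distances times finite norms.\<close>

lemma inn_HS:
  assumes "x \<in> fin" "y \<in> fin"
  shows "inn HS (vhat U H x) (vhat U H y) = li x y"
proof -
  have "standard_part U (iinn U H x' y') = li x y"
    if "x' \<in> vhat U H x" "y' \<in> vhat U H y" for x' y'
  proof -
    have xy: "x' \<in> fin" "near x' x" "y' \<in> fin" "near y' y" using vhat_memD assms that by blast+
    obtain B where B: "0 \<le> B" "\<forall>\<^sub>F g in FF. hnorm (Sp g) (g y') \<le> B" using finE[OF xy(3)] by blast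
    obtain C where C: "0 \<le> C" "\<forall>\<^sub>F g in FF. hnorm (Sp g) (g x) \<le> C" using finE[OF assms(1)] by blast
    let ?dx = "\<lambda>g. hnorm (Sp g) (hsub (Sp g) (g x') (g x))"
    let ?dy = "\<lambda>g. hnorm (Sp g) (hsub (Sp g) (g y') (g y))"
    have "((\<lambda>g. inn (Sp g) (g x') (g y') - inn (Sp g) (g x) (g y)) \<longlongrightarrow> 0) FF"
    proof (rule Lim_null_comparison)
      show "\<forall>\<^sub>F g in FF. norm (inn (Sp g) (g x') (g y') - inn (Sp g) (g x) (g y)) \<le> ?dx g * B + C * ?dy g"
        using eventually_ips B(2) C(2) fin_car[OF xy(1)] fin_car[OF xy(3)] fin_car[OF assms(1)] fin_car[OF assms(2)]
      proof eventually_elim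
        case (elim g)
        interpret inner_product_space "Sp g" by (rule elim(1))
        show ?case
          using inn_diff_bound[OF elim(4,5,6,7)] elim(4-7)
            mult_left_mono[OF elim(2), of "?dx g"] mult_right_mono[OF elim(3), of "?dy g"] by simp
      qed
      show "((\<lambda>g. ?dx g * B + C * ?dy g) \<longlongrightarrow> 0) FF"
        using tendsto_add[OF tendsto_mult_left_zero[OF xy(2)[unfolded near_def], of B]
          tendsto_mult_right_zero[OF xy(4)[unfolded near_def], of C]] by simp
    qed
    from tendsto_add[OF this li_tendsto[OF assms]]
    have "((\<lambda>g. inn (Sp g) (g x') (g y')) \<longlongrightarrow> li x y) FF" by simp
    then show ?thesis using standard_part_iinn[OF xy(1,3)] li_eqI by simp
  qed
  moreover have "x \<in> vhat U H x" "y \<in> vhat U H y" using vhat_self fin_ivec assms by blast+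
  ultimately show ?thesis
    unfolding hull_space_def ips.simps by (intro the_equality) metis+
qed

lemma ivec_eqI:
  assumes "x \<in> ivec U H" "y \<in> ivec U H" "\<forall>\<^sub>F g in FF. g x = g y" shows "x = y"
  using D_eqI ivec_D assms by blast

lemma ivec_eqI_inn:
  assumes "x \<in> ivec U H" "y \<in> ivec U H"
    and "\<forall>\<^sub>F g in FF. \<forall>z\<in>car (Sp g). inn (Sp g) (g x) z = inn (Sp g) (g y) z" shows "x = y"
proof (rule ivec_eqI[OF assms(1,2)])
  show "\<forall>\<^sub>F g in FF. g x = g y"
    using eventually_ips assms(3) ivec_car[OF assms(1)] ivec_car[OF assms(2)]
    by eventually_elim (rule inner_product_space.eqI, auto)
qed

lemma ex_fin: "\<exists>x. x \<in> fin"
proof -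
  have "\<forall>\<^sub>F g in FF. \<exists>w\<in>M. w \<in> car (Sp g)"
    using eventually_K
  proof eventually_elim
    case (elim g)
    then show ?case using inner_product_space.ex_zero[OF sp_ips] sp_M by blast
  qed
  from choice1[OF H_D, of "\<lambda>q w. w \<in> car (sp q)", OF this] obtain w where w: "w \<in> ivec U H" by (auto simp: ivec_iff)
  have "\<forall>\<^sub>F g in FF. hnorm (Sp g) (g (iscl U H (star U (cpx U 0)) w)) \<le> 0"
    using eventually_ips ivec_car[OF w] iscl_spec(2)[OF w, of 0]
    by eventually_elim (simp add: inner_product_space.hnorm_scl)
  from finI[OF iscl_spec(1)[OF w] this] show ?thesis ..
qed

abbreviation hscl :: "complex \<Rightarrow> 'v \<Rightarrow> 'v" where "hscl c x \<equiv> iscl U H (star U (cpx U c)) x"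

lemma HS_ball: "(\<forall>X\<in>car HS. P X) \<longleftrightarrow> (\<forall>x\<in>fin. P (vhat U H x))"
  by (simp add: car_HS)

text \<open>The required identities hold exactly, not merely up to infinitesimals, for internal
  representatives, because they hold in almost every \<open>Sp g\<close>; they then pass to the
  classes.\<close>

lemma HS_vector_space: "complex_vector_space_on HS"
proof -
  note ax = eventually_ips
  note iv = fin_ivec
  note asp = iadd_spec(2)[OF fin_ivec fin_ivec] and ssp = iscl_spec(2)[OF fin_ivec]
  note av = fin_ivec[OF iadd_fin] and sv = fin_ivec[OF iscl_fin]
  have comm: "iadd U H x y = iadd U H y x" if "x \<in> fin" "y \<in> fin" for x y
    using ax fin_car[OF that(1)] fin_car[OF that(2)] asp[OF that] asp[OF that(2,1)]
    by (intro ivec_eqI av that, eventually_elim) (simp add: inner_product_space.add_commute)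
  have assoc: "iadd U H (iadd U H x y) z = iadd U H x (iadd U H y z)"
    if "x \<in> fin" "y \<in> fin" "z \<in> fin" for x y z
    using ax fin_car[OF that(1)] fin_car[OF that(2)] fin_car[OF that(3)] asp[OF that(1,2)] asp[OF that(2,3)]
      asp[OF iadd_fin[OF that(1,2)] that(3)] asp[OF that(1) iadd_fin[OF that(2,3)]]
    by (intro ivec_eqI av iadd_fin that, eventually_elim) (simp add: inner_product_space.add_assoc)
  obtain x0 where x0: "x0 \<in> fin" using ex_fin ..
  \<comment> \<open>The zero vector, obtained from an arbitrary finite vector because the record has
    no zero.\<close>
  define z where "z = hscl 0 x0"
  have z: "z \<in> fin" unfolding z_def by (rule iscl_fin[OF x0])
  have zero: "iadd U H z x = x" if "x \<in> fin" for x
    using ax fin_car[OF that(1)] fin_car[OF x0] asp[OF z that] ssp[OF x0, of 0]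
    by (intro ivec_eqI_inn av z that iv, eventually_elim)
      (auto simp: z_def inner_product_space.inn_add inner_product_space.inn_scl inner_product_space.scl_closed)
  have inverse: "iadd U H x (hscl (-1) x) = z" if "x \<in> fin" for x
    using ax fin_car[OF that(1)] fin_car[OF x0] asp[OF that iscl_fin[OF that, of "-1"]]
      ssp[OF x0, of 0] ssp[OF that, of "-1"]
    by (intro ivec_eqI_inn av z that iv iscl_fin, eventually_elim)
      (auto simp: z_def inner_product_space.inn_add inner_product_space.inn_scl inner_product_space.scl_closed)
  have one: "hscl 1 x = x" if "x \<in> fin" for x
    using ax fin_car[OF that(1)] ssp[OF that, of 1]
    by (intro ivec_eqI sv iv that, eventually_elim) (simp add: inner_product_space.scl_one)
  have ss: "hscl c (hscl d x) = hscl (c * d) x" if "x \<in> fin" for c d x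
    using ax fin_car[OF that(1)] ssp[OF that, of d] ssp[OF iscl_fin[OF that], of c d] ssp[OF that, of "c * d"]
    by (intro ivec_eqI_inn sv iscl_fin that, eventually_elim)
      (auto simp: inner_product_space.inn_scl inner_product_space.scl_closed)
  have sl: "hscl (c + d) x = iadd U H (hscl c x) (hscl d x)" if "x \<in> fin" for c d x
    using ax fin_car[OF that(1)] ssp[OF that, of d] ssp[OF that, of c] ssp[OF that, of "c + d"]
      asp[OF iscl_fin[OF that] iscl_fin[OF that], of c d]
    by (intro ivec_eqI_inn sv av iscl_fin that, eventually_elim)
      (auto simp: inner_product_space.scl_add_left)
  have sr: "hscl c (iadd U H x y) = iadd U H (hscl c x) (hscl c y)" if "x \<in> fin" "y \<in> fin" for c x y
    using ax fin_car[OF that(1)] fin_car[OF that(2)] ssp[OF that(1), of c] ssp[OF that(2), of c]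
      ssp[OF iadd_fin[OF that], of c] asp[OF that] asp[OF iscl_fin[OF that(1)] iscl_fin[OF that(2)], of c c]
    by (intro ivec_eqI_inn sv av iscl_fin iadd_fin that, eventually_elim)
      (auto simp: inner_product_space.inn_add inner_product_space.inn_scl inner_product_space.scl_closed
         inner_product_space.add_closed algebra_simps)
  have ex: "\<exists>Z\<in>car HS. (\<forall>X\<in>car HS. add HS Z X = X) \<and> (\<forall>X\<in>car HS. \<exists>Y\<in>car HS. add HS X Y = Z)"
  proof (intro bexI conjI)
    show "\<forall>X\<in>car HS. add HS (vhat U H z) X = X" unfolding HS_ball by (simp add: add_HS z zero)
    show "\<forall>X\<in>car HS. \<exists>Y\<in>car HS. add HS X Y = vhat U H z"
      unfolding HS_ball
    proof
      fix x assume "x \<in> fin"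
      then show "\<exists>Y\<in>car HS. add HS (vhat U H x) Y = vhat U H z"
        by (intro bexI[of _ "vhat U H (hscl (-1) x)"]) (simp_all add: add_HS iscl_fin inverse vhat_HS)
    qed
  qed (rule vhat_HS[OF z])
  show ?thesis
    unfolding complex_vector_space_on_def
    apply (intro conjI ex)
    unfolding HS_ball
    by (simp_all add: add_HS scl_HS iadd_fin iscl_fin vhat_HS one ss sl sr assoc) (simp add: comm)
qed

lemma HS_inner_product_space: "inner_product_space_on HS"
proof -
  have 1: "li (iadd U H x y) z = li x z + li y z" if "x \<in> fin" "y \<in> fin" "z \<in> fin" for x y z
  proof (rule li_eqI)
    have "\<forall>\<^sub>F g in FF. inn (Sp g) (g x) (g z) + inn (Sp g) (g y) (g z) = inn (Sp g) (g (iadd U H x y)) (g z)"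
      using eventually_ips fin_car[OF that(1)] fin_car[OF that(2)] fin_car[OF that(3)]
        iadd_spec(2)[OF fin_ivec[OF that(1)] fin_ivec[OF that(2)]]
      by eventually_elim (simp add: inner_product_space.inn_add)
    from Lim_transform_eventually[OF tendsto_add[OF li_tendsto[OF that(1,3)] li_tendsto[OF that(2,3)]] this]
    show "((\<lambda>g. inn (Sp g) (g (iadd U H x y)) (g z)) \<longlongrightarrow> li x z + li y z) FF" .
  qed
  have 2: "li (hscl c x) y = c * li x y" if "x \<in> fin" "y \<in> fin" for c x y
  proof (rule li_eqI)
    have "\<forall>\<^sub>F g in FF. c * inn (Sp g) (g x) (g y) = inn (Sp g) (g (hscl c x)) (g y)"
      using eventually_ips fin_car[OF that(1)] fin_car[OF that(2)] iscl_spec(2)[OF fin_ivec[OF that(1)], of c]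
      by eventually_elim (simp add: inner_product_space.inn_scl)
    from Lim_transform_eventually[OF tendsto_mult_left[OF li_tendsto[OF that]] this]
    show "((\<lambda>g. inn (Sp g) (g (hscl c x)) (g y)) \<longlongrightarrow> c * li x y) FF" .
  qed
  have 3: "li y x = cnj (li x y)" if "x \<in> fin" "y \<in> fin" for x y
  proof (rule li_eqI)
    have "\<forall>\<^sub>F g in FF. cnj (inn (Sp g) (g x) (g y)) = inn (Sp g) (g y) (g x)"
      using eventually_ips fin_car[OF that(1)] fin_car[OF that(2)]
      by eventually_elim (rule inner_product_space.inn_cnj[symmetric])
    from Lim_transform_eventually[OF tendsto_cnj[OF li_tendsto[OF that]] this]
    show "((\<lambda>g. inn (Sp g) (g y) (g x)) \<longlongrightarrow> cnj (li x y)) FF" .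
  qed
  have 4: "0 \<le> Re (li x x)" if "x \<in> fin" for x
  proof (rule tendsto_lowerbound[OF tendsto_Re[OF li_tendsto[OF that that]] _ FF_nonbot])
    show "\<forall>\<^sub>F g in FF. 0 \<le> Re (inn (Sp g) (g x) (g x))"
      using eventually_ips fin_car[OF that] by eventually_elim (rule inner_product_space.inn_nonneg)
  qed
  have 5: "li x x \<in> \<real>" if "x \<in> fin" for x
    using 3[OF that that] by (simp add: complex_is_Real_iff complex_eq_iff)
  \<comment> \<open>Definiteness: \<open>x\<close> plus \<open>-1\<close> times \<open>x\<close> is
    the internal zero vector, so its distance from \<open>x\<close> is the norm of \<open>x\<close>,
    which is infinitesimal.\<close>
  have 6: "vhat U H x = hsub HS (vhat U H x) (vhat U H x)" if x: "x \<in> fin" "li x x = 0" for x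
  proof -
    note s = iscl_spec[OF fin_ivec[OF x(1)], of "-1"] and a = iadd_spec[OF fin_ivec[OF x(1)] fin_ivec[OF iscl_fin[OF x(1)]], of "-1"]
    have "near x (iadd U H x (hscl (-1) x))"
    proof (rule near_bound[OF fin_ivec[OF x(1)] a(1)])
      show "\<forall>\<^sub>F g in FF. hnorm (Sp g) (hsub (Sp g) (g x) (g (iadd U H x (hscl (-1) x)))) \<le>
          sqrt (Re (inn (Sp g) (g x) (g x)))"
        using eventually_ips fin_car[OF x(1)] s(2) a(2)
      proof eventually_elim
        case (elim g)
        interpret inner_product_space "Sp g" by (rule elim(1))
        have "hsub (Sp g) (g x) (g (iadd U H x (hscl (-1) x))) = g x"
          by (rule eqI) (use elim(2-4) in auto)
        then show ?case by (simp add: hnorm_def)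
      qed
      show "((\<lambda>g. sqrt (Re (inn (Sp g) (g x) (g x)))) \<longlongrightarrow> 0) FF"
        using tendsto_real_sqrt[OF tendsto_Re[OF li_tendsto[OF x(1) x(1)]]] x(2) by simp
    qed
    note n = this
    have hs: "hsub HS (vhat U H x) (vhat U H x) = vhat U H (iadd U H x (hscl (-1) x))"
      unfolding hsub_def scl_HS[OF x(1)] by (rule add_HS[OF x(1) iscl_fin[OF x(1)]])
    show ?thesis unfolding hs vhat_eq_iff[OF fin_ivec[OF x(1)] a(1)] by (rule n)
  qed
  have "\<forall>X\<in>car HS. \<forall>Y\<in>car HS. \<forall>Z\<in>car HS. inn HS (add HS X Y) Z = inn HS X Z + inn HS Y Z"
    unfolding HS_ball by (simp add: add_HS inn_HS iadd_fin 1)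
  moreover have "\<forall>c. \<forall>X\<in>car HS. \<forall>Y\<in>car HS. inn HS (scl HS c X) Y = c * inn HS X Y"
    unfolding HS_ball by (simp add: scl_HS inn_HS iscl_fin 2)
  moreover have "\<forall>X\<in>car HS. \<forall>Y\<in>car HS. inn HS Y X = cnj (inn HS X Y)"
    unfolding HS_ball
  proof (intro ballI)
    fix x y assume xy: "x \<in> fin" "y \<in> fin"
    show "inn HS (vhat U H y) (vhat U H x) = cnj (inn HS (vhat U H x) (vhat U H y))"
      unfolding inn_HS[OF xy] inn_HS[OF xy(2,1)] by (rule 3[OF xy])
  qed
  moreover have "\<forall>X\<in>car HS. inn HS X X \<in> \<real> \<and> 0 \<le> Re (inn HS X X)"
    unfolding HS_ball by (simp add: inn_HS 4 5)
  moreover have "\<forall>X\<in>car HS. inn HS X X = 0 \<longrightarrow> X = hsub HS X X"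
    unfolding HS_ball
  proof (intro ballI impI)
    fix x assume x: "x \<in> fin" "inn HS (vhat U H x) (vhat U H x) = 0"
    show "vhat U H x = hsub HS (vhat U H x) (vhat U H x)"
      by (rule 6[OF x(1) x(2)[unfolded inn_HS[OF x(1) x(1)]]])
  qed
  ultimately show ?thesis
    unfolding inner_product_space_on_def using HS_vector_space by (intro conjI)
qed

end

sublocale internal_hilbert \<subseteq> hull: inner_product_space "hull_space U H"
  by unfold_locales (rule HS_inner_product_space)

context internal_hilbert
begin

section \<open>Norm and completeness of the hull\<close>

lemma hnorm_HS_tendsto:
  assumes "x \<in> fin"
  shows "((\<lambda>g. hnorm (Sp g) (g x)) \<longlongrightarrow> hnorm HS (vhat U H x)) FF"
  using tendsto_real_sqrt[OF tendsto_Re[OF li_tendsto[OF assms assms]]]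
  by (simp add: hnorm_def inn_HS assms)

lemma isub_fin:
  assumes "x \<in> fin" "y \<in> fin" shows "isub U H x y \<in> fin"
proof -
  obtain B where B: "\<forall>\<^sub>F g in FF. hnorm (Sp g) (g x) \<le> B" using finE[OF assms(1)] by blast
  obtain C where C: "\<forall>\<^sub>F g in FF. hnorm (Sp g) (g y) \<le> C" using finE[OF assms(2)] by blast
  note a = isub_spec[OF fin_ivec fin_ivec, OF assms]
  have "\<forall>\<^sub>F g in FF. hnorm (Sp g) (g (isub U H x y)) \<le> B + C"
    using eventually_ips B C fin_car[OF assms(1)] fin_car[OF assms(2)] a(2)
  proof eventually_elim
    case (elim g)
    show ?case using inner_product_space.hnorm_hsub_le[OF elim(1,4,5)] elim(2,3,6) by simp
  qed
  then show ?thesis by (rule finI[OF a(1)])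
qed

lemma hsub_HS:
  assumes "x \<in> fin" "y \<in> fin"
  shows "hsub HS (vhat U H x) (vhat U H y) = vhat U H (isub U H x y)"
proof -
  have "iadd U H x (hscl (-1) y) = isub U H x y"
    using iscl_spec(2)[OF fin_ivec[OF assms(2)], of "-1"] isub_spec(2)[OF fin_ivec[OF assms(1)] fin_ivec[OF assms(2)]]
      iadd_spec(2)[OF fin_ivec[OF assms(1)] fin_ivec[OF iscl_fin[OF assms(2)]], of "-1"]
    by (intro ivec_eqI fin_ivec iadd_fin iscl_fin isub_fin assms, eventually_elim) (simp add: hsub_def)
  then show ?thesis by (simp add: hsub_def scl_HS add_HS assms iscl_fin)
qed

lemma hnorm_hsub_HS_tendsto:
  assumes "x \<in> fin" "y \<in> fin"
  shows "((\<lambda>g. hnorm (Sp g) (hsub (Sp g) (g x) (g y))) \<longlongrightarrow>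
    hnorm HS (hsub HS (vhat U H x) (vhat U H y))) FF"
proof -
  have "\<forall>\<^sub>F g in FF. hnorm (Sp g) (g (isub U H x y)) = hnorm (Sp g) (hsub (Sp g) (g x) (g y))"
    using isub_spec(2)[OF fin_ivec[OF assms(1)] fin_ivec[OF assms(2)]] by eventually_elim simp
  from Lim_transform_eventually[OF hnorm_HS_tendsto[OF isub_fin[OF assms]] this]
  show ?thesis by (simp add: hsub_HS assms)
qed

text \<open>From index \<open>N j\<close> on, all terms are within \<open>1 / (j + 1)\<close> of
  each other. A representative \<open>y\<close> of the limit has to be within
  \<open>1 / (j + 1)\<close> of a representative of the term \<open>N j\<close> for every
  \<open>j\<close>; these are countably many conditions, to be met simultaneously by
  saturation.\<close>

lemma HS_Cauchy_convergent:
  assumes X: "\<And>n::nat. X n \<in> car HS"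
    and Cauchy: "\<And>e. 0 < e \<Longrightarrow> \<exists>N. \<forall>m\<ge>N. \<forall>n\<ge>N. hnorm HS (hsub HS (X m) (X n)) < e"
  shows "\<exists>Y\<in>car HS. (\<lambda>n. hnorm HS (hsub HS (X n) Y)) \<longlonglongrightarrow> 0"
proof -
  have "\<exists>N. \<forall>j. \<forall>m\<ge>N j. \<forall>n\<ge>N j. hnorm HS (hsub HS (X m) (X n)) < 1 / real (Suc j)"
    using Cauchy[of "1 / real (Suc j)" for j] by (intro choice allI) simp
  then obtain N where N: "\<And>j m n. m \<ge> N j \<Longrightarrow> n \<ge> N j \<Longrightarrow> hnorm HS (hsub HS (X m) (X n)) < 1 / real (Suc j)"
    by blast
  have "\<exists>x. \<forall>n. x n \<in> fin \<and> X n = vhat U H (x n)"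
    using X by (intro choice allI) (auto simp: car_HS)
  then obtain x where x: "\<And>n. x n \<in> fin" "\<And>n. X n = vhat U H (x n)" by blast
  let ?P = "\<lambda>(j::nat) us y. y \<in> car (sp (us ! 0)) \<and>
      hnorm (sp (us ! 0)) (hsub (sp (us ! 0)) (us ! 1) y) < 1 / real (Suc j)"
  have "\<exists>y\<in>D. \<forall>j. \<forall>\<^sub>F g in FF. ?P j (map g [H, x (N j)]) (g y)"
  proof (rule saturated_list[where a = 2])
    show "\<exists>y\<in>D. \<forall>j\<le>J. \<forall>\<^sub>F g in FF. g y \<in> level U (k + 4) \<and> ?P j (map g [H, x (N j)]) (g y)" for J
    proof (intro bexI allI impI)
      \<comment> \<open>A term beyond all of \<open>N 0\<close>, ..., \<open>N J\<close> meets the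
        conditions up to \<open>J\<close>.\<close>
      define n where "n = Max (N ` {..J})"
      show "x n \<in> D" using x(1) fin_ivec ivec_D by blast
      fix j assume "j \<le> J"
      then have n: "N j \<le> n" by (simp add: n_def)
      have "hnorm HS (hsub HS (vhat U H (x (N j))) (vhat U H (x n))) < 1 / real (Suc j)"
        using N[of j "N j" n] n x(2) by simp
      from order_tendstoD(2)[OF hnorm_hsub_HS_tendsto[OF x(1) x(1)] this]
      have "\<forall>\<^sub>F g in FF. hnorm (Sp g) (hsub (Sp g) (g (x (N j))) (g (x n))) < 1 / real (Suc j)" .
      then show "\<forall>\<^sub>F g in FF. g (x n) \<in> level U (k + 4) \<and> ?P j (map g [H, x (N j)]) (g (x n))"
        using eventually_K fin_car[OF x(1), of n]
      proof eventually_elim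
        case (elim g)
        then show ?case using sp_level[OF elim(2)] level_mono[of k "k + 4"] by auto
      qed
    qed
  qed (use x fin_ivec ivec_D H_D in \<open>auto simp: arity_def\<close>)
  then obtain y where y: "y \<in> D" "\<And>j. \<forall>\<^sub>F g in FF. g y \<in> car (Sp g)"
      "\<And>j. \<forall>\<^sub>F g in FF. hnorm (Sp g) (hsub (Sp g) (g (x (N j))) (g y)) < 1 / real (Suc j)"
    by (auto simp: eventually_conj_iff)
  have yv: "y \<in> ivec U H" using y(1,2) by (simp add: ivec_iff)
  \<comment> \<open>The condition for \<open>j = 0\<close> puts \<open>y\<close> within distance 1
    of a finite vector.\<close>
  obtain B where B: "\<forall>\<^sub>F g in FF. hnorm (Sp g) (g (x (N 0))) \<le> B" using finE[OF x(1)] by blast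
  have "\<forall>\<^sub>F g in FF. hnorm (Sp g) (g y) \<le> 1 + B"
    using eventually_ips B fin_car[OF x(1), of "N 0"] ivec_car[OF yv] y(3)[of 0]
  proof eventually_elim
    case (elim g)
    interpret inner_product_space "Sp g" by (rule elim(1))
    show ?case using hnorm_le_hsub[OF elim(4,3)] hnorm_hsub_commute[OF elim(4,3)] elim(2,5) by simp
  qed
  then have yf: "y \<in> fin" by (rule finI[OF yv])
  have le: "hnorm HS (hsub HS (X (N j)) (vhat U H y)) \<le> 1 / real (Suc j)" for j
    unfolding x(2)
    by (rule tendsto_upperbound[OF hnorm_hsub_HS_tendsto[OF x(1) yf] _ FF_nonbot])
      (rule eventually_mono[OF y(3)[of j]], simp)
  have Y: "vhat U H y \<in> car HS" by (rule vhat_HS[OF yf])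
  have "(\<lambda>n. hnorm HS (hsub HS (X n) (vhat U H y))) \<longlonglongrightarrow> 0"
  proof (rule LIMSEQ_I)
    fix e :: real assume "0 < e"
    then obtain j where j: "inverse (real (Suc j)) < e / 2" using reals_Archimedean[of "e / 2"] by auto
    have "norm (hnorm HS (hsub HS (X n) (vhat U H y)) - 0) < e" if "n \<ge> N j" for n
    proof -
      have "hnorm HS (hsub HS (X n) (vhat U H y)) \<le>
          hnorm HS (hsub HS (X n) (X (N j))) + hnorm HS (hsub HS (X (N j)) (vhat U H y))"
        by (rule hull.hnorm_hsub_triangle[OF X X Y])
      also have "\<dots> < 1 / real (Suc j) + 1 / real (Suc j)"
        using N[of j n "N j"] that le[of j] by simp
      also have "\<dots> < e" using j by (simp add: inverse_eq_divide)
      finally show ?thesis using X Y by simp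
    qed
    then show "\<exists>no. \<forall>n\<ge>no. norm (hnorm HS (hsub HS (X n) (vhat U H y)) - 0) < e" by blast
  qed
  then show ?thesis using Y by blast
qed

end

section \<open>Operators on the hull\<close>

context internal_hilbert
begin

definition op_fin :: "'v set" where
  "op_fin = {a \<in> iops U H. \<exists>B. \<forall>\<^sub>F g in FF. op_norm (Sp g) (opg g a) \<le> B}"

lemma op_fin_iops: "a \<in> op_fin \<Longrightarrow> a \<in> iops U H"
  by (simp add: op_fin_def)

lemma op_finI: "a \<in> iops U H \<Longrightarrow> \<forall>\<^sub>F g in FF. op_norm (Sp g) (opg g a) \<le> B \<Longrightarrow> a \<in> op_fin"
  by (auto simp: op_fin_def)

lemma op_finE:
  assumes "a \<in> op_fin"
  obtains B where "0 \<le> B" "\<forall>\<^sub>F g in FF. op_norm (Sp g) (opg g a) \<le> B"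
proof -
  obtain B where B: "\<forall>\<^sub>F g in FF. op_norm (Sp g) (opg g a) \<le> B" using assms by (auto simp: op_fin_def)
  show ?thesis
    by (rule that[of "\<bar>B\<bar>"]) (auto intro: eventually_mono[OF B])
qed

lemma eventually_bounded_op:
  "a \<in> iops U H \<Longrightarrow> \<forall>\<^sub>F g in FF. opg g a \<in> bounded_ops (Sp g)"
  using iops_op[of a] by (auto elim: eventually_mono is_op_bounded)

lemma hfinite_iopnorm:
  assumes "a \<in> iops U H"
  shows "hfinite U (iopnorm U H a) \<longleftrightarrow> a \<in> op_fin"
proof -
  have "hfinite U (iopnorm U H a) \<longleftrightarrow> (\<exists>B. \<forall>\<^sub>F g in FF. cmod (complex_of_real (op_norm (Sp g) (opg g a))) \<le> B)"
    by (rule hfinite_iff[OF iopnorm_spec[OF assms]])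
  also have "\<dots> \<longleftrightarrow> (\<exists>B. \<forall>\<^sub>F g in FF. op_norm (Sp g) (opg g a) \<le> B)"
  proof -
    have "(\<forall>\<^sub>F g in FF. cmod (complex_of_real (op_norm (Sp g) (opg g a))) \<le> B) \<longleftrightarrow>
        (\<forall>\<^sub>F g in FF. op_norm (Sp g) (opg g a) \<le> B)" for B
    proof (rule eventually_subst)
      show "\<forall>\<^sub>F g in FF. (cmod (complex_of_real (op_norm (Sp g) (opg g a))) \<le> B) = (op_norm (Sp g) (opg g a) \<le> B)"
        using eventually_ips eventually_bounded_op[OF assms]
        by eventually_elim (simp add: inner_product_space.op_norm_nonneg)
    qed
    then show ?thesis by simp
  qed
  finally show ?thesis using assms by (simp add: op_fin_def)
qed

definition ohat :: "'v \<Rightarrow> 'v set" where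
  "ohat a = hat U (iops U H) (iopnorm U H) (iopsub U H) a"

lemma ohat_iff:
  assumes "a \<in> iops U H"
  shows "b \<in> ohat a \<longleftrightarrow> b \<in> iops U H \<and>
    ((\<lambda>g. op_norm (Sp g) (op_sub (Sp g) (opg g b) (opg g a))) \<longlongrightarrow> 0) FF"
proof (cases "b \<in> iops U H")
  case True
  note s = iopsub_spec[OF True assms]
  have "\<forall>\<^sub>F g in FF. g (iopnorm U H (iopsub U H b a)) = rl U (op_norm (Sp g) (op_sub (Sp g) (opg g b) (opg g a)))"
    using iopnorm_spec(2)[OF s(1)] s(2) by eventually_elim simp
  from happrox_iff[OF iopnorm_spec(1)[OF s(1)] this, of 0]
  show ?thesis
    using True tendsto_of_real_iff[where c = "0 :: real" and 'a = complex] by (simp add: ohat_def hat_def)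
qed (simp add: ohat_def hat_def)

lemma ohat_self: "a \<in> iops U H \<Longrightarrow> a \<in> ohat a"
proof -
  assume a: "a \<in> iops U H"
  have "\<forall>\<^sub>F g in FF. op_norm (Sp g) (op_sub (Sp g) (opg g a) (opg g a)) = 0"
    using eventually_ips eventually_bounded_op[OF a]
  proof eventually_elim
    case (elim g)
    interpret inner_product_space "Sp g" by (rule elim(1))
    have "op_norm (Sp g) (op_sub (Sp g) (opg g a) (opg g a)) \<le> 0"
      using bounded_opsD(1)[OF elim(2)] ex_zero
      by (intro op_norm_le) (auto simp: op_sub_def hnorm_hsub_self)
    with op_norm_nonneg[OF op_sub_bounded[OF elim(2,2)]] show ?case by simp
  qed
  then show ?thesis using ohat_iff[OF a] a by (simp add: tendsto_eventually)
qed

lemma iapp_fin: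
  assumes "a \<in> op_fin" "x \<in> fin" shows "iapp U H a x \<in> fin"
proof -
  obtain B where B: "0 \<le> B" "\<forall>\<^sub>F g in FF. op_norm (Sp g) (opg g a) \<le> B" using op_finE[OF assms(1)] by blast
  obtain C where C: "\<forall>\<^sub>F g in FF. hnorm (Sp g) (g x) \<le> C" using finE[OF assms(2)] by blast
  note s = iapp_spec[OF op_fin_iops[OF assms(1)] fin_ivec[OF assms(2)]]
  have "\<forall>\<^sub>F g in FF. hnorm (Sp g) (g (iapp U H a x)) \<le> B * C"
    using eventually_ips eventually_bounded_op[OF op_fin_iops[OF assms(1)]] B(2) C fin_car[OF assms(2)] s(2)
  proof eventually_elim
    case (elim g)
    interpret inner_product_space "Sp g" by (rule elim(1))
    show ?case
      using op_norm_bound[OF elim(2,5)] mult_mono[OF elim(3,4) B(1) hnorm_nonneg[OF elim(5)]] elim(6) by simp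
  qed
  then show ?thesis by (rule finI[OF s(1)])
qed

text \<open>The difference splits into \<open>b - a\<close> applied to \<open>y\<close> and
  \<open>a\<close> applied to \<open>y - x\<close>; each part is bounded by an infinitesimal times a
  finite number.\<close>

lemma iapp_near:
  assumes a: "a \<in> op_fin" and b: "b \<in> ohat a" and x: "x \<in> fin" and y: "y \<in> vhat U H x"
  shows "near (iapp U H b y) (iapp U H a x)"
proof -
  have ai: "a \<in> iops U H" by (rule op_fin_iops[OF a])
  have bi: "b \<in> iops U H" and bl: "((\<lambda>g. op_norm (Sp g) (op_sub (Sp g) (opg g b) (opg g a))) \<longlongrightarrow> 0) FF"
    using ohat_iff[OF ai] b by simp_all
  have yf: "y \<in> fin" and yn: "near y x" using vhat_memD[OF x y] by simp_all
  obtain B where B: "0 \<le> B" "\<forall>\<^sub>F g in FF. op_norm (Sp g) (opg g a) \<le> B" using op_finE[OF a] by blast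
  obtain C where C: "0 \<le> C" "\<forall>\<^sub>F g in FF. hnorm (Sp g) (g y) \<le> C" using finE[OF yf] by blast
  note s = iapp_spec[OF bi fin_ivec[OF yf]] and t = iapp_spec[OF ai fin_ivec[OF x]]
  let ?n = "\<lambda>g. op_norm (Sp g) (op_sub (Sp g) (opg g b) (opg g a))"
  let ?d = "\<lambda>g. hnorm (Sp g) (hsub (Sp g) (g y) (g x))"
  show ?thesis
  proof (rule near_bound[OF s(1) t(1)])
    show "\<forall>\<^sub>F g in FF. hnorm (Sp g) (hsub (Sp g) (g (iapp U H b y)) (g (iapp U H a x))) \<le> ?n g * C + B * ?d g"
      using eventually_ips eventually_bounded_op[OF ai] eventually_bounded_op[OF bi] B(2) C(2)
        fin_car[OF x] fin_car[OF yf] s(2) t(2)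
    proof eventually_elim
      case (elim g)
      interpret inner_product_space "Sp g" by (rule elim(1))
      let ?a = "opg g a" and ?b = "opg g b"
      note ca = bounded_opsD(1)[OF elim(2)] and cb = bounded_opsD(1)[OF elim(3)]
      have "hnorm (Sp g) (hsub (Sp g) (?b (g y)) (?a (g y))) \<le> ?n g * hnorm (Sp g) (g y)"
        using op_norm_bound[OF op_sub_bounded[OF elim(3,2)] elim(7)] elim(7) by (simp add: op_sub_def)
      also have "\<dots> \<le> ?n g * C"
        by (rule mult_left_mono[OF elim(5) op_norm_nonneg[OF op_sub_bounded[OF elim(3,2)]]])
      finally have 1: "hnorm (Sp g) (hsub (Sp g) (?b (g y)) (?a (g y))) \<le> ?n g * C" .
      have "hnorm (Sp g) (hsub (Sp g) (?a (g y)) (?a (g x))) \<le> op_norm (Sp g) ?a * ?d g"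
        using op_norm_bound[OF elim(2), of "hsub (Sp g) (g y) (g x)"] bounded_ops_hsub[OF elim(2,7,6)] elim(6,7)
        by simp
      also have "\<dots> \<le> B * ?d g" using elim(4,6,7) by (simp add: mult_right_mono)
      finally have 2: "hnorm (Sp g) (hsub (Sp g) (?a (g y)) (?a (g x))) \<le> B * ?d g" .
      show ?case
        using hnorm_hsub_triangle[OF cb[OF elim(7)] ca[OF elim(7)] ca[OF elim(6)]] 1 2 elim(8,9) by simp
    qed
    show "((\<lambda>g. ?n g * C + B * ?d g) \<longlongrightarrow> 0) FF"
      using tendsto_add[OF tendsto_mult_left_zero[OF bl, of C]
        tendsto_mult_right_zero[OF yn[unfolded near_def], of B]] by simp
  qed
qed

section \<open>Internal operators acting on the hull\<close>

definition rep :: "'v \<Rightarrow> 'v set \<Rightarrow> 'v set" where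
  "rep a = hull_rep U H (ohat a)"

lemma hull_algebra_eq: "hull_algebra U H = rep ` op_fin"
proof -
  have "{x \<in> iops U H. hfinite U (iopnorm U H x)} = op_fin"
    using hfinite_iopnorm op_fin_iops by blast
  then show ?thesis by (simp add: hull_algebra_def hull_ops_def ns_hull_def image_image rep_def ohat_def)
qed

lemma rep_vhat:
  assumes a: "a \<in> op_fin" and x: "x \<in> fin"
  shows "rep a (vhat U H x) = vhat U H (iapp U H a x)"
proof -
  have "vhat U H (iapp U H b y) = vhat U H (iapp U H a x)" if "b \<in> ohat a" "y \<in> vhat U H x" for b y
  proof -
    have "b \<in> iops U H" using that(1) ohat_iff[OF op_fin_iops[OF a]] by simp
    moreover have "y \<in> ivec U H" using vhat_memD[OF x that(2)] fin_ivec by simp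
    ultimately show ?thesis
      using vhat_eq_iff iapp_spec(1) iapp_near[OF a that(1) x that(2)] op_fin_iops[OF a] fin_ivec[OF x] by simp
  qed
  moreover have "a \<in> ohat a" "x \<in> vhat U H x"
    using ohat_self[OF op_fin_iops[OF a]] vhat_self[OF fin_ivec[OF x]] by simp_all
  ultimately have "(THE Y. \<exists>b\<in>ohat a. \<exists>y\<in>vhat U H x. Y = vhat U H (iapp U H b y)) = vhat U H (iapp U H a x)"
    by (intro the_equality) blast+
  then show ?thesis unfolding rep_def hull_rep_def by (simp add: vhat_HS x)
qed

lemma rep_bounded:
  assumes a: "a \<in> op_fin"
  shows "rep a \<in> bounded_ops HS"
proof -
  note ai = op_fin_iops[OF a]
  obtain B where B: "0 \<le> B" "\<forall>\<^sub>F g in FF. op_norm (Sp g) (opg g a) \<le> B" using op_finE[OF a] by blast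
  have ext: "rep a \<in> extensional (car HS)" by (simp add: rep_def hull_rep_def)
  have cl: "rep a X \<in> car HS" if "X \<in> car HS" for X
    using that by (auto simp: car_HS rep_vhat[OF a] iapp_fin[OF a])
  have add: "iapp U H a (iadd U H x y) = iadd U H (iapp U H a x) (iapp U H a y)" if "x \<in> fin" "y \<in> fin" for x y
    using eventually_bounded_op[OF ai] eventually_ips fin_car[OF that(1)] fin_car[OF that(2)]
      iadd_spec(2)[OF fin_ivec[OF that(1)] fin_ivec[OF that(2)]]
      iadd_spec(2)[OF fin_ivec[OF iapp_fin[OF a that(1)]] fin_ivec[OF iapp_fin[OF a that(2)]]]
      iapp_spec(2)[OF ai fin_ivec[OF that(1)]] iapp_spec(2)[OF ai fin_ivec[OF that(2)]]
      iapp_spec(2)[OF ai fin_ivec[OF iadd_fin[OF that]]]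
    by (intro ivec_eqI fin_ivec iapp_fin[OF a] iadd_fin that, eventually_elim)
      (simp add: inner_product_space.bounded_opsD(2))
  have scl: "iapp U H a (hscl c x) = hscl c (iapp U H a x)" if "x \<in> fin" for c x
    using eventually_bounded_op[OF ai] eventually_ips fin_car[OF that(1)]
      iscl_spec(2)[OF fin_ivec[OF that], of c] iscl_spec(2)[OF fin_ivec[OF iapp_fin[OF a that]], of c]
      iapp_spec(2)[OF ai fin_ivec[OF that]] iapp_spec(2)[OF ai fin_ivec[OF iscl_fin[OF that]], of c]
    by (intro ivec_eqI fin_ivec iapp_fin[OF a] iscl_fin that, eventually_elim)
      (simp add: inner_product_space.bounded_opsD(3))
  have bd: "hnorm HS (vhat U H (iapp U H a x)) \<le> B * hnorm HS (vhat U H x)" if x: "x \<in> fin" for x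
  proof (rule tendsto_le[OF FF_nonbot tendsto_mult_left[OF hnorm_HS_tendsto[OF x]] hnorm_HS_tendsto[OF iapp_fin[OF a x]]])
    show "\<forall>\<^sub>F g in FF. hnorm (Sp g) (g (iapp U H a x)) \<le> B * hnorm (Sp g) (g x)"
      using eventually_ips eventually_bounded_op[OF ai] B(2) fin_car[OF x] iapp_spec(2)[OF ai fin_ivec[OF x]]
    proof eventually_elim
      case (elim g)
      interpret inner_product_space "Sp g" by (rule elim(1))
      show ?case
        using op_norm_bound[OF elim(2,4)] mult_right_mono[OF elim(3) hnorm_nonneg[OF elim(4)]] elim(5) by simp
    qed
  qed
  have "\<forall>X\<in>car HS. \<forall>Y\<in>car HS. rep a (add HS X Y) = add HS (rep a X) (rep a Y)"
    unfolding HS_ball by (simp add: add_HS rep_vhat[OF a] iapp_fin[OF a] iadd_fin add)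
  moreover have "\<forall>c. \<forall>X\<in>car HS. rep a (scl HS c X) = scl HS c (rep a X)"
    unfolding HS_ball by (simp add: scl_HS rep_vhat[OF a] iapp_fin[OF a] iscl_fin scl)
  moreover have "\<forall>X\<in>car HS. hnorm HS (rep a X) \<le> B * hnorm HS X"
    unfolding HS_ball by (simp add: rep_vhat[OF a] bd)
  ultimately show ?thesis
    unfolding bounded_ops_def using ext cl by (auto simp: PiE_def)
qed

lemma rep_zero: "\<exists>a\<in>op_fin. \<forall>X\<in>car HS. rep a X = scl HS 0 X"
proof -
  have "\<forall>\<^sub>F g in FF. \<exists>t\<in>M. is_op (g H) t \<and> opf (g H) t = (\<lambda>x\<in>car (Sp g). scl (Sp g) 0 x)"
    using eventually_K
  proof eventually_elim
    case (elim g)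
    note z = inner_product_space.zero_op_bounded[OF sp_ips[OF elim]]
    show ?case
      using is_op_op_code[OF elim z] opf_op_code[OF elim z] is_op_M[OF elim] by blast
  qed
  from choice1[OF H_D, of "\<lambda>q t. is_op q t \<and> opf q t = (\<lambda>x\<in>car (sp q). scl (sp q) 0 x)", OF this] obtain a where a: "a \<in> D"
    "\<forall>\<^sub>F g in FF. is_op (g H) (g a) \<and> opg g a = (\<lambda>x\<in>car (Sp g). scl (Sp g) 0 x)" by blast
  have ai: "a \<in> iops U H" using a by (auto simp: iops_iff elim: eventually_mono)
  have "\<forall>\<^sub>F g in FF. op_norm (Sp g) (opg g a) \<le> 0"
    using eventually_ips a(2)
  proof eventually_elim
    case (elim g)
    interpret inner_product_space "Sp g" by (rule elim(1))
    show ?case using elim(2) ex_zero by (intro op_norm_le) auto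
  qed
  then have af: "a \<in> op_fin" by (rule op_finI[OF ai])
  have "iapp U H a x = hscl 0 x" if x: "x \<in> fin" for x
    using a(2) fin_car[OF x] iscl_spec(2)[OF fin_ivec[OF x], of 0] iapp_spec(2)[OF ai fin_ivec[OF x]]
    by (intro ivec_eqI fin_ivec iapp_fin[OF af] iscl_fin x, eventually_elim) simp
  then have "\<forall>X\<in>car HS. rep a X = scl HS 0 X"
    unfolding HS_ball by (simp add: rep_vhat[OF af] scl_HS)
  then show ?thesis using af by blast
qed

text \<open>The internal operator multiplies \<open>w\<close> by the internal inner product of
  \<open>x\<close> and \<open>f\<close>, the operator on the hull by its standard part. The error is
  the infinitesimal difference of the two numbers times the finite norm of \<open>w\<close>.\<close>

lemma rep_upd:
  assumes a: "a \<in> op_fin" and f: "f \<in> fin" and w: "w \<in> fin"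
  shows "\<exists>b\<in>op_fin. \<forall>X\<in>car HS.
    rep b X = add HS (rep a X) (scl HS (inn HS X (vhat U H f)) (vhat U H w))"
proof -
  note ai = op_fin_iops[OF a]
  have "\<forall>\<^sub>F g in FF. \<exists>t\<in>M. is_op (g H) t \<and>
      opf (g H) t = inner_product_space.op_upd (Sp g) (opg g a) (g f) (g w)"
    using eventually_K eventually_bounded_op[OF ai] fin_car[OF f] fin_car[OF w]
  proof eventually_elim
    case (elim g)
    note z = inner_product_space.op_upd_bounded[OF sp_ips[OF elim(1)] elim(2-4)]
    show ?case
      using is_op_op_code[OF elim(1) z] opf_op_code[OF elim(1) z] is_op_M[OF elim(1)] by blast
  qed
  from choice4[OF H_D iops_D[OF ai] ivec_D[OF fin_ivec[OF f]] ivec_D[OF fin_ivec[OF w]], of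
      "\<lambda>q a f w t. is_op q t \<and> opf q t = inner_product_space.op_upd (sp q) (opf q a) f w", OF this]
  obtain b where b: "b \<in> D" "\<forall>\<^sub>F g in FF. is_op (g H) (g b) \<and>
      opg g b = inner_product_space.op_upd (Sp g) (opg g a) (g f) (g w)" by blast
  have bi: "b \<in> iops U H" using b by (auto simp: iops_iff elim: eventually_mono)
  obtain A where A: "0 \<le> A" "\<forall>\<^sub>F g in FF. op_norm (Sp g) (opg g a) \<le> A" using op_finE[OF a] by blast
  obtain B where B: "0 \<le> B" "\<forall>\<^sub>F g in FF. hnorm (Sp g) (g f) \<le> B" using finE[OF f] by blast
  obtain C where C: "0 \<le> C" "\<forall>\<^sub>F g in FF. hnorm (Sp g) (g w) \<le> C" using finE[OF w] by blast
  have "\<forall>\<^sub>F g in FF. op_norm (Sp g) (opg g b) \<le> A + B * C"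
    using eventually_ips b(2) eventually_bounded_op[OF ai] A(2) B(2) C(2) fin_car[OF f] fin_car[OF w]
  proof eventually_elim
    case (elim g)
    interpret inner_product_space "Sp g" by (rule elim(1))
    have "hnorm (Sp g) (g f) * hnorm (Sp g) (g w) \<le> B * C"
      by (rule mult_mono[OF elim(5,6) B(1) hnorm_nonneg[OF elim(8)]])
    then have le: "op_norm (Sp g) (opg g a) + hnorm (Sp g) (g f) * hnorm (Sp g) (g w) \<le> A + B * C"
      using elim(4) by linarith
    show ?case
    proof (rule op_norm_le)
      fix x assume x: "x \<in> car (Sp g)"
      have "hnorm (Sp g) (op_upd (opg g a) (g f) (g w) x) \<le>
          (op_norm (Sp g) (opg g a) + hnorm (Sp g) (g f) * hnorm (Sp g) (g w)) * hnorm (Sp g) x"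
        using op_upd_bound[where T = "opg g a" and x = x, OF x bounded_opsD(1)[OF elim(3) x] elim(7,8) op_norm_bound[OF elim(3) x]] .
      also have "\<dots> \<le> (A + B * C) * hnorm (Sp g) x" by (rule mult_right_mono[OF le hnorm_nonneg[OF x]])
      finally show "hnorm (Sp g) (opg g b x) \<le> (A + B * C) * hnorm (Sp g) x" using elim(2) by simp
    qed (use ex_zero A(1) B(1) C(1) in auto)
  qed
  then have bf: "b \<in> op_fin" by (rule op_finI[OF bi])
  have "vhat U H (iapp U H b x) = add HS (vhat U H (iapp U H a x)) (scl HS (li x f) (vhat U H w))"
    if x: "x \<in> fin" for x
  proof -
    let ?c = "li x f"
    note xa = iapp_fin[OF a x] and xb = iapp_fin[OF bf x] and cw = iscl_fin[OF w, of ?c]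
    have "near (iapp U H b x) (iadd U H (iapp U H a x) (hscl ?c w))"
    proof (rule near_bound[OF fin_ivec[OF xb] fin_ivec[OF iadd_fin[OF xa cw]]])
      show "\<forall>\<^sub>F g in FF. hnorm (Sp g) (hsub (Sp g) (g (iapp U H b x)) (g (iadd U H (iapp U H a x) (hscl ?c w)))) \<le>
          cmod (inn (Sp g) (g x) (g f) - ?c) * C"
        using eventually_ips b(2) C(2) fin_car[OF x] fin_car[OF f] fin_car[OF w] eventually_bounded_op[OF ai]
          iapp_spec(2)[OF bi fin_ivec[OF x]] iapp_spec(2)[OF ai fin_ivec[OF x]]
          iscl_spec(2)[OF fin_ivec[OF w], of ?c] iadd_spec(2)[OF fin_ivec[OF xa] fin_ivec[OF cw]]
      proof eventually_elim
        case (elim g)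
        interpret inner_product_space "Sp g" by (rule elim(1))
        note ax = bounded_opsD(1)[OF elim(7,4)]
        let ?u = "add (Sp g) (opg g a (g x)) (scl (Sp g) (inn (Sp g) (g x) (g f)) (g w))"
        let ?v = "add (Sp g) (opg g a (g x)) (scl (Sp g) ?c (g w))"
        have "hsub (Sp g) ?u ?v = scl (Sp g) (inn (Sp g) (g x) (g f) - ?c) (g w)"
          by (rule eqI) (use elim(4-6) ax in \<open>auto simp: algebra_simps\<close>)
        then have "hnorm (Sp g) (hsub (Sp g) ?u ?v) = cmod (inn (Sp g) (g x) (g f) - ?c) * hnorm (Sp g) (g w)"
          using elim(6) by simp
        also have "\<dots> \<le> cmod (inn (Sp g) (g x) (g f) - ?c) * C"
          by (rule mult_left_mono[OF elim(3)]) simp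
        finally show ?case using elim(2,4,8-11) by (simp add: op_upd_def)
      qed
      have "((\<lambda>g. inn (Sp g) (g x) (g f) - ?c) \<longlongrightarrow> 0) FF"
        using tendsto_diff[OF li_tendsto[OF x f] tendsto_const[of ?c]] by simp
      from tendsto_mult_left_zero[OF tendsto_norm_zero[OF this], of C]
      show "((\<lambda>g. cmod (inn (Sp g) (g x) (g f) - ?c) * C) \<longlongrightarrow> 0) FF" .
    qed
    then show ?thesis
      using vhat_eq_iff[OF fin_ivec[OF xb] fin_ivec[OF iadd_fin[OF xa cw]]] by (simp add: add_HS scl_HS xa cw w)
  qed
  then have "\<forall>X\<in>car HS. rep b X = add HS (rep a X) (scl HS (inn HS X (vhat U H f)) (vhat U H w))"
    unfolding HS_ball by (simp add: rep_vhat[OF a] rep_vhat[OF bf] inn_HS f)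
  then show ?thesis using bf by blast
qed

end

section \<open>Finite and infinite internal dimension\<close>

context inner_product_space
begin

text \<open>The sum over \<open>i < n\<close> of \<open>inn S x (e i)\<close> times
  \<open>f i\<close>, started at \<open>scl S 0 x\<close> because the record has no zero. With
  \<open>f = e\<close> orthonormal it is the projection onto the span of the first \<open>n\<close>
  vectors.\<close>

primrec fsum :: "(nat \<Rightarrow> 'a) \<Rightarrow> (nat \<Rightarrow> 'a) \<Rightarrow> nat \<Rightarrow> 'a \<Rightarrow> 'a" where
  "fsum e f 0 x = scl S 0 x"
| "fsum e f (Suc n) x = add S (fsum e f n x) (scl S (inn S x (e n)) (f n))"

lemma fsum_closed: "x \<in> car S \<Longrightarrow> (\<And>i. i < n \<Longrightarrow> f i \<in> car S) \<Longrightarrow> fsum e f n x \<in> car S"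
  by (induction n) auto

lemma inn_fsum:
  "x \<in> car S \<Longrightarrow> (\<And>i. i < n \<Longrightarrow> f i \<in> car S) \<Longrightarrow> z \<in> car S \<Longrightarrow>
    inn S (fsum e f n x) z = (\<Sum>i<n. inn S x (e i) * inn S (f i) z)"
  by (induction n) (simp_all add: fsum_closed)

lemma bounded_ops_fsum:
  assumes T: "T \<in> bounded_ops S" and x: "x \<in> car S" and f: "\<And>i. i < n \<Longrightarrow> f i \<in> car S"
  shows "T (fsum e f n x) = fsum e (\<lambda>i. T (f i)) n x"
proof -
  note D = bounded_opsD[OF T]
  have "scl S 0 (T x) = scl S 0 x"
    by (rule eqI) (use x D(1) in auto)
  then show ?thesis
    using f by (induction n) (simp_all add: x D(2,3) fsum_closed)
qed

text \<open>Parseval's identity. The remainder \<open>?z\<close> of the expansion of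
  \<open>x\<close> is orthogonal to the basis; if its norm were not 0, its normalisation would
  extend the basis, against maximality.\<close>

lemma orthonormal_basis_inn:
  fixes b :: "nat \<Rightarrow> 'a"
  assumes B: "orthonormal_basis_on S B" and b: "bij_betw b {..<n} B" and x: "x \<in> car S" and y: "y \<in> car S"
  shows "inn S x y = (\<Sum>i<n. inn S x (b i) * inn S (b i) y)"
proof -
  have on: "orthonormal_on S B" and mx: "\<And>B'. orthonormal_on S B' \<Longrightarrow> B \<subseteq> B' \<Longrightarrow> B' = B"
    using B by (auto simp: orthonormal_basis_on_def)
  have bB: "b i \<in> B" if "i < n" for i using b that by (auto simp: bij_betw_def)
  have bc: "b i \<in> car S" if "i < n" for i using bB[OF that] on by (auto simp: orthonormal_on_def)
  have bi: "inn S (b i) (b j) = (if i = j then 1 else 0)" if "i < n" "j < n" for i j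
    using on bB that bij_betw_imp_inj_on[OF b] by (auto simp: orthonormal_on_def inj_on_def)
  let ?z = "hsub S x (fsum b b n x)"
  have z: "?z \<in> car S" using x bc by (simp add: fsum_closed)
  have zb: "inn S ?z (b j) = 0" if j: "j < n" for j
  proof -
    have "(\<Sum>i<n. inn S x (b i) * inn S (b i) (b j)) = (\<Sum>i<n. if i = j then inn S x (b i) else 0)"
      by (rule sum.cong) (use bi j in auto)
    then show ?thesis using j x bc by (simp add: fsum_closed inn_fsum)
  qed
  have "hnorm S ?z = 0"
  proof (rule ccontr)
    assume nz: "hnorm S ?z \<noteq> 0"
    define u where "u = scl S (complex_of_real (1 / hnorm S ?z)) ?z"
    have u: "u \<in> car S" using z by (simp add: u_def)
    have uu: "inn S u u = 1"
      using z nz by (simp add: u_def inn_self[OF z] power2_eq_square del: inn_hsub inn_hsub_right)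
    have uB: "inn S u v = 0" if "v \<in> B" for v
    proof -
      obtain j where "j < n" "v = b j" using b \<open>v \<in> B\<close> by (auto simp: bij_betw_def)
      then show ?thesis using zb z bc by (simp add: u_def del: inn_hsub)
    qed
    have Bc: "B \<subseteq> car S" using on by (simp add: orthonormal_on_def)
    have "u \<notin> B" using uB[of u] uu by auto
    moreover have "orthonormal_on S (insert u B)"
      unfolding orthonormal_on_def
    proof (intro conjI ballI)
      show "insert u B \<subseteq> car S" using u Bc by simp
      fix v w assume vw: "v \<in> insert u B" "w \<in> insert u B"
      have "inn S w u = 0" if "w \<in> B" for w
        using inn_cnj[OF u, of w] uB[OF that] that Bc by auto
      then show "inn S v w = (if v = w then 1 else 0)"
        using vw uB uu \<open>u \<notin> B\<close> on by (auto simp: orthonormal_on_def)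
    qed
    then have "insert u B = B" using mx by blast
    ultimately show False by blast
  qed
  then have "inn S ?z y = 0" using Cauchy_Schwarz[OF z y] by simp
  then show ?thesis using x y bc by (simp add: fsum_closed inn_fsum)
qed

section \<open>Strong limits of finite-rank projections\<close>

lemma strong_limit_mem:
  assumes A: "closedin (strong_operator_topology S) A" and Q: "\<And>n::nat. Q n \<in> A"
    and P: "P \<in> bounded_ops S" and lim: "\<And>x. x \<in> car S \<Longrightarrow> (\<lambda>n. hnorm S (hsub S (Q n x) (P x))) \<longlonglongrightarrow> 0"
  shows "P \<in> A"
proof -
  interpret Metric_space "car S" "hdist S" by (rule metric)
  have sub: "A \<subseteq> bounded_ops S"
    using closedin_subset[OF A] by (auto simp: strong_operator_topology_def)
  have QB: "Q n \<in> bounded_ops S" for n using Q sub by blast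
  \<comment> \<open>Convergence in the product topology is coordinatewise, which here means norm
    convergence at each vector.\<close>
  have "limitin (strong_operator_topology S) Q P sequentially"
    unfolding strong_operator_topology_def limitin_subtopology limitin_componentwise
  proof (intro conjI ballI)
    show "P \<in> extensional (car S)" by (rule bounded_opsD(4)[OF P])
    show "\<forall>\<^sub>F n in sequentially. Q n \<in> topspace (product_topology (\<lambda>_. mtopology) (car S))"
      using QB by (auto simp: bounded_ops_def)
    fix x assume x: "x \<in> car S"
    show "limitin mtopology (\<lambda>n. Q n x) (P x) sequentially"
      unfolding limit_metric_sequentially
    proof (intro conjI allI impI)
      show "P x \<in> car S" by (rule bounded_opsD(1)[OF P x])
      fix r :: real assume "0 < r"
      then obtain N where "\<forall>n\<ge>N. norm (hnorm S (hsub S (Q n x) (P x)) - 0) < r"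
        using LIMSEQ_D[OF lim[OF x]] by blast
      then show "\<exists>N. \<forall>n\<ge>N. Q n x \<in> car S \<and> hdist S (Q n x) (P x) < r"
        using bounded_opsD(1)[OF QB x] bounded_opsD(1)[OF P x] by (auto simp: hdist_def)
    qed
  qed (use P QB in auto)
  then show ?thesis
    by (rule limitin_closedin[OF _ A]) (use Q in auto)
qed

text \<open>\<open>P\<close> is the projection onto the closed span of the \<open>e n\<close>.
  Bessel's inequality makes the partial expansions of each vector Cauchy, so \<open>P\<close> is
  their pointwise limit. The conclusion records what the contradiction needs: \<open>P\<close> fixes
  every \<open>e n\<close> and annihilates their orthogonal complement.\<close>

lemma projection_in_closure:
  assumes A: "closedin (strong_operator_topology S) A"
    and complete: "\<And>X :: nat \<Rightarrow> 'a. (\<And>n. X n \<in> car S) \<Longrightarrow>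
      (\<And>r. 0 < r \<Longrightarrow> \<exists>N. \<forall>m\<ge>N. \<forall>n\<ge>N. hnorm S (hsub S (X m) (X n)) < r) \<Longrightarrow>
      \<exists>Y\<in>car S. (\<lambda>n. hnorm S (hsub S (X n) Y)) \<longlonglongrightarrow> 0"
    and e: "\<And>n. e n \<in> car S" "\<And>m n. inn S (e m) (e n) = (if m = n then 1 else 0)"
    and Q: "\<And>n. restrict (fsum e e n) (car S) \<in> A"
  shows "\<exists>P\<in>A. (\<forall>n. P (e n) = e n) \<and>
    (\<forall>x\<in>car S. (\<forall>n. inn S x (e n) = 0) \<longrightarrow> hnorm S (P x) = 0)"
proof -
  \<comment> \<open>The squared norm of the \<open>n\<close>-th partial expansion of
    \<open>x\<close>.\<close>
  define s where "s x n = (\<Sum>i<n. (cmod (inn S x (e i)))\<^sup>2)" for x n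
  have qc: "fsum e e n x \<in> car S" if "x \<in> car S" for n x using that e(1) by (simp add: fsum_closed)
  note iq = inn_fsum[where f = e and e = e, OF _ e(1)]
  have qe: "inn S (fsum e e n x) (e j) = (if j < n then inn S x (e j) else 0)" if "x \<in> car S" for n x j
  proof -
    have "inn S (fsum e e n x) (e j) = (\<Sum>i<n. if i = j then inn S x (e i) else 0)"
      unfolding iq[OF that e(1)] by (rule sum.cong) (simp_all add: e(2))
    then show ?thesis by simp
  qed
  have eq: "inn S (e j) (fsum e e n x) = (if j < n then cnj (inn S x (e j)) else 0)" if "x \<in> car S" for n x j
    unfolding inn_cnj[OF qc[OF that] e(1)] qe[OF that] by simp
  have qq: "inn S (fsum e e m x) (fsum e e n x) = complex_of_real (s x (min m n))" if x: "x \<in> car S" for m n x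
  proof -
    have "inn S (fsum e e m x) (fsum e e n x) =
        (\<Sum>i<m. if i < n then complex_of_real ((cmod (inn S x (e i)))\<^sup>2) else 0)"
      unfolding iq[OF x qc[OF x]] by (rule sum.cong) (simp_all only: eq[OF x] complex_norm_square, simp)
    also have "\<dots> = (\<Sum>i\<in>{..<m} \<inter> {i. i < n}. complex_of_real ((cmod (inn S x (e i)))\<^sup>2))"
      by (simp only: sum.inter_restrict[OF finite_lessThan] mem_Collect_eq)
    also have "{..<m} \<inter> {i. i < n} = {..<min m n}" by auto
    finally show ?thesis by (simp add: s_def)
  qed
  have mono: "s x m \<le> s x n" if "m \<le> n" for x m n
    unfolding s_def by (rule sum_mono2) (use that in auto)
  \<comment> \<open>The projections are nested, so squared distances are differences of squared
    norms.\<close>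
  have diff: "(hnorm S (hsub S (fsum e e m x) (fsum e e n x)))\<^sup>2 = \<bar>s x m - s x n\<bar>" if x: "x \<in> car S" for m n x
    using x mono[of m n x] mono[of n m x]
    by (simp add: hnorm_power2 qc qq min_def)
  have bessel: "s x n \<le> (hnorm S x)\<^sup>2" if x: "x \<in> car S" for n x
  proof -
    have "inn S (fsum e e n x) x = complex_of_real (s x n)"
      unfolding iq[OF x x] s_def of_real_sum
      by (rule sum.cong) (simp_all add: inn_cnj[OF x e(1)] complex_norm_square del: of_real_power)
    moreover have "inn S x (fsum e e n x) = complex_of_real (s x n)"
      unfolding inn_cnj[OF qc[OF x] x] calculation by simp
    ultimately have "(hnorm S (hsub S x (fsum e e n x)))\<^sup>2 = (hnorm S x)\<^sup>2 - s x n"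
      using x by (simp add: hnorm_power2 qc qq)
    then show ?thesis using zero_le_power2[of "hnorm S (hsub S x (fsum e e n x))"] by linarith
  qed
  have "\<exists>Y\<in>car S. (\<lambda>n. hnorm S (hsub S (fsum e e n x) Y)) \<longlonglongrightarrow> 0" if x: "x \<in> car S" for x
  proof (rule complete)
    fix r :: real assume r: "0 < r"
    \<comment> \<open>Squared norms are increasing and bounded by Bessel's inequality, hence Cauchy;
      by \<open>diff\<close> the expansions themselves are Cauchy.\<close>
    have "Bseq (s x)"
      by (rule BseqI'[of _ "(hnorm S x)\<^sup>2"]) (use bessel[OF x] in \<open>simp add: s_def sum_nonneg\<close>)
    moreover have "incseq (s x)" using mono by (simp add: incseq_def)
    ultimately have "Cauchy (s x)"
      by (intro convergent_Cauchy Bseq_monoseq_convergent) (auto simp: monoseq_iff)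
    then obtain N where N: "\<And>m n. m \<ge> N \<Longrightarrow> n \<ge> N \<Longrightarrow> norm (s x m - s x n) < r\<^sup>2"
      using CauchyD[of "s x" "r\<^sup>2"] r by auto
    have "hnorm S (hsub S (fsum e e m x) (fsum e e n x)) < r" if "m \<ge> N" "n \<ge> N" for m n
      using power_less_imp_less_base[of "hnorm S (hsub S (fsum e e m x) (fsum e e n x))" 2 r]
        N[OF that] diff[OF x, of m n] r by simp
    then show "\<exists>N. \<forall>m\<ge>N. \<forall>n\<ge>N. hnorm S (hsub S (fsum e e m x) (fsum e e n x)) < r" by blast
  qed (rule qc[OF x])
  then obtain p where p: "\<And>x. x \<in> car S \<Longrightarrow> p x \<in> car S"
    "\<And>x. x \<in> car S \<Longrightarrow> (\<lambda>n. hnorm S (hsub S (fsum e e n x) (p x))) \<longlonglongrightarrow> 0" by metis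
  define P where "P = restrict p (car S)"
  \<comment> \<open>Norm convergence gives convergence of inner products with a fixed vector. As
    these separate points, the linearity of \<open>p\<close> and its values at the
    \<open>e n\<close> can be read off from the approximants.\<close>
  have pl: "(\<lambda>n. inn S (fsum e e n x) z) \<longlonglongrightarrow> inn S (p x) z" if x: "x \<in> car S" and z: "z \<in> car S" for x z
  proof -
    have "(\<lambda>n. inn S (fsum e e n x) z - inn S (p x) z) \<longlonglongrightarrow> 0"
    proof (rule Lim_null_comparison)
      show "\<forall>\<^sub>F n in sequentially. norm (inn S (fsum e e n x) z - inn S (p x) z) \<le>
          hnorm S (hsub S (fsum e e n x) (p x)) * hnorm S z"
        using Cauchy_Schwarz[OF hsub_closed[OF qc[OF x] p(1)[OF x]] z] x z
        by (intro always_eventually allI) (simp add: qc p(1))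
      show "(\<lambda>n. hnorm S (hsub S (fsum e e n x) (p x)) * hnorm S z) \<longlonglongrightarrow> 0"
        by (rule tendsto_mult_left_zero[OF p(2)[OF x]])
    qed
    from tendsto_add[OF this tendsto_const[of "inn S (p x) z"]] show ?thesis by simp
  qed
  have padd: "p (add S x y) = add S (p x) (p y)" if x: "x \<in> car S" and y: "y \<in> car S" for x y
  proof (rule eqI)
    fix z assume z: "z \<in> car S"
    have "(\<lambda>n. inn S (fsum e e n (add S x y)) z) \<longlonglongrightarrow> inn S (p x) z + inn S (p y) z"
      using tendsto_add[OF pl[OF x z] pl[OF y z]] x y z e(1)
      by (simp add: iq sum.distrib algebra_simps)
    with pl[of "add S x y" z] show "inn S (p (add S x y)) z = inn S (add S (p x) (p y)) z"
      using LIMSEQ_unique x y z p(1) by (metis add_closed inn_add)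
  qed (use x y p(1) in auto)
  have pscl: "p (scl S c x) = scl S c (p x)" if x: "x \<in> car S" for c x
  proof (rule eqI)
    fix z assume z: "z \<in> car S"
    have "(\<lambda>n. inn S (fsum e e n (scl S c x)) z) \<longlonglongrightarrow> c * inn S (p x) z"
      using tendsto_mult_left[OF pl[OF x z], of c] x z e(1)
      by (simp add: iq sum_distrib_left mult.assoc)
    with pl[of "scl S c x" z] show "inn S (p (scl S c x)) z = inn S (scl S c (p x)) z"
      using LIMSEQ_unique x z p(1) by (metis scl_closed inn_scl)
  qed (use x p(1) in auto)
  have pbd: "hnorm S (p x) \<le> 1 * hnorm S x" if x: "x \<in> car S" for x
  proof -
    \<comment> \<open>The partial expansions do not exceed \<open>x\<close> in norm, and their
      distance to \<open>p x\<close> tends to 0.\<close>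
    have "hnorm S (p x) \<le> hnorm S (hsub S (fsum e e n x) (p x)) + hnorm S x" for n
    proof -
      have "(hnorm S (fsum e e n x))\<^sup>2 \<le> (hnorm S x)\<^sup>2"
        using bessel[OF x, of n] by (simp add: hnorm_power2[OF qc[OF x]] qq[OF x])
      then have "hnorm S (fsum e e n x) \<le> hnorm S x" by (rule power2_le_imp_le) (use x in simp)
      then show ?thesis
        using hnorm_le_hsub[OF p(1)[OF x] qc[OF x], of n] hnorm_hsub_commute[OF p(1)[OF x] qc[OF x], of n] by linarith
    qed
    moreover have "(\<lambda>n. hnorm S (hsub S (fsum e e n x) (p x)) + hnorm S x) \<longlonglongrightarrow> 0 + hnorm S x"
      by (intro tendsto_add p(2)[OF x] tendsto_const)
    ultimately show ?thesis using LIMSEQ_le_const by fastforce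
  qed
  have "\<exists>B. \<forall>x\<in>car S. hnorm S (p x) \<le> B * hnorm S x" using pbd by blast
  then have "P \<in> bounded_ops S"
    unfolding bounded_ops_def P_def using p(1) padd pscl by simp
  moreover have "(\<lambda>n. hnorm S (hsub S (restrict (fsum e e n) (car S) x) (P x))) \<longlonglongrightarrow> 0" if "x \<in> car S" for x
    using p(2)[OF that] that by (simp add: P_def)
  ultimately have "P \<in> A" by (rule strong_limit_mem[OF A Q])
  moreover have "P (e n) = e n" for n
  proof -
    have "inn S (p (e n)) z = inn S (e n) z" if z: "z \<in> car S" for z
    proof (rule LIMSEQ_unique[OF pl[OF e(1) z]])
      have "inn S (fsum e e m (e n)) z = inn S (e n) z" if "m > n" for m
      proof -
        have "inn S (fsum e e m (e n)) z = (\<Sum>i<m. if i = n then inn S (e n) z else 0)"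
          unfolding iq[OF e(1) z] by (rule sum.cong) (simp_all add: e(2))
        then show ?thesis using that by simp
      qed
      then show "(\<lambda>m. inn S (fsum e e m (e n)) z) \<longlonglongrightarrow> inn S (e n) z"
        by (intro tendsto_eventually eventually_mono[OF eventually_gt_at_top[of n]])
    qed
    then have "p (e n) = e n" by (intro eqI p(1) e(1))
    then show ?thesis by (simp add: P_def e(1))
  qed
  moreover have "hnorm S (P x) = 0" if x: "x \<in> car S" "\<forall>n. inn S x (e n) = 0" for x
  proof -
    have "inn S (fsum e e n x) (p x) = 0" for n
      using x(2) by (simp add: iq[OF x(1) p(1)[OF x(1)]])
    then have "inn S (p x) (p x) = 0"
      using LIMSEQ_unique[OF pl[OF x(1) p(1)[OF x(1)]]] by simp
    then show ?thesis using x(1) p(1) by (simp add: P_def inn_self)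
  qed
  ultimately show ?thesis by blast
qed

end

context internal_hilbert
begin

section \<open>Finite-rank operators and finite internal dimension\<close>

lemma set_code_vectors:
  assumes "q \<in> K" "B \<subseteq> car (sp q)"
  shows "set_code B \<in> M" "{x. mem U x (set_code B)} = B"
proof -
  have B: "B \<subseteq> level U k" using sp_level[OF assms(1)] assms(2) by blast
  have "set_code B \<in> level U (Suc k)" by (rule set_code_level[OF B]) simp
  then show "set_code B \<in> M" unfolding M_def using level_mono[of "Suc k" "k + 5"] by auto
  show "{x. mem U x (set_code B)} = B" using mem_set_code[OF B] by simp
qed

text \<open>The number of summands is standard, so ordinary induction with one rank-one update per
  step suffices.\<close>

lemma rep_fsum:
  assumes "\<And>i. i < n \<Longrightarrow> e i \<in> fin" "\<And>i. i < n \<Longrightarrow> f i \<in> fin"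
  shows "\<exists>a\<in>op_fin. \<forall>X\<in>car HS. rep a X = hull.fsum (\<lambda>i. vhat U H (e i)) (\<lambda>i. vhat U H (f i)) n X"
  using assms
proof (induction n)
  case 0
  then show ?case using rep_zero by simp
next
  case (Suc n)
  then obtain a where a: "a \<in> op_fin"
      "\<forall>X\<in>car HS. rep a X = hull.fsum (\<lambda>i. vhat U H (e i)) (\<lambda>i. vhat U H (f i)) n X" by auto
  from rep_upd[OF a(1) Suc.prems(1)[OF lessI] Suc.prems(2)[OF lessI]] obtain b where
    "b \<in> op_fin" "\<forall>X\<in>car HS. rep b X = add HS (rep a X) (scl HS (inn HS X (vhat U H (e n))) (vhat U H (f n)))"
    by blast
  then show ?case using a(2) by (intro bexI[of _ b]) auto
qed

lemma unit_fin:
  assumes "x \<in> ivec U H" "\<forall>\<^sub>F g in FF. inn (Sp g) (g x) (g x) = 1" shows "x \<in> fin"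
  by (rule finI[OF assms(1), of 1]) (rule eventually_mono[OF assms(2)], simp add: hnorm_def)

lemma hull_algebra_finite_dim:
  assumes "\<forall>\<^sub>F g in FF. has_hilbert_dim (Sp g) n"
  shows "hull_algebra U H = bounded_ops HS"
proof
  show "hull_algebra U H \<subseteq> bounded_ops HS"
    unfolding hull_algebra_eq using rep_bounded by blast
  \<comment> \<open>A basis as a whole is coded by one element of \<open>M\<close>, so a single
    internal point \<open>s\<close> can carry bases of almost all spaces.\<close>
  define B where "B s = {x. mem U x s}" for s
  have "\<forall>\<^sub>F g in FF. \<exists>s\<in>M. orthonormal_basis_on (Sp g) (B s) \<and> finite (B s) \<and> card (B s) = n"
    using eventually_K assms
  proof eventually_elim
    case (elim g)
    then obtain C where C: "orthonormal_basis_on (Sp g) C" "finite C" "card C = n"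
      by (auto simp: has_hilbert_dim_def)
    then have "C \<subseteq> car (Sp g)" by (simp add: orthonormal_basis_on_def orthonormal_on_def)
    from set_code_vectors[OF elim(1) this] C show ?case by (intro bexI[of _ "set_code C"]) (auto simp: B_def)
  qed
  from choice1[OF H_D, of "\<lambda>q s. orthonormal_basis_on (sp q) (B s) \<and> finite (B s) \<and> card (B s) = n", OF this]
  obtain s where s: "s \<in> D"
    "\<forall>\<^sub>F g in FF. orthonormal_basis_on (Sp g) (B (g s)) \<and> finite (B (g s)) \<and> card (B (g s)) = n" by blast
  \<comment> \<open>The enumeration depends on the code alone, so its \<open>i\<close>-th vector is
    a function of \<open>g s\<close> and can be realised by an internal point
    \<open>e i\<close>.\<close>
  define b where "b s = (SOME b. bij_betw b {..<n} (B s))" for s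
  have bij: "\<forall>\<^sub>F g in FF. bij_betw (b (g s)) {..<n} (B (g s))"
    using s(2)
  proof eventually_elim
    case (elim g)
    then have "\<exists>b. bij_betw b {..<n} (B (g s))"
      using finite_same_card_bij[of "{..<n}" "B (g s)"] by auto
    then show ?case unfolding b_def by (rule someI_ex)
  qed
  have bc: "\<forall>\<^sub>F g in FF. b (g s) i \<in> car (Sp g) \<and> inn (Sp g) (b (g s) i) (b (g s) i) = 1" if "i < n" for i
    using s(2) bij
  proof eventually_elim
    case (elim g)
    then have "b (g s) i \<in> B (g s)" using that by (auto simp: bij_betw_def)
    then show ?case using elim(1) by (auto simp: orthonormal_basis_on_def orthonormal_on_def)
  qed
  have "\<exists>w\<in>D. \<forall>\<^sub>F g in FF. g w = b (g s) i" if "i < n" for i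
  proof (rule choice1[OF s(1)])
    show "\<forall>\<^sub>F g in FF. \<exists>w\<in>M. w = b (g s) i"
      using eventually_K bc[OF that] by eventually_elim (use sp_M in blast)
  qed
  then have "\<exists>e. \<forall>i. i < n \<longrightarrow> e i \<in> D \<and> (\<forall>\<^sub>F g in FF. g (e i) = b (g s) i)"
    by (intro choice) blast
  then obtain e where e: "\<And>i. i < n \<Longrightarrow> e i \<in> D" "\<And>i. i < n \<Longrightarrow> \<forall>\<^sub>F g in FF. g (e i) = b (g s) i"
    by blast
  have ef: "e i \<in> fin" if "i < n" for i
  proof (rule unit_fin)
    show "e i \<in> ivec U H" unfolding ivec_iff
      using e(1)[OF that] eventually_conj[OF bc[OF that] e(2)[OF that]] by (auto elim: eventually_mono)
    show "\<forall>\<^sub>F g in FF. inn (Sp g) (g (e i)) (g (e i)) = 1"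
      using bc[OF that] e(2)[OF that] by eventually_elim simp
  qed
  let ?e = "\<lambda>i. vhat U H (e i)"
  have eH: "?e i \<in> car HS" if "i < n" for i using ef[OF that] by (rule vhat_HS)
  have all_e: "\<forall>\<^sub>F g in FF. \<forall>i\<in>{..<n}. g (e i) = b (g s) i"
    by (rule eventually_ball_finite) (use e(2) in auto)
  \<comment> \<open>As \<open>n\<close> is standard, the \<open>n\<close> eventual equalities for
    the \<open>e i\<close> hold simultaneously and the limit passes through the sum.\<close>
  have parseval: "li x y = (\<Sum>i<n. li x (e i) * li (e i) y)" if x: "x \<in> fin" and y: "y \<in> fin" for x y
  proof (rule li_eqI)
    have "\<forall>\<^sub>F g in FF. (\<Sum>i<n. inn (Sp g) (g x) (g (e i)) * inn (Sp g) (g (e i)) (g y)) = inn (Sp g) (g x) (g y)"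
      using eventually_ips all_e bij s(2) fin_car[OF x] fin_car[OF y]
    proof eventually_elim
      case (elim g)
      have "inn (Sp g) (g x) (g y) = (\<Sum>i<n. inn (Sp g) (g x) (b (g s) i) * inn (Sp g) (b (g s) i) (g y))"
        using inner_product_space.orthonormal_basis_inn[OF elim(1) conjunct1[OF elim(4)] elim(3,5,6)] .
      then show ?case using elim(2) by simp
    qed
    moreover have "((\<lambda>g. \<Sum>i<n. inn (Sp g) (g x) (g (e i)) * inn (Sp g) (g (e i)) (g y)) \<longlongrightarrow>
        (\<Sum>i<n. li x (e i) * li (e i) y)) FF"
      by (intro tendsto_sum tendsto_mult li_tendsto x y ef) auto
    ultimately show "((\<lambda>g. inn (Sp g) (g x) (g y)) \<longlongrightarrow> (\<Sum>i<n. li x (e i) * li (e i) y)) FF"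
      by (rule Lim_transform_eventually[rotated])
  qed
  have X_eq: "X = hull.fsum ?e ?e n X" if X: "X \<in> car HS" for X
  proof (rule hull.eqI[OF X])
    show "hull.fsum ?e ?e n X \<in> car HS" using X eH by (rule hull.fsum_closed)
    fix Z assume Z: "Z \<in> car HS"
    obtain x z where xz: "x \<in> fin" "X = vhat U H x" "z \<in> fin" "Z = vhat U H z"
      using X Z by (auto simp: car_HS)
    have "inn HS (hull.fsum ?e ?e n X) Z = (\<Sum>i<n. inn HS X (?e i) * inn HS (?e i) Z)"
      by (rule hull.inn_fsum[OF X eH Z])
    also have "\<dots> = (\<Sum>i<n. li x (e i) * li (e i) z)"
      by (rule sum.cong) (use xz ef in \<open>auto simp: inn_HS\<close>)
    also have "\<dots> = inn HS X Z" using parseval[OF xz(1,3)] by (simp add: xz inn_HS)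
    finally show "inn HS X Z = inn HS (hull.fsum ?e ?e n X) Z" ..
  qed
  show "bounded_ops HS \<subseteq> hull_algebra U H"
  proof
    fix T assume T: "T \<in> bounded_ops HS"
    have "\<exists>f. \<forall>i. i < n \<longrightarrow> f i \<in> fin \<and> T (?e i) = vhat U H (f i)"
      using hull.bounded_opsD(1)[OF T eH] by (intro choice) (auto simp: car_HS)
    then obtain f where f: "\<And>i. i < n \<Longrightarrow> f i \<in> fin" "\<And>i. i < n \<Longrightarrow> T (?e i) = vhat U H (f i)" by blast
    obtain a where a: "a \<in> op_fin" "\<And>X. X \<in> car HS \<Longrightarrow> rep a X = hull.fsum ?e (\<lambda>i. vhat U H (f i)) n X"
      using rep_fsum[of n e f, OF ef f(1)] by blast
    have "T = rep a"
    proof (rule extensionalityI[OF hull.bounded_opsD(4)[OF T] hull.bounded_opsD(4)[OF rep_bounded[OF a(1)]]])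
      fix X assume X: "X \<in> car HS"
      have "T X = T (hull.fsum ?e ?e n X)" using X_eq[OF X] by simp
      also have "\<dots> = hull.fsum ?e (\<lambda>i. T (?e i)) n X" by (rule hull.bounded_ops_fsum[OF T X eH])
      also have "\<dots> = hull.fsum ?e (\<lambda>i. vhat U H (f i)) n X"
        using f(2) by (induction n) (auto simp: less_Suc_eq)
      also have "\<dots> = rep a X" using a(2)[OF X] by simp
      finally show "T X = rep a X" .
    qed
    then show "T \<in> hull_algebra U H" unfolding hull_algebra_eq using a(1) by blast
  qed
qed

section \<open>Infinite internal dimension\<close>

lemma ex_orthonormal_sequence:
  assumes "\<And>n. \<not> (\<forall>\<^sub>F g in FF. has_hilbert_dim (Sp g) n)"
  shows "\<exists>e :: nat \<Rightarrow> 'v. (\<forall>n. e n \<in> ivec U H) \<and>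
    (\<forall>m n. \<forall>\<^sub>F g in FF. inn (Sp g) (g (e m)) (g (e n)) = (if m = n then 1 else 0))"
proof -
  define B where "B s = {x. mem U x s}" for s
  define ON where "ON n q s \<longleftrightarrow> orthonormal_on (sp q) (B s) \<and> finite (B s) \<and> card (B s) = n" for n q s
  have ON_car: "x \<in> car (sp q)" if "ON n q s" "x \<in> B s" for n q s x
    using that by (auto simp: ON_def orthonormal_on_def)
  have ON_inn: "inn (sp q) x y = (if x = y then 1 else 0)" if "ON n q s" "x \<in> B s" "y \<in> B s" for n q s x y
    using that by (simp add: ON_def orthonormal_on_def)
  \<comment> \<open>Failure to have dimension \<open>n\<close> eventually becomes eventual failure,
    since the dimension depends only on the value of \<open>g\<close> at \<open>H\<close>.\<close>
  have nd: "\<forall>\<^sub>F g in FF. \<not> has_hilbert_dim (Sp g) n" for n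
    using ultra2[OF H_D H_D, of "\<lambda>q _. has_hilbert_dim (sp q) n"] assms[of n] by blast
  \<comment> \<open>The values of \<open>f n\<close> code orthonormal sets of \<open>n\<close>
    vectors. They are made to increase with \<open>n\<close>, so that vectors picked from
    consecutive differences are distinct members of a common orthonormal set.\<close>
  have "\<exists>f. \<forall>n. (f n \<in> D \<and> (\<forall>\<^sub>F g in FF. ON n (g H) (g (f n)))) \<and>
      (\<forall>\<^sub>F g in FF. B (g (f n)) \<subseteq> B (g (f (Suc n))))"
  proof (rule dependent_nat_choice)
    have "\<forall>\<^sub>F g in FF. \<exists>s\<in>M. ON 0 (g H) s"
      using eventually_K
    proof eventually_elim
      case (elim g)
      from set_code_vectors[OF elim, of "{}"] show ?case
        by (intro bexI[of _ "set_code {}"]) (simp_all add: ON_def B_def orthonormal_on_def)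
    qed
    from choice1[OF H_D, of "ON 0", OF this]
    show "\<exists>s. s \<in> D \<and> (\<forall>\<^sub>F g in FF. ON 0 (g H) (g s))" by blast
  next
    fix s n assume s: "s \<in> D \<and> (\<forall>\<^sub>F g in FF. ON n (g H) (g s))"
    have "\<forall>\<^sub>F g in FF. \<exists>t\<in>M. ON (Suc n) (g H) t \<and> B (g s) \<subseteq> B t"
      using eventually_K conjunct2[OF s] nd[of n]
    proof eventually_elim
      case (elim g)
      have on: "orthonormal_on (Sp g) (B (g s))" "finite (B (g s))" "card (B (g s)) = n"
        using elim(2) by (simp_all add: ON_def)
      \<comment> \<open>An orthonormal set of \<open>n\<close> vectors cannot be maximal, as
        otherwise the space would have dimension \<open>n\<close>.\<close>
      then obtain C where C: "orthonormal_on (Sp g) C" "B (g s) \<subseteq> C" "C \<noteq> B (g s)"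
        using elim(3) unfolding has_hilbert_dim_def orthonormal_basis_on_def by metis
      then obtain u where u: "u \<in> C" "u \<notin> B (g s)" by blast
      have on': "orthonormal_on (Sp g) (insert u (B (g s)))"
        unfolding orthonormal_on_def
      proof (intro conjI ballI)
        have sub: "insert u (B (g s)) \<subseteq> C" using C(2) u(1) by simp
        then show "insert u (B (g s)) \<subseteq> car (Sp g)" using C(1) by (auto simp: orthonormal_on_def)
        show "inn (Sp g) x y = (if x = y then 1 else 0)"
          if "x \<in> insert u (B (g s))" "y \<in> insert u (B (g s))" for x y
          using C(1) subsetD[OF sub that(1)] subsetD[OF sub that(2)] by (simp add: orthonormal_on_def)
      qed
      then have "insert u (B (g s)) \<subseteq> car (Sp g)" by (simp add: orthonormal_on_def)
      from set_code_vectors[OF elim(1) this] on' on(2,3) u(2) show ?case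
        by (intro bexI[of _ "set_code (insert u (B (g s)))"]) (auto simp: ON_def B_def)
    qed
    from choice2[OF H_D conjunct1[OF s], of "\<lambda>q s t. ON (Suc n) q t \<and> B s \<subseteq> B t", OF this]
    show "\<exists>t. (t \<in> D \<and> (\<forall>\<^sub>F g in FF. ON (Suc n) (g H) (g t))) \<and> (\<forall>\<^sub>F g in FF. B (g s) \<subseteq> B (g t))"
      by (auto simp: eventually_conj_iff)
  qed
  then obtain s where s: "\<And>n. s n \<in> D" "\<And>n. \<forall>\<^sub>F g in FF. ON n (g H) (g (s n))"
    "\<And>n. \<forall>\<^sub>F g in FF. B (g (s n)) \<subseteq> B (g (s (Suc n)))" by blast
  have "\<exists>w\<in>D. \<forall>\<^sub>F g in FF. g w \<in> B (g (s (Suc n))) - B (g (s n))" for n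
  proof (rule choice2[OF s(1) s(1), of "\<lambda>s t w. w \<in> B t - B s"])
    show "\<forall>\<^sub>F g in FF. \<exists>w\<in>M. w \<in> B (g (s (Suc n))) - B (g (s n))"
      using eventually_K s(2)[of n] s(2)[of "Suc n"] s(3)[of n]
    proof eventually_elim
      case (elim g)
      have "B (g (s n)) \<noteq> B (g (s (Suc n)))" using elim(2,3) by (auto simp: ON_def)
      then obtain w where "w \<in> B (g (s (Suc n))) - B (g (s n))" using elim(4) by blast
      moreover have "w \<in> car (Sp g)" using ON_car[OF elim(3)] calculation by simp
      ultimately show ?case using sp_M[OF elim(1)] by blast
    qed
  qed
  then have "\<forall>n. \<exists>w. w \<in> D \<and> (\<forall>\<^sub>F g in FF. g w \<in> B (g (s (Suc n))) - B (g (s n)))"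
    by (intro allI) (simp only: bex_simps Bex_def)
  from choice[OF this] obtain e where
    e': "\<forall>n. e n \<in> D \<and> (\<forall>\<^sub>F g in FF. g (e n) \<in> B (g (s (Suc n))) - B (g (s n)))" by (elim exE)
  have e: "e n \<in> D" "\<forall>\<^sub>F g in FF. g (e n) \<in> B (g (s (Suc n))) - B (g (s n))" for n
    by (rule conjunct1[OF e'[THEN spec]], rule conjunct2[OF e'[THEN spec]])
  have mono: "\<forall>\<^sub>F g in FF. B (g (s m)) \<subseteq> B (g (s n))" if "m \<le> n" for m n
    using that
  proof (induction rule: dec_induct)
    case (step n)
    show ?case using step.IH s(3)[of n] by eventually_elim blast
  qed simp
  have ev: "e n \<in> ivec U H" for n
  proof -
    have "\<forall>\<^sub>F g in FF. g (e n) \<in> car (Sp g)"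
      using s(2)[of "Suc n"] e(2)[of n] by eventually_elim (rule ON_car, auto)
    then show ?thesis using e(1) by (simp add: ivec_iff)
  qed
  have lt: "\<forall>\<^sub>F g in FF. g (e m) \<noteq> g (e n) \<and> g (e m) \<in> B (g (s (Suc n))) \<and> g (e n) \<in> B (g (s (Suc n)))"
    if "m < n" for m n
  proof -
    have "\<forall>\<^sub>F g in FF. B (g (s (Suc m))) \<subseteq> B (g (s n))" by (rule mono) (use that in simp)
    then show ?thesis using s(3)[of n] e(2)[of m] e(2)[of n]
    proof eventually_elim
      case (elim g)
      have "g (e m) \<in> B (g (s n))" using elim(1,3) by (auto dest: subsetD)
      moreover have "g (e n) \<notin> B (g (s n))" "g (e n) \<in> B (g (s (Suc n)))" using elim(4) by simp_all
      ultimately show ?case using subsetD[OF elim(2)] by metis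
    qed
  qed
  have orth: "\<forall>\<^sub>F g in FF. inn (Sp g) (g (e m)) (g (e n)) = (if m = n then 1 else 0)" for m n
  proof (cases m n rule: linorder_cases)
    case less
    show ?thesis using lt[OF less] s(2)[of "Suc n"]
    proof eventually_elim
      case (elim g)
      then show ?case using ON_inn[OF elim(2), of "g (e m)" "g (e n)"] less by simp
    qed
  next
    case equal
    show ?thesis using e(2)[of n] s(2)[of "Suc n"]
    proof eventually_elim
      case (elim g)
      then show ?case using ON_inn[OF elim(2), of "g (e m)" "g (e n)"] equal by simp
    qed
  next
    case greater
    show ?thesis using lt[OF greater] s(2)[of "Suc m"]
    proof eventually_elim
      case (elim g)
      then show ?case using ON_inn[OF elim(2), of "g (e m)" "g (e n)"] greater by (simp add: eq_commute[of "g (e m)"])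
    qed
  qed
  show ?thesis using ev orth by blast
qed

text \<open>If the projection onto the closed span of the \<open>vhat U H (e n)\<close> came from an internal operator \<open>a\<close>,
  then saturation would give a unit vector that is almost fixed by \<open>a\<close> but orthogonal to all \<open>e n\<close>.\<close>

lemma hull_algebra_infinite_dim:
  assumes nd: "\<And>n. \<not> (\<forall>\<^sub>F g in FF. has_hilbert_dim (Sp g) n)"
  shows "\<not> is_von_neumann_algebra HS (hull_algebra U H)"
proof
  assume "is_von_neumann_algebra HS (hull_algebra U H)"
  then have closed: "closedin (strong_operator_topology HS) (hull_algebra U H)"
    by (simp add: is_von_neumann_algebra_def)
  obtain e :: "nat \<Rightarrow> 'v" where e: "\<And>n. e n \<in> ivec U H"
    "\<And>m n. \<forall>\<^sub>F g in FF. inn (Sp g) (g (e m)) (g (e n)) = (if m = n then 1 else 0)"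
    using ex_orthonormal_sequence[OF nd] by blast
  have ef: "e n \<in> fin" for n by (rule unit_fin[OF e(1)]) (use e(2)[of n n] in simp)
  let ?e = "\<lambda>n. vhat U H (e n)"
  have eH: "?e n \<in> car HS" for n by (rule vhat_HS[OF ef])
  have eo: "inn HS (?e m) (?e n) = (if m = n then 1 else 0)" for m n
    unfolding inn_HS[OF ef ef] by (rule li_eqI[OF tendsto_eventually[OF e(2)]])
  have "restrict (hull.fsum ?e ?e n) (car HS) \<in> hull_algebra U H" for n
  proof -
    obtain a where a: "a \<in> op_fin" "\<And>X. X \<in> car HS \<Longrightarrow> rep a X = hull.fsum ?e ?e n X"
      using rep_fsum[of n e e] ef by blast
    have "restrict (hull.fsum ?e ?e n) (car HS) = rep a"
      by (rule extensionalityI[OF _ hull.bounded_opsD(4)[OF rep_bounded[OF a(1)]]]) (use a(2) in auto)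
    then show ?thesis unfolding hull_algebra_eq using a(1) by blast
  qed
  from hull.projection_in_closure[OF closed HS_Cauchy_convergent eH eo this]
  obtain a where a: "a \<in> op_fin" "\<And>n. rep a (?e n) = ?e n"
    "\<And>X. X \<in> car HS \<Longrightarrow> (\<And>n. inn HS X (?e n) = 0) \<Longrightarrow> hnorm HS (rep a X) = 0"
    unfolding hull_algebra_eq by blast
  note ai = op_fin_iops[OF a(1)]
  let ?P = "\<lambda>(n::nat) us x. let S = sp (us ! 0) in x \<in> car S \<and> inn S x x = 1 \<and> inn S x (us ! 2) = 0 \<and>
      hnorm S (hsub S (opf (us ! 0) (us ! 1) x) x) < 1 / real (Suc n)"
  have "\<exists>x\<in>D. \<forall>n. \<forall>\<^sub>F g in FF. ?P n (map g [H, a, e n]) (g x)"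
  proof (rule saturated_list[where a = 3])
    show "\<exists>x\<in>D. \<forall>n\<le>N. \<forall>\<^sub>F g in FF. g x \<in> level U (k + 4) \<and> ?P n (map g [H, a, e n]) (g x)" for N
    proof (intro bexI allI impI)
      \<comment> \<open>This unit vector is orthogonal to \<open>e 0\<close>, ...,
        \<open>e N\<close> and, because its class is fixed by the projection, it is moved by
        \<open>a\<close> only infinitesimally.\<close>
      let ?x = "e (Suc N)"
      show "?x \<in> D" by (rule ivec_D[OF e(1)])
      fix n assume n: "n \<le> N"
      have "near (iapp U H a ?x) ?x"
        using a(2)[of "Suc N"] rep_vhat[OF a(1) ef] vhat_eq_iff[OF fin_ivec[OF iapp_fin[OF a(1) ef]] e(1)] by simp
      from order_tendstoD(2)[OF this[unfolded near_def], of "1 / real (Suc n)"]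
      have "\<forall>\<^sub>F g in FF. hnorm (Sp g) (hsub (Sp g) (g (iapp U H a ?x)) (g ?x)) < 1 / real (Suc n)" by simp
      then show "\<forall>\<^sub>F g in FF. g ?x \<in> level U (k + 4) \<and> ?P n (map g [H, a, e n]) (g ?x)"
        using eventually_K ivec_car[OF e(1), of "Suc N"] e(2)[of "Suc N" "Suc N"] e(2)[of "Suc N" n]
          iapp_spec(2)[OF ai e(1), of "Suc N"]
      proof eventually_elim
        case (elim g)
        have "g ?x \<in> level U (k + 4)" using sp_level[OF elim(2)] elim(3) level_mono[of k "k + 4"] by auto
        then show ?case using elim n by (simp add: Let_def)
      qed
    qed
  qed (use e(1) ivec_D ai iops_D H_D in \<open>auto simp: arity_def\<close>)
  then obtain x where x: "x \<in> D" "\<And>n. \<forall>\<^sub>F g in FF. ?P n (map g [H, a, e n]) (g x)" by blast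
  have x1: "\<forall>\<^sub>F g in FF. g x \<in> car (Sp g)" "\<forall>\<^sub>F g in FF. inn (Sp g) (g x) (g x) = 1"
    using x(2)[of 0] by (auto simp: Let_def elim: eventually_mono)
  have xo: "\<forall>\<^sub>F g in FF. inn (Sp g) (g x) (g (e n)) = 0"
    and xa: "\<forall>\<^sub>F g in FF. hnorm (Sp g) (hsub (Sp g) (opg g a (g x)) (g x)) < 1 / real (Suc n)" for n
    using x(2)[of n] by (auto simp: Let_def elim: eventually_mono)
  have xv: "x \<in> ivec U H" using x(1) x1(1) by (simp add: ivec_iff)
  have xf: "x \<in> fin" by (rule unit_fin[OF xv x1(2)])
  have X: "vhat U H x \<in> car HS" by (rule vhat_HS[OF xf])
  have norm1: "inn HS (vhat U H x) (vhat U H x) = 1"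
    unfolding inn_HS[OF xf xf] by (rule li_eqI[OF tendsto_eventually[OF x1(2)]])
  have "inn HS (vhat U H x) (?e n) = 0" for n
    unfolding inn_HS[OF xf ef] by (rule li_eqI[OF tendsto_eventually[OF xo]])
  from a(3)[OF X this] have zero: "hnorm HS (rep a (vhat U H x)) = 0" .
  note axf = iapp_fin[OF a(1) xf]
  have "hnorm HS (hsub HS (rep a (vhat U H x)) (vhat U H x)) \<le> 1 / real (Suc n)" for n
    unfolding rep_vhat[OF a(1) xf]
  proof (rule tendsto_upperbound[OF hnorm_hsub_HS_tendsto[OF axf xf] _ FF_nonbot])
    show "\<forall>\<^sub>F g in FF. hnorm (Sp g) (hsub (Sp g) (g (iapp U H a x)) (g x)) \<le> 1 / real (Suc n)"
      using xa[of n] iapp_spec(2)[OF ai xv] by eventually_elim simp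
  qed
  \<comment> \<open>The class of \<open>x\<close> has norm 1, while its image has norm 0 and lies
    within \<open>1 / 2\<close> of it; the choice \<open>n = 1\<close> is already
    contradictory.\<close>
  from this[of 1] have "hnorm HS (vhat U H x) \<le> 1 / 2"
    using hull.hnorm_le_hsub[OF X hull.bounded_opsD(1)[OF rep_bounded[OF a(1)] X]] zero
      hull.hnorm_hsub_commute[OF X hull.bounded_opsD(1)[OF rep_bounded[OF a(1)] X]] by simp
  then show False using norm1 by (simp add: hnorm_def)
qed

text \<open>The bounded operators are the whole underlying set of the strong operator
  topology.\<close>

lemma bounded_ops_von_neumann: "is_von_neumann_algebra HS (bounded_ops HS)"
proof -
  interpret Metric_space "car HS" "hdist HS" by (rule hull.metric)
  have "topspace (strong_operator_topology HS) = bounded_ops HS"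
    by (auto simp: strong_operator_topology_def bounded_ops_def)
  then show ?thesis
    unfolding is_von_neumann_algebra_def using closedin_topspace[of "strong_operator_topology HS"] by simp
qed

end

theorem proposition15:
  fixes U :: "('u, 'v) universe" and \<kappa> :: "'k rel" and h :: enat and k :: nat and H :: 'v
  assumes "Card_order \<kappa>" and "natLeq <o \<kappa>"
    and "nonstandard_universe h \<kappa> U"
    and "internal_hilbert_space U k H"
    and "enat (k + 40) \<le> h"
  shows "((\<exists>n::nat. internal_dim U H (star U (rl U (real n)))) \<longleftrightarrow>
            hull_algebra U H = bounded_ops (hull_space U H)) \<and>
         (hull_algebra U H = bounded_ops (hull_space U H) \<longleftrightarrow>
            is_von_neumann_algebra (hull_space U H) (hull_algebra U H))"
proof -
  interpret internal_hilbert U \<kappa> h k H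
    by unfold_locales (rule assms(2-5))+
  \<comment> \<open>The implications close up: finite dimension gives equality, equality gives
    closedness, and closedness is impossible if no standard \<open>n\<close> is the
    dimension.\<close>
  show ?thesis
    using hull_algebra_finite_dim hull_algebra_infinite_dim bounded_ops_von_neumann
    unfolding internal_dim_iff by metis
qed

end
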